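(* Suppose the attachment rule $f$ is regularly varying with index $\alpha<\frac12$. Define $s^*_t$ to be the index of the hub at (artificial) time $t$, and $Z^{\max}_t=Z[s^*_t,t]$ to be the corresponding maximal indegree. Then, in probability as $t\to\infty$, $$s_t^*\sim Z_t^{\max}-t\sim\frac12\,\frac{1-\alpha}{1-2\alpha}\,\frac{t^{\frac{1-2\alpha}{1-\alpha}}}{\bar\ell(t)}=\frac12\,\frac{1-\alpha}{1-2\alpha}\,\frac{t}{\bar f(t)} .$$ Moreover, in probability on $\mathcal L(0,\infty)$, $$\lim_{t\to\infty}\Big(\frac{Z[s^*_t,s^*_t+tu]-tu}{t^{\frac{1-2\alpha}{1-\alpha}}\,\bar\ell(t)^{-1}}\colon u\ge0\Big)=\Big(\frac{1-\alpha}{1-2\alpha}\big(u^{\frac{1-2\alpha}{1-\alpha}}\wedge1\big)\colon u\ge0\Big).$$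
   Context: $\mathbb Z_+=\{0,1,2,\dots\}$, $\mathbb N=\{1,2,\dots\}$. An attachment rule is a monotonically increasing (nondecreasing) function $f:\mathbb Z_+\to(0,\infty)$ with $f(n)\le n+1$ for all $n\in\mathbb Z_+$; it is extended to $[0,\infty)$ by $f(u):=f(\lfloor u\rfloor)$. The network evolves as follows: at time $n=1$ it consists of a single vertex, labelled $1$, without edges. In the step $n\to n+1$ a new vertex labelled $n+1$ is added and, independently for each old vertex $m\in\{1,\dots,n\}$ (given the graph at time $n$), a directed edge $n+1\to m$ is inserted with probability $f(\text{indegree of } m \text{ at time } n)/n$. For $m\le n$, $\mathcal Z[m,n]$ denotes the indegree of vertex $m$ after insertion of vertex $n$. Artificial scales: $\Psi(n)=\sum_{m=1}^{n-1}\frac1m$ for $n\in\mathbb N$, $\Phi(u)=\int_0^u\frac{dv}{f(v)}$ for $u\ge0$ (a bijection of $[0,\infty)$), $\mathbb T=\{\Psi(n):n\in\mathbb N\}$. For $s=\Psi(m)$, $t=\Psi(n)$ with $m\le n$ put $Z[s,t]:=\Phi(\mathcal Z[m,n])$, and for arbitrary real $t\ge0$ put $Z[s,t]:=Z[s,s\vee\max(\mathbb T\cap[0,t])]$. A vertex $m$ is identified with its artificial birth time $s=\Psi(m)\in\mathbb T$; the index $s^*_t$ of the hub at time $t$ is an element $s\in\mathbb T\cap[0,t]$ maximizing $Z[s,t]$ (ties broken by an arbitrary fixed rule). Put $\bar f:=f\circ\Phi^{-1}$. If $f$ is regularly varying with index $\alpha$, then $\bar f(u)=u^{\alpha/(1-\alpha)}\bar\ell(u)$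 for $u>0$ with a slowly varying function $\bar\ell$; this defines $\bar\ell$. $A_t\sim B_t$ in probability means $A_t/B_t\to1$ in probability. $\mathcal L(0,\infty)$ is the space of càdlàg functions $x:(0,\infty)\to\mathbb R$ with the topology of uniform convergence on compact subsets of $(0,\infty)$.
   Formalization: For index α = 0 the attachment rule f is additionally assumed to tend to infinity; for bounded f the claim is false (e.g. f ≡ 1/4 would give s*_t ~ 2t although s*_t ≤ t). *)

theory Defs
  imports "HOL-Probability.Probability"
begin

section \<open>Attachment rules\<close>

definition attachment_rule :: "(nat \<Rightarrow> real) \<Rightarrow> bool" where
  "attachment_rule f \<longleftrightarrow> mono f \<and> (\<forall>n. 0 < f n) \<and> (\<forall>n. f n \<le> real n + 1)"

definition step_ext :: "(nat \<Rightarrow> real) \<Rightarrow> real \<Rightarrow> real" where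
  "step_ext f u = f (nat \<lfloor>u\<rfloor>)"

definition regularly_varying :: "(real \<Rightarrow> real) \<Rightarrow> real \<Rightarrow> bool" where
  "regularly_varying g \<alpha> \<longleftrightarrow>
     (\<forall>c>0. ((\<lambda>u. g (c * u) / g u) \<longlongrightarrow> c powr \<alpha>) at_top)"

text \<open>An attachment rule that varies regularly with a positive index is unbounded. With index
  \<open>0\<close> it may be bounded, and then the asymptotics of the hub are different: if \<open>f\<close> has
  limit \<open>c\<close>, the maximal indegree on the \<open>Phi\<close>-scale is of order \<open>t / (c * ln (1 + 1 / c))\<close>
  rather than \<open>t * (1 + 1 / (2 * c))\<close>, and for \<open>c < 1/2\<close> the value \<open>t / (2 * c)\<close> exceeds every
  possible birth time. Hence the theorem assumes \<open>f \<rightarrow> \<infinity>\<close> if the index is \<open>0\<close>.\<close>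

section \<open>Artificial scales\<close>

definition Psi :: "nat \<Rightarrow> real" where
  "Psi n = (\<Sum>m = 1..<n. 1 / real m)"

definition Phi :: "(nat \<Rightarrow> real) \<Rightarrow> real \<Rightarrow> real" where
  "Phi f u = integral {0..u} (\<lambda>v. 1 / step_ext f v)"

definition art_times :: "real set" where
  "art_times = Psi ` {1..}"

text \<open>The index \<open>n \<ge> 1\<close> with \<open>Psi n = s\<close>, for \<open>s \<in> art_times\<close>.\<close>

definition label :: "real \<Rightarrow> nat" where
  "label s = inv_into {1..} Psi s"

definition last_time :: "real \<Rightarrow> real" where
  "last_time t = Max (art_times \<inter> {0..t})"

definition f_bar :: "(nat \<Rightarrow> real) \<Rightarrow> real \<Rightarrow> real" where
  "f_bar f u = step_ext f (inv_into {0..} (Phi f) u)"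

text \<open>For \<open>u > 0\<close> this is the factor in \<open>f_bar f u = u powr (\<alpha> / (1 - \<alpha>)) * l_bar f \<alpha> u\<close>.\<close>

definition l_bar :: "(nat \<Rightarrow> real) \<Rightarrow> real \<Rightarrow> real \<Rightarrow> real" where
  "l_bar f \<alpha> u = f_bar f u / u powr (\<alpha> / (1 - \<alpha>))"

section \<open>The network\<close>

text \<open>The network at time \<open>n\<close> has vertex set \<open>{1..n}\<close> and is represented by its set of
  directed edges; \<open>(k, m)\<close> is the edge from \<open>k\<close> to \<open>m\<close>.\<close>

type_synonym network = "(nat \<times> nat) set"

definition indegree :: "network \<Rightarrow> nat \<Rightarrow> nat" where
  "indegree g m = card {k. (k, m) \<in> g}"

text \<open>Every edge carries the label of the vertex with which it was inserted, so the network at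
  time \<open>n\<close> determines all earlier ones, and conditioning on it is conditioning on the whole
  past. The conditional law is needed only given networks of positive probability, where it is
  the elementary one.\<close>

definition network_process ::
  "'w measure \<Rightarrow> (nat \<Rightarrow> real) \<Rightarrow> (nat \<Rightarrow> 'w \<Rightarrow> network) \<Rightarrow> bool" where
  "network_process M f G \<longleftrightarrow>
     prob_space M \<and>
     (\<forall>n\<ge>1. G n \<in> measurable M (count_space UNIV)) \<and>
     (\<forall>\<omega>\<in>space M. G 1 \<omega> = {}) \<and>
     (\<forall>n\<ge>1. \<forall>\<omega>\<in>space M. \<exists>A\<subseteq>{1..n}. G (n + 1) \<omega> = G n \<omega> \<union> {n + 1} \<times> A) \<and>
     (\<forall>n\<ge>1. \<forall>g. measure M {\<omega>\<in>space M. G n \<omega> = g} > 0 \<longrightarrow>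
        (let C = uniform_measure M {\<omega>\<in>space M. G n \<omega> = g};
             E = (\<lambda>m. {\<omega>\<in>space M. (n + 1, m) \<in> G (n + 1) \<omega>})
         in prob_space.indep_events C E {1..n} \<and>
            (\<forall>m\<in>{1..n}. measure C (E m) = f (indegree g m) / real n)))"

text \<open>For a network evolution \<open>\<gamma>\<close>, the value \<open>Z f \<gamma> s t\<close> is \<open>Z[s,t]\<close>, the indegree on the
  \<open>Phi\<close>-scale, at the last artificial time before \<open>t\<close>, of the vertex born at \<open>s \<in> art_times\<close>.\<close>

definition Z :: "(nat \<Rightarrow> real) \<Rightarrow> (nat \<Rightarrow> network) \<Rightarrow> real \<Rightarrow> real \<Rightarrow> real" where
  "Z f \<gamma> s t = Phi f (real (indegree (\<gamma> (label (max s (last_time t)))) (label s)))"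

definition hubs :: "(nat \<Rightarrow> real) \<Rightarrow> (nat \<Rightarrow> network) \<Rightarrow> real \<Rightarrow> real set" where
  "hubs f \<gamma> t =
     {s \<in> art_times \<inter> {0..t}. \<forall>s'\<in>art_times \<inter> {0..t}. Z f \<gamma> s' t \<le> Z f \<gamma> s t}"

text \<open>A tie-breaking rule may use the time and the current network, but neither the future
  evolution nor additional randomness; this is the second clause.\<close>

definition hub_index ::
  "'w measure \<Rightarrow> (nat \<Rightarrow> real) \<Rightarrow> (nat \<Rightarrow> 'w \<Rightarrow> network) \<Rightarrow> (real \<Rightarrow> 'w \<Rightarrow> real) \<Rightarrow> bool" where
  "hub_index M f G S \<longleftrightarrow>
     (\<forall>t\<ge>0.
        (\<forall>\<omega>\<in>space M. S t \<omega> \<in> hubs f (\<lambda>n. G n \<omega>) t) \<and>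
        (\<forall>\<omega>\<in>space M. \<forall>\<omega>'\<in>space M.
           G (label (last_time t)) \<omega> = G (label (last_time t)) \<omega>' \<longrightarrow> S t \<omega> = S t \<omega>'))"

section \<open>Convergence in probability\<close>

text \<open>Since \<^const>\<open>measure\<close> is \<open>0\<close> on non-measurable sets, measurability of the exceptional
  events is made part of both notions of convergence.\<close>

definition tendsto_in_prob ::
  "'w measure \<Rightarrow> (real \<Rightarrow> 'w \<Rightarrow> real) \<Rightarrow> real \<Rightarrow> real filter \<Rightarrow> bool" where
  "tendsto_in_prob M X c F \<longleftrightarrow>
     (\<forall>\<epsilon>>0. (\<forall>\<^sub>F t in F. {\<omega>\<in>space M. \<bar>X t \<omega> - c\<bar> > \<epsilon>} \<in> sets M) \<and>
            ((\<lambda>t. measure M {\<omega>\<in>space M. \<bar>X t \<omega> - c\<bar> > \<epsilon>}) \<longlongrightarrow> 0) F)"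

definition asymp_equiv_in_prob ::
  "'w measure \<Rightarrow> (real \<Rightarrow> 'w \<Rightarrow> real) \<Rightarrow> (real \<Rightarrow> 'w \<Rightarrow> real) \<Rightarrow> real filter \<Rightarrow> bool" where
  "asymp_equiv_in_prob M A B F \<longleftrightarrow> tendsto_in_prob M (\<lambda>t \<omega>. A t \<omega> / B t \<omega>) 1 F"

text \<open>Functions are total, so only the values on \<open>(0,\<infinity>)\<close> are relevant here.\<close>

definition cadlag_pos :: "(real \<Rightarrow> real) set" where
  "cadlag_pos = {x. \<forall>u>0. (x \<longlongrightarrow> x u) (at_right u) \<and> (\<exists>l. (x \<longlongrightarrow> l) (at_left u))}"

text \<open>In the topology of uniform convergence on compact subsets of \<open>(0,\<infinity>)\<close>, a neighbourhood
  base at \<open>x\<close> is given by the sets of all \<open>y\<close> with \<open>\<bar>y u - x u\<bar> \<le> \<epsilon>\<close> for all \<open>u \<in> K\<close>, where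
  \<open>K\<close> is compact and \<open>\<epsilon> > 0\<close>. Convergence in probability to \<open>x\<close> says that the probability of
  the complement of each of these neighbourhoods tends to \<open>0\<close>.\<close>

definition tendsto_in_prob_cadlag ::
  "'w measure \<Rightarrow> (real \<Rightarrow> 'w \<Rightarrow> real \<Rightarrow> real) \<Rightarrow> (real \<Rightarrow> real) \<Rightarrow> real filter \<Rightarrow> bool" where
  "tendsto_in_prob_cadlag M X x F \<longleftrightarrow>
     x \<in> cadlag_pos \<and>
     (\<forall>\<^sub>F t in F. \<forall>\<omega>\<in>space M. X t \<omega> \<in> cadlag_pos) \<and>
     (\<forall>K \<epsilon>. compact K \<and> K \<subseteq> {0<..} \<and> \<epsilon> > 0 \<longrightarrow>
        (\<forall>\<^sub>F t in F. {\<omega>\<in>space M. \<exists>u\<in>K. \<bar>X t \<omega> u - x u\<bar> > \<epsilon>} \<in> sets M) \<and>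
        ((\<lambda>t. measure M {\<omega>\<in>space M. \<exists>u\<in>K. \<bar>X t \<omega> u - x u\<bar> > \<epsilon>}) \<longlongrightarrow> 0) F)"

end

theory Submission
  imports Defs
begin

text \<open>The degree evolution of a single vertex is controlled by exact exponential moments. Put
  \<open>tilt \<theta> k = (1 + \<theta> / f 0) * \<dots> * (1 + \<theta> / f (k - 1))\<close>. In the step from \<open>n\<close> to \<open>n + 1\<close> the
  expectation of \<open>tilt \<theta>\<close> of the indegree is multiplied by \<open>1 + \<theta> / n\<close>, whatever the present
  indegree is (\<open>transition_tilt\<close>). Hence its moments are explicit (\<open>expectation_tilt\<close>); for a vertex of
  age \<open>r\<close> on the artificial time scale they are about \<open>exp (\<theta> * r)\<close>. If \<open>z\<close> is the value of \<open>Phi f\<close> at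
  \<open>k\<close>, then \<open>tilt \<theta> k\<close> is about \<open>exp (\<theta> * z - \<theta>\<^sup>2 / 2 * A z)\<close>, where \<open>A z\<close> is the integral of
  \<open>1 / f_bar f\<close> over \<open>{0..z}\<close>. So on an exponential scale \<open>Z[s,t]\<close> behaves like a Gaussian variable
  with mean \<open>t - s\<close> and variance \<open>A t\<close>.

  About \<open>exp s\<close> vertices are born around time \<open>s\<close>, and the largest excess over \<open>t - s\<close> among them is the
  \<open>x\<close> with \<open>x\<^sup>2 / (2 * A t) = s\<close>. Maximising \<open>x - s\<close> gives \<open>s = A t / 2\<close> and \<open>x = A t\<close>, so that the hub
  has the level \<open>t + A t / 2\<close>. The corresponding tilting parameter is \<open>x / A t = 1\<close>. Under the weight
  \<open>tilt 1\<close> the level at age \<open>r\<close> concentrates around \<open>r + A r\<close>, and this is the path of the hub until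
  time \<open>t\<close>; afterwards its level grows at unit speed.

  The upper bounds are Chernoff bounds, summed over all vertices and over a mesh of times. A path
  that leaves the neighbourhood of \<open>r + A r\<close> is penalised by using a parameter slightly different from
  \<open>1\<close> up to the time in question and \<open>1\<close> afterwards (\<open>expectation_tilt_far\<close>, \<open>prob_far_and_large\<close>).
  Applied at time \<open>t\<close> itself, this also locates the birth time: a level near \<open>t + A t / 2\<close> that is
  near \<open>t - s + A t\<close> forces \<open>s\<close> to be near \<open>A t / 2\<close>. For the lower bound, most of the weighted mass
  lies in a window where the weight is known, so the probability of the window is known up to a
  factor \<open>exp (o(A t))\<close> (\<open>prob_large_ge\<close>); as the indegrees of different vertices are independent
  and slightly more than \<open>exp (A t / 2)\<close> vertices are available, one of them succeeds
  (\<open>prob_none_large\<close>). Since the hub is selected without anticipating the future, after time \<open>t\<close> it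
  evolves like a fixed vertex (\<open>expectation_tilt_selected\<close>).

  Karamata's theorem supplies the analytic part: \<open>A t\<close> is asymptotically equivalent to
  \<open>\<kappa> * t / f_bar f t\<close> with \<open>\<kappa> = (1 - \<alpha>) / (1 - 2 * \<alpha>)\<close> and varies regularly with the positive index
  \<open>1 / \<kappa>\<close>. In particular \<open>A t\<close> dominates \<open>ln t\<close>, so that union bounds over polynomially many times cost
  nothing, and since \<open>f\<close> is unbounded, \<open>A t\<close> is of smaller order than \<open>t\<close>.\<close>

section \<open>Integrals of reciprocals of monotone step functions\<close>

locale pos_mono =
  fixes h :: "nat \<Rightarrow> real"
  assumes h_mono: "mono h" and h_pos: "\<And>n. 0 < h n"
begin

lemma step_ext_mono: "x \<le> y \<Longrightarrow> step_ext h x \<le> step_ext h y"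
  unfolding step_ext_def by (intro monoD[OF h_mono] nat_mono floor_mono)

lemma step_ext_pos: "0 < step_ext h x"
  unfolding step_ext_def by (rule h_pos)

lemma step_ext_ge_0: "h 0 \<le> step_ext h x"
  unfolding step_ext_def by (intro monoD[OF h_mono]) auto

lemma step_ext_of_nat [simp]: "step_ext h (real k) = h k"
  unfolding step_ext_def by simp

lemma reciprocal_integrable: "(\<lambda>v. 1 / step_ext h v) integrable_on {x..y}"
proof -
  have "(\<lambda>v. - (1 / step_ext h v)) integrable_on {x..y}"
    by (rule integrable_on_mono_on)
       (auto intro!: mono_onI divide_left_mono step_ext_mono mult_pos_pos step_ext_pos)
  then show ?thesis
    using integrable_neg by fastforce
qed

lemma Phi_diff_eq:
  assumes "0 \<le> x" "x \<le> y"
  shows "Phi h y - Phi h x = integral {x..y} (\<lambda>v. 1 / step_ext h v)"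
  unfolding Phi_def
  using Henstock_Kurzweil_Integration.integral_combine[OF assms reciprocal_integrable] by simp

lemma Phi_diff_le:
  assumes "0 \<le> x" "x \<le> y"
  shows "Phi h y - Phi h x \<le> (y - x) / step_ext h x"
proof -
  have "integral {x..y} (\<lambda>v. 1 / step_ext h v) \<le> integral {x..y} (\<lambda>v. 1 / step_ext h x)"
    by (rule integral_le[OF reciprocal_integrable])
       (auto intro!: divide_left_mono step_ext_mono mult_pos_pos step_ext_pos)
  then show ?thesis
    using assms by (simp add: Phi_diff_eq)
qed

lemma Phi_diff_ge:
  assumes "0 \<le> x" "x \<le> y"
  shows "(y - x) / step_ext h y \<le> Phi h y - Phi h x"
proof -
  have "integral {x..y} (\<lambda>v. 1 / step_ext h y) \<le> integral {x..y} (\<lambda>v. 1 / step_ext h v)"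
    by (rule integral_le[OF _ reciprocal_integrable])
       (auto intro!: divide_left_mono step_ext_mono mult_pos_pos step_ext_pos)
  then show ?thesis
    using assms by (simp add: Phi_diff_eq)
qed

lemma Phi_0 [simp]: "Phi h 0 = 0"
  unfolding Phi_def by simp

lemma Phi_strict_mono:
  assumes "0 \<le> x" "x < y" shows "Phi h x < Phi h y"
proof -
  have "0 < (y - x) / step_ext h y" using assms step_ext_pos by simp
  then show ?thesis using Phi_diff_ge[of x y] assms by simp
qed

lemma Phi_le_iff: "0 \<le> x \<Longrightarrow> 0 \<le> y \<Longrightarrow> Phi h x \<le> Phi h y \<longleftrightarrow> x \<le> y"
  using Phi_strict_mono[of x y] Phi_strict_mono[of y x] by (cases x y rule: linorder_cases) auto

lemma Phi_nonneg: "0 \<le> x \<Longrightarrow> 0 \<le> Phi h x"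
  using Phi_le_iff[of 0 x] by simp

lemma Phi_le_linear: "0 \<le> x \<Longrightarrow> Phi h x \<le> x / h 0"
  using Phi_diff_le[of 0 x] step_ext_of_nat[of 0] by simp

lemma Phi_continuous: "continuous_on {0..} (Phi h)"
proof -
  have L: "\<bar>Phi h y - Phi h x\<bar> \<le> 1 / h 0 * \<bar>y - x\<bar>" if "0 \<le> x" "x \<le> y" for x y
  proof -
    have "(y - x) / step_ext h x \<le> (y - x) / h 0"
      using that by (intro divide_left_mono step_ext_ge_0 mult_pos_pos step_ext_pos h_pos) auto
    moreover have "Phi h x \<le> Phi h y" using that Phi_le_iff[of x y] by simp
    ultimately show ?thesis using Phi_diff_le[OF that] that by simp
  qed
  have "(1 / h 0)-lipschitz_on {0..} (Phi h)"
  proof (rule lipschitz_onI)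
    fix x y :: real assume "x \<in> {0..}" "y \<in> {0..}"
    then show "dist (Phi h x) (Phi h y) \<le> 1 / h 0 * dist x y"
      using L[of x y] L[of y x] by (cases "x \<le> y") (auto simp: dist_real_def abs_minus_commute)
  qed (use h_pos[of 0] in auto)
  then show ?thesis by (rule lipschitz_on_continuous_on)
qed

lemma Phi_nat: "Phi h (real k) = (\<Sum>j<k. 1 / h j)"
proof (induction k)
  case (Suc k)
  have "((\<lambda>v. 1 / h k) has_integral (1 / h k)) {real k..real (Suc k)}"
    using has_integral_const_real[of "1 / h k" "real k" "real (Suc k)"] by simp
  then have "((\<lambda>v. 1 / step_ext h v) has_integral (1 / h k)) {real k..real (Suc k)}"
  proof (rule has_integral_spike_finite[of "{real (Suc k)}", rotated 2])
    fix x assume "x \<in> {real k..real (Suc k)} - {real (Suc k)}"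
    then have "nat \<lfloor>x\<rfloor> = k" by (simp add: nat_eq_iff floor_eq_iff)
    then show "1 / step_ext h x = 1 / h k" by (simp add: step_ext_def)
  qed simp
  then have "Phi h (real (Suc k)) - Phi h (real k) = 1 / h k"
    using Phi_diff_eq[of "real k" "real (Suc k)"] by (simp add: integral_unique)
  then show ?case using Suc by simp
qed simp

end

section \<open>Karamata's theorem for monotone step functions\<close>

text \<open>A function that is controlled by a contraction of its values at a smaller argument forgets
  its initial values. This replaces subsequence arguments and Potter bounds for regularly varying
  functions.\<close>

lemma contraction_limsup:
  fixes T :: "real \<Rightarrow> real"
  assumes c: "0 < c" "c < 1" and q: "0 \<le> q" "q < 1" and X: "0 < X"
    and rec: "\<And>x. x \<ge> X \<Longrightarrow> T x \<le> q * T (c * x) + b"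
    and bd: "\<And>x. c * X \<le> x \<Longrightarrow> x \<le> X \<Longrightarrow> T x \<le> B"
    and \<epsilon>: "0 < \<epsilon>"
  shows "\<forall>\<^sub>F x in at_top. T x \<le> b / (1 - q) + \<epsilon>"
proof -
  define e where "e x = T x - b / (1 - q)" for x
  define C where "C = max 0 (B - b / (1 - q))"
  have C0: "0 \<le> C" by (simp add: C_def)
  have qb: "q * (b / (1 - q)) + b = b / (1 - q)" using q by (simp add: field_simps)
  have rec': "e x \<le> q * e (c * x)" if "x \<ge> X" for x
    using rec[OF that] qb by (simp add: e_def algebra_simps)
  have bounded: "e x \<le> C" if "c * X \<le> x" "x \<le> X * (1 / c) ^ n" for x n
    using that
  proof (induction n arbitrary: x)
    case 0
    then show ?case using bd[of x] by (simp add: e_def C_def)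
  next
    case (Suc n)
    show ?case
    proof (cases "x \<le> X")
      case True
      then show ?thesis using bd[of x] Suc.prems by (simp add: e_def C_def)
    next
      case False
      have "c * x \<le> X * (1 / c) ^ n" using Suc.prems c by (simp add: field_simps)
      moreover have "c * X \<le> c * x" using False c by simp
      ultimately have "e (c * x) \<le> C" by (rule Suc.IH[rotated])
      then have "q * e (c * x) \<le> 1 * C"
        using q C0 by (metis mult_left_mono mult_right_mono order_trans less_imp_le)
      then show ?thesis using rec'[of x] False by simp
    qed
  qed
  have bounded': "e x \<le> C" if "c * X \<le> x" for x
  proof -
    obtain n where "x / X < (1 / c) ^ n" using real_arch_pow[of "1 / c" "x / X"] c by auto
    then show ?thesis using bounded[OF that, of n] X by (simp add: field_simps)
  qed
  have decay: "e x \<le> q ^ n * C" if "c * X * (1 / c) ^ n \<le> x" for x n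
    using that
  proof (induction n arbitrary: x)
    case 0
    then show ?case using bounded' by simp
  next
    case (Suc n)
    have "c * X * (1 / c) ^ n \<le> c * x" using Suc.prems c by (simp add: field_simps)
    then have "e (c * x) \<le> q ^ n * C" by (rule Suc.IH)
    then have "q * e (c * x) \<le> q ^ Suc n * C" using q by (simp add: mult_left_mono mult.assoc)
    moreover have "X \<le> x"
    proof -
      have "X * 1 \<le> X * (1 / c) ^ n" using X c by (intro mult_left_mono one_le_power) auto
      also have "\<dots> \<le> x" using Suc.prems c by (simp add: field_simps)
      finally show ?thesis by simp
    qed
    ultimately show ?case using rec'[of x] by simp
  qed
  have "(\<lambda>n. q ^ n * C) \<longlonglongrightarrow> 0 * C"
    using q by (intro tendsto_mult tendsto_const LIMSEQ_realpow_zero) auto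
  then have "\<forall>\<^sub>F n in sequentially. q ^ n * C < \<epsilon>"
    using \<epsilon> by (auto dest: order_tendstoD)
  then obtain n where "q ^ n * C < \<epsilon>" by (auto simp: eventually_sequentially)
  then have "T x \<le> b / (1 - q) + \<epsilon>" if "c * X * (1 / c) ^ n \<le> x" for x
    using decay[OF that] by (simp add: e_def)
  then show ?thesis by (auto simp: eventually_at_top_linorder)
qed

lemma tendsto_difference_quotient_at_left_1:
  assumes "\<beta> < 1"
  shows "((\<lambda>c::real. (1 - c) / (1 - c powr (1 - \<beta>))) \<longlongrightarrow> 1 / (1 - \<beta>)) (at_left 1)"
proof -
  have "((\<lambda>c::real. c powr (1 - \<beta>)) has_real_derivative (1 - \<beta>)) (at 1)"
    by (auto intro!: derivative_eq_intros)
  then have "((\<lambda>c::real. (c powr (1 - \<beta>) - 1 powr (1 - \<beta>)) / (c - 1)) \<longlongrightarrow> 1 - \<beta>) (at 1)"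
    by (simp add: has_field_derivative_iff)
  then have "((\<lambda>c::real. inverse ((c powr (1 - \<beta>) - 1) / (c - 1))) \<longlongrightarrow> inverse (1 - \<beta>)) (at_left 1)"
    using assms by (intro tendsto_inverse) (auto intro: filterlim_at_split[THEN iffD1, THEN conjunct1])
  moreover have "inverse ((c powr (1 - \<beta>) - 1) / (c - 1)) = (1 - c) / (1 - c powr (1 - \<beta>))" for c
    using minus_divide_divide[of "1 - c" "1 - c powr (1 - \<beta>)"] by simp
  ultimately show ?thesis by (simp add: inverse_eq_divide)
qed

context pos_mono
begin

text \<open>Splitting the integral of \<open>1 / h\<close> over \<open>{0..x}\<close> at \<open>c * x\<close> relates the quotient \<open>T x\<close> in the
  statement to \<open>T (c * x)\<close>, with a factor tending to \<open>c powr (1 - \<beta>) < 1\<close>. On \<open>{c * x..x}\<close> the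
  monotone integrand is bounded by its values at the end points. Hence \<open>T\<close> is asymptotically
  between \<open>(1 - c) / (1 - c powr (1 - \<beta>))\<close> and \<open>c powr (- \<beta>)\<close> times this number.\<close>

lemma Karamata:
  assumes rv: "regularly_varying (step_ext h) \<beta>" and \<beta>: "\<beta> < 1"
  shows "((\<lambda>x. Phi h x * step_ext h x / x) \<longlongrightarrow> 1 / (1 - \<beta>)) at_top"
proof -
  let ?H = "step_ext h"
  define T where "T x = Phi h x * ?H x / x" for x
  have T_nonneg: "0 \<le> T x" if "0 < x" for x
    using that Phi_nonneg[of x] step_ext_pos[of x] by (simp add: T_def)
  have T_bd: "T x \<le> ?H X / h 0" if "0 < x" "x \<le> X" for x X
  proof -
    have "T x \<le> (x / h 0) * ?H X / x"
      unfolding T_def using that Phi_le_linear[of x] step_ext_mono[of x X] step_ext_pos[of x] h_pos[of 0]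
      by (intro divide_right_mono mult_mono) auto
    then show ?thesis using that by simp
  qed
  have ratio: "((\<lambda>x. ?H x / ?H (c * x)) \<longlongrightarrow> c powr (- \<beta>)) at_top" if "0 < c" for c
  proof -
    have "((\<lambda>x. inverse (?H (c * x) / ?H x)) \<longlongrightarrow> inverse (c powr \<beta>)) at_top"
      using rv that by (intro tendsto_inverse) (auto simp: regularly_varying_def)
    then show ?thesis by (simp add: powr_minus)
  qed
  have split: "T x = c * (?H x / ?H (c * x)) * T (c * x) + (Phi h x - Phi h (c * x)) * ?H x / x"
    if "0 < x" "0 < c" for x c
    using that step_ext_pos[of "c * x"] by (simp add: T_def field_simps)
  have inc_le: "(Phi h x - Phi h (c * x)) * ?H x / x \<le> (1 - c) * (?H x / ?H (c * x))"
    if "0 < x" "0 < c" "c < 1" for x c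
  proof -
    have "(Phi h x - Phi h (c * x)) * ?H x / x \<le> ((x - c * x) / ?H (c * x)) * ?H x / x"
      using that step_ext_pos[of x] Phi_diff_le[of "c * x" x]
      by (intro divide_right_mono mult_right_mono) auto
    also have "x - c * x = (1 - c) * x" by (simp add: algebra_simps)
    also have "((1 - c) * x / ?H (c * x)) * ?H x / x = (1 - c) * (?H x / ?H (c * x))"
      using that by simp
    finally show ?thesis .
  qed
  have inc_ge: "1 - c \<le> (Phi h x - Phi h (c * x)) * ?H x / x"
    if "0 < x" "0 < c" "c < 1" for x c
  proof -
    have "((x - c * x) / ?H x) * ?H x / x \<le> (Phi h x - Phi h (c * x)) * ?H x / x"
      using that step_ext_pos[of x] Phi_diff_ge[of "c * x" x]
      by (intro divide_right_mono mult_right_mono) auto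
    moreover have "((x - c * x) / ?H x) * ?H x / x = 1 - c"
      using that step_ext_pos[of x] by (simp add: field_simps)
    ultimately show ?thesis by simp
  qed
  have q_less: "0 < c powr (1 - \<beta>)" "c powr (1 - \<beta>) < 1" if "0 < c" "c < 1" for c :: real
    using that \<beta> powr_less_mono2[of "1 - \<beta>" c 1] by auto
  have a_lim: "((\<lambda>x. c * (?H x / ?H (c * x))) \<longlongrightarrow> c powr (1 - \<beta>)) at_top" if "0 < c" for c
    using tendsto_mult[OF tendsto_const[of c] ratio[OF that]] that
    by (simp add: powr_diff powr_minus divide_inverse powr_one)
  \<comment> \<open>The parameter \<open>\<delta>\<close> is room for replacing the limits of the coefficients by strict bounds.\<close>
  have upper: "\<forall>\<^sub>F x in at_top. T x < y"
    if c: "0 < c" "c < 1" and y: "(1 - c) * c powr (- \<beta>) / (1 - c powr (1 - \<beta>)) < y" for c y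
  proof -
    let ?q = "c powr (1 - \<beta>)" and ?b = "(1 - c) * c powr (- \<beta>)"
    have "((\<lambda>\<delta>. (?b + \<delta>) / (1 - (?q + \<delta>)) + \<delta>) \<longlongrightarrow> (?b + 0) / (1 - (?q + 0)) + 0) (at_right 0)"
      using q_less[OF c] by (intro tendsto_intros) auto
    then have "\<forall>\<^sub>F \<delta> in at_right 0. (?b + \<delta>) / (1 - (?q + \<delta>)) + \<delta> < y"
      using y by (intro order_tendstoD(2)) auto
    moreover have "\<forall>\<^sub>F \<delta> in at_right 0. \<delta> \<in> {0<..<1 - ?q}"
      using q_less[OF c] by (intro eventually_at_right_real) auto
    ultimately have "\<forall>\<^sub>F \<delta> in at_right (0::real). (?b + \<delta>) / (1 - (?q + \<delta>)) + \<delta> < y \<and> \<delta> \<in> {0<..<1 - ?q}"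
      by (rule eventually_conj)
    then obtain \<delta> where \<delta>: "(?b + \<delta>) / (1 - (?q + \<delta>)) + \<delta> < y" "0 < \<delta>" "\<delta> < 1 - ?q"
      using eventually_happens[of _ "at_right (0::real)"] by auto
    have "\<forall>\<^sub>F x in at_top. c * (?H x / ?H (c * x)) < ?q + \<delta>"
      using \<delta> by (intro order_tendstoD(2)[OF a_lim[OF c(1)]]) auto
    moreover have "\<forall>\<^sub>F x in at_top. (1 - c) * (?H x / ?H (c * x)) < ?b + \<delta>"
      using \<delta> by (intro order_tendstoD(2)[OF tendsto_mult[OF tendsto_const ratio[OF c(1)]]]) auto
    ultimately have "\<forall>\<^sub>F x in at_top. c * (?H x / ?H (c * x)) < ?q + \<delta> \<and>
        (1 - c) * (?H x / ?H (c * x)) < ?b + \<delta> \<and> 1 \<le> x"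
      using eventually_ge_at_top by (intro eventually_conj)
    then obtain X where X: "\<And>x. x \<ge> X \<Longrightarrow> c * (?H x / ?H (c * x)) < ?q + \<delta> \<and>
        (1 - c) * (?H x / ?H (c * x)) < ?b + \<delta> \<and> 1 \<le> x"
      by (auto simp: eventually_at_top_linorder)
    then have X1: "1 \<le> X" by blast
    have "\<forall>\<^sub>F x in at_top. T x \<le> (?b + \<delta>) / (1 - (?q + \<delta>)) + \<delta>"
    proof (rule contraction_limsup[OF c, where X = X and B = "?H X / h 0"])
      fix x assume x: "X \<le> x"
      have "c * (?H x / ?H (c * x)) * T (c * x) \<le> (?q + \<delta>) * T (c * x)"
        using X[OF x] T_nonneg[of "c * x"] c by (intro mult_right_mono) auto
      then show "T x \<le> (?q + \<delta>) * T (c * x) + (?b + \<delta>)"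
        using split[of x c] inc_le[of x c] X[OF x] c by fastforce
    next
      fix x assume "c * X \<le> x" "x \<le> X"
      moreover have "0 < c * X" using c X1 by simp
      ultimately show "T x \<le> ?H X / h 0" using T_bd[of x X] by linarith
    qed (use q_less[OF c] \<delta> X1 in auto)
    then show ?thesis by (rule eventually_mono) (use \<delta> in auto)
  qed
  have lower: "\<forall>\<^sub>F x in at_top. y < T x"
    if c: "0 < c" "c < 1" and y: "y < (1 - c) / (1 - c powr (1 - \<beta>))" for c y
  proof -
    let ?q = "c powr (1 - \<beta>)"
    have "((\<lambda>\<delta>. (1 - c) / (1 - (?q - \<delta>)) - \<delta>) \<longlongrightarrow> (1 - c) / (1 - (?q - 0)) - 0) (at_right 0)"
      using q_less[OF c] by (intro tendsto_intros) auto
    then have "\<forall>\<^sub>F \<delta> in at_right 0. y < (1 - c) / (1 - (?q - \<delta>)) - \<delta>"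
      using y by (intro order_tendstoD(1)) auto
    moreover have "\<forall>\<^sub>F \<delta> in at_right 0. \<delta> \<in> {0<..<?q}"
      using q_less[OF c] by (intro eventually_at_right_real) auto
    ultimately have "\<forall>\<^sub>F \<delta> in at_right (0::real). y < (1 - c) / (1 - (?q - \<delta>)) - \<delta> \<and> \<delta> \<in> {0<..<?q}"
      by (rule eventually_conj)
    then obtain \<delta> where \<delta>: "y < (1 - c) / (1 - (?q - \<delta>)) - \<delta>" "0 < \<delta>" "\<delta> < ?q"
      using eventually_happens[of _ "at_right (0::real)"] by auto
    have "\<forall>\<^sub>F x in at_top. ?q - \<delta> < c * (?H x / ?H (c * x))"
      using \<delta> by (intro order_tendstoD(1)[OF a_lim[OF c(1)]]) auto
    then have "\<forall>\<^sub>F x in at_top. ?q - \<delta> < c * (?H x / ?H (c * x)) \<and> 1 \<le> x"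
      using eventually_ge_at_top by (intro eventually_conj)
    then obtain X where X: "\<And>x. x \<ge> X \<Longrightarrow> ?q - \<delta> < c * (?H x / ?H (c * x)) \<and> 1 \<le> x"
      by (auto simp: eventually_at_top_linorder)
    then have X1: "1 \<le> X" by blast
    have "\<forall>\<^sub>F x in at_top. - T x \<le> (- (1 - c)) / (1 - (?q - \<delta>)) + \<delta>"
    proof (rule contraction_limsup[OF c, where X = X and B = 0])
      fix x assume x: "X \<le> x"
      have "(?q - \<delta>) * T (c * x) \<le> c * (?H x / ?H (c * x)) * T (c * x)"
        using X[OF x] T_nonneg[of "c * x"] c by (intro mult_right_mono) auto
      then show "- T x \<le> (?q - \<delta>) * - T (c * x) + - (1 - c)"
        using split[of x c] inc_ge[of x c] X[OF x] c by fastforce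
    next
      fix x assume "c * X \<le> x" "x \<le> X"
      moreover have "0 < c * X" using c X1 by simp
      ultimately show "- T x \<le> 0" using T_nonneg[of x] by linarith
    qed (use q_less[OF c] \<delta> X1 in auto)
    moreover have "(- (1 - c)) / (1 - (?q - \<delta>)) = - ((1 - c) / (1 - (?q - \<delta>)))"
      by (rule minus_divide_left[symmetric])
    ultimately have "\<forall>\<^sub>F x in at_top. - T x \<le> - ((1 - c) / (1 - (?q - \<delta>))) + \<delta>"
      by (simp only:)
    then show ?thesis
    proof (rule eventually_mono)
      fix x assume "- T x \<le> - ((1 - c) / (1 - (?q - \<delta>))) + \<delta>"
      then show "y < T x" using \<delta>(1) by linarith
    qed
  qed
  \<comment> \<open>As \<open>c\<close> increases to \<open>1\<close>, both bounds tend to \<open>1 / (1 - \<beta>)\<close>.\<close>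
  note q1 = tendsto_difference_quotient_at_left_1[OF \<beta>]
  have "((\<lambda>c::real. c powr (- \<beta>)) \<longlongrightarrow> 1 powr (- \<beta>)) (at_left 1)"
    by (intro tendsto_intros) auto
  from tendsto_mult[OF this q1]
  have q2: "((\<lambda>c. (1 - c) * c powr (- \<beta>) / (1 - c powr (1 - \<beta>))) \<longlongrightarrow> 1 / (1 - \<beta>)) (at_left 1)"
    by (simp add: mult.commute)
  have near: "\<forall>\<^sub>F c in at_left 1. c \<in> {0<..<1::real}" by (rule eventually_at_left_real) simp
  show ?thesis
  proof (rule order_tendstoI)
    fix y assume "y < 1 / (1 - \<beta>)"
    then have "\<forall>\<^sub>F c in at_left 1. y < (1 - c) / (1 - c powr (1 - \<beta>)) \<and> c \<in> {0<..<1}"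
      using near by (intro eventually_conj order_tendstoD(1)[OF q1])
    then obtain c where "y < (1 - c) / (1 - c powr (1 - \<beta>))" "0 < c" "c < 1"
      using eventually_happens[of _ "at_left (1::real)"] by auto
    then show "\<forall>\<^sub>F x in at_top. y < Phi h x * ?H x / x" using lower by (simp add: T_def)
  next
    fix y assume "1 / (1 - \<beta>) < y"
    then have "\<forall>\<^sub>F c in at_left 1. (1 - c) * c powr (- \<beta>) / (1 - c powr (1 - \<beta>)) < y \<and> c \<in> {0<..<1}"
      using near by (intro eventually_conj order_tendstoD(2)[OF q2])
    then obtain c where "(1 - c) * c powr (- \<beta>) / (1 - c powr (1 - \<beta>)) < y" "0 < c" "c < 1"
      using eventually_happens[of _ "at_left (1::real)"] by auto
    then show "\<forall>\<^sub>F x in at_top. Phi h x * ?H x / x < y" using upper by (simp add: T_def)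
  qed
qed

lemma Phi_regularly_varying:
  assumes rv: "regularly_varying (step_ext h) \<beta>" and \<beta>: "\<beta> < 1"
  shows "regularly_varying (Phi h) (1 - \<beta>)"
  unfolding regularly_varying_def
proof (intro allI impI)
  fix c :: real assume c: "0 < c"
  let ?T = "\<lambda>x. Phi h x * step_ext h x / x"
  note T = Karamata[OF assms]
  have "filterlim (\<lambda>x. c * x) at_top at_top"
    using c by (rule filterlim_tendsto_pos_mult_at_top[OF tendsto_const]) (rule filterlim_ident)
  then have Tc: "((\<lambda>x. ?T (c * x)) \<longlongrightarrow> 1 / (1 - \<beta>)) at_top"
    using T by (rule filterlim_compose[rotated])
  have R: "((\<lambda>x. inverse (step_ext h (c * x) / step_ext h x)) \<longlongrightarrow> inverse (c powr \<beta>)) at_top"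
    using rv c by (intro tendsto_inverse) (auto simp: regularly_varying_def)
  have "((\<lambda>x. c * (?T (c * x) / ?T x) * inverse (step_ext h (c * x) / step_ext h x))
      \<longlongrightarrow> c * ((1 / (1 - \<beta>)) / (1 / (1 - \<beta>))) * inverse (c powr \<beta>)) at_top"
    using \<beta> by (intro tendsto_intros T Tc R) auto
  moreover have "c * ((1 / (1 - \<beta>)) / (1 / (1 - \<beta>))) * inverse (c powr \<beta>) = c powr (1 - \<beta>)"
    using \<beta> c by (simp add: powr_diff divide_inverse)
  moreover have "\<forall>\<^sub>F x in at_top. c * (?T (c * x) / ?T x) * inverse (step_ext h (c * x) / step_ext h x)
      = Phi h (c * x) / Phi h x"
    using eventually_gt_at_top[of 0]
  proof eventually_elim
    case (elim x)
    then show ?case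
      using c step_ext_pos[of x] step_ext_pos[of "c * x"] Phi_strict_mono[of 0 x] by (simp add: field_simps)
  qed
  ultimately show "((\<lambda>x. Phi h (c * x) / Phi h x) \<longlongrightarrow> c powr (1 - \<beta>)) at_top"
    using Lim_transform_eventually by fastforce
qed

end

section \<open>The variance function\<close>

text \<open>\<open>Phi_inv f\<close> inverts the artificial scale. The function \<open>Avar f z = integral of 1 / f_bar f
  over {0..z}\<close> is the asymptotic variance of the degree evolution after artificial time \<open>z\<close>;
  substituting \<open>z = Phi f x\<close> turns it into an integral of \<open>1 / f^2\<close>.\<close>

definition Phi_inv :: "(nat \<Rightarrow> real) \<Rightarrow> real \<Rightarrow> real" where
  "Phi_inv f z = inv_into {0..} (Phi f) z"

definition Avar :: "(nat \<Rightarrow> real) \<Rightarrow> real \<Rightarrow> real" where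
  "Avar f z = Phi (\<lambda>n. (f n)\<^sup>2) (Phi_inv f z)"

locale rule =
  fixes f :: "nat \<Rightarrow> real"
  assumes rule: "attachment_rule f"
begin

lemma f_pos: "0 < f n" using rule by (simp add: attachment_rule_def)
lemma f_mono: "mono f" using rule by (simp add: attachment_rule_def)
lemma f_le: "f n \<le> real n + 1" using rule by (simp add: attachment_rule_def)

lemma f_ge_0: "f 0 \<le> f n" using f_mono by (auto dest: monoD)

sublocale pos_mono f
  by unfold_locales (use f_pos f_mono in auto)

sublocale sq: pos_mono "\<lambda>n. (f n)\<^sup>2"
proof
  show "mono (\<lambda>n. (f n)\<^sup>2)"
    using f_pos by (intro monoI power_mono monoD[OF f_mono]) (auto simp: less_imp_le)
  show "0 < (f n)\<^sup>2" for n by (rule zero_less_power[OF f_pos])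
qed

lemma step_ext_sq: "step_ext (\<lambda>n. (f n)\<^sup>2) x = (step_ext f x)\<^sup>2"
  by (simp add: step_ext_def)

lemma Phi_nat_at_top: "filterlim (\<lambda>k. Phi f (real k)) at_top sequentially"
proof (rule filterlim_at_top_mono[OF harm_at_top])
  show "\<forall>\<^sub>F k in sequentially. harm k \<le> Phi f (real k)"
  proof (intro always_eventually allI)
    fix k
    show "harm k \<le> Phi f (real k)"
      unfolding Phi_nat harm_altdef
    proof (rule sum_mono)
      fix j
      show "inverse (real (Suc j)) \<le> 1 / f j"
        using f_le[of j] f_pos[of j] by (simp add: inverse_eq_divide frac_le add.commute)
    qed
  qed
qed

lemma Phi_surj:
  assumes "0 \<le> z" obtains x where "0 \<le> x" "Phi f x = z"
proof -
  have "\<forall>\<^sub>F k in sequentially. z \<le> Phi f (real k)"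
    using Phi_nat_at_top by (auto simp: filterlim_at_top)
  then obtain k where k: "z \<le> Phi f (real k)" by (auto simp: eventually_sequentially)
  have "\<exists>x\<ge>0. x \<le> real k \<and> Phi f x = z"
    using assms k by (intro IVT') (auto intro: continuous_on_subset[OF Phi_continuous])
  then show ?thesis using that by blast
qed

lemma Phi_inj: "inj_on (Phi f) {0..}"
proof (rule inj_onI)
  fix x y assume "x \<in> {0..}" "y \<in> {0..}" "Phi f x = Phi f y"
  then show "x = y" using Phi_le_iff[of x y] Phi_le_iff[of y x] by auto
qed

lemma Phi_inv_Phi [simp]: "0 \<le> x \<Longrightarrow> Phi_inv f (Phi f x) = x"
  unfolding Phi_inv_def by (intro inv_into_f_f Phi_inj) auto

lemma Phi_inv_nonneg: "0 \<le> z \<Longrightarrow> 0 \<le> Phi_inv f z"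
  by (rule Phi_surj[of z]) auto

lemma Phi_Phi_inv [simp]: "0 \<le> z \<Longrightarrow> Phi f (Phi_inv f z) = z"
  by (rule Phi_surj[of z]) auto

lemma Phi_inv_mono: "0 \<le> y \<Longrightarrow> y \<le> z \<Longrightarrow> Phi_inv f y \<le> Phi_inv f z"
  using Phi_le_iff[of "Phi_inv f y" "Phi_inv f z"] by (simp add: Phi_inv_nonneg)

lemma f_bar_eq: "f_bar f z = step_ext f (Phi_inv f z)"
  by (simp add: f_bar_def Phi_inv_def)

lemma f_bar_pos: "0 < f_bar f z"
  by (simp add: f_bar_eq step_ext_pos)

lemma f_bar_mono: "0 \<le> y \<Longrightarrow> y \<le> z \<Longrightarrow> f_bar f y \<le> f_bar f z"
  by (simp add: f_bar_eq step_ext_mono Phi_inv_mono)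

lemma Avar_Phi: "0 \<le> x \<Longrightarrow> Avar f (Phi f x) = Phi (\<lambda>n. (f n)\<^sup>2) x"
  by (simp add: Avar_def)

lemma Avar_Phi_nat: "Avar f (Phi f (real k)) = (\<Sum>j<k. 1 / (f j)\<^sup>2)"
  by (simp add: Avar_Phi sq.Phi_nat)

lemma Phi_inv_0 [simp]: "Phi_inv f 0 = 0"
  using Phi_inv_Phi[of 0] by simp

lemma Avar_0 [simp]: "Avar f 0 = 0"
  by (simp add: Avar_def)

lemma Avar_mono: "0 \<le> y \<Longrightarrow> y \<le> z \<Longrightarrow> Avar f y \<le> Avar f z"
  unfolding Avar_def using sq.Phi_le_iff[of "Phi_inv f y" "Phi_inv f z"]
  by (simp add: Phi_inv_mono Phi_inv_nonneg)

lemma Avar_nonneg: "0 \<le> z \<Longrightarrow> 0 \<le> Avar f z"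
  using Avar_mono[of 0 z] by simp

text \<open>The variance function is concave: \<open>1 / f\<^sup>2\<close> is \<open>1 / f\<close> times the nonincreasing
  function \<open>1 / f\<close>, so the increments of its integral are compared with those of \<open>Phi f\<close>.\<close>

lemma Avar_diff:
  assumes "0 \<le> y" "y \<le> z"
  shows "Avar f z - Avar f y \<le> (z - y) / f_bar f y" and "(z - y) / f_bar f z \<le> Avar f z - Avar f y"
proof -
  let ?x = "Phi_inv f y" and ?x' = "Phi_inv f z"
  have x: "0 \<le> ?x" "?x \<le> ?x'" using assms by (auto intro: Phi_inv_nonneg Phi_inv_mono)
  have A: "Avar f z - Avar f y = integral {?x..?x'} (\<lambda>v. 1 / (step_ext f v)\<^sup>2)"
    unfolding Avar_def using sq.Phi_diff_eq[OF x] by (simp add: step_ext_sq)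
  have D: "z - y = integral {?x..?x'} (\<lambda>v. 1 / step_ext f v)"
    using Phi_diff_eq[OF x] assms by simp
  have int2: "(\<lambda>v. 1 / (step_ext f v)\<^sup>2) integrable_on {?x..?x'}"
    using sq.reciprocal_integrable by (simp add: step_ext_sq)
  have int1: "(\<lambda>v. 1 / step_ext f v * (1 / step_ext f w)) integrable_on {?x..?x'}" for w
    by (intro integrable_on_mult_left reciprocal_integrable)
  have sq_le: "1 / b\<^sup>2 \<le> 1 / b * (1 / a)" and sq_ge: "1 / a * (1 / b) \<le> 1 / a\<^sup>2" if "0 < a" "a \<le> b" for a b :: real
    using that by (auto simp: power2_eq_square intro!: frac_le mult_left_mono)
  have "Avar f z - Avar f y \<le> integral {?x..?x'} (\<lambda>v. 1 / step_ext f v * (1 / step_ext f ?x))"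
    unfolding A by (intro integral_le int1 int2 sq_le step_ext_pos step_ext_mono) auto
  also have "\<dots> = (z - y) * (1 / step_ext f ?x)"
    unfolding D using integral_mult_left[of "{?x..?x'}" "\<lambda>v. 1 / step_ext f v" "1 / step_ext f ?x"] by simp
  finally show "Avar f z - Avar f y \<le> (z - y) / f_bar f y"
    by (simp add: f_bar_eq)
  have "integral {?x..?x'} (\<lambda>v. 1 / step_ext f v * (1 / step_ext f ?x')) \<le> Avar f z - Avar f y"
    unfolding A by (intro integral_le int1 int2 sq_ge step_ext_pos step_ext_mono) auto
  also have "integral {?x..?x'} (\<lambda>v. 1 / step_ext f v * (1 / step_ext f ?x')) = (z - y) * (1 / step_ext f ?x')"
    unfolding D using integral_mult_left[of "{?x..?x'}" "\<lambda>v. 1 / step_ext f v" "1 / step_ext f ?x'"] by simp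
  finally show "(z - y) / f_bar f z \<le> Avar f z - Avar f y"
    by (simp add: f_bar_eq)
qed

lemma f_bar_ge: "f 0 \<le> f_bar f z"
  by (simp add: f_bar_eq step_ext_ge_0)

lemma Avar_diff_le_linear:
  assumes "0 \<le> y" "y \<le> z" shows "Avar f z - Avar f y \<le> (z - y) / f 0"
proof -
  have "(z - y) / f_bar f y \<le> (z - y) / f 0"
    using assms f_pos[of 0] f_bar_pos[of y] by (intro divide_left_mono f_bar_ge) auto
  then show ?thesis using Avar_diff(1)[OF assms] by simp
qed

text \<open>Concavity is used in this form, which allows to move lower order terms out of the argument.\<close>

lemma Avar_subadd:
  assumes "0 \<le> y" "0 \<le> z" shows "Avar f (y + z) \<le> Avar f y + Avar f z"
proof -
  have *: "Avar f (y + z) \<le> Avar f y + Avar f z" if "0 \<le> y" "y \<le> z" for y z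
  proof -
    have "Avar f (y + z) - Avar f z \<le> y / f_bar f z" using Avar_diff(1)[of z "y + z"] that by simp
    also have "\<dots> \<le> y / f_bar f y"
      using that f_bar_pos[of y] f_bar_pos[of z] by (intro divide_left_mono f_bar_mono) auto
    also have "\<dots> \<le> Avar f y" using Avar_diff(2)[of 0 y] that by simp
    finally show ?thesis by simp
  qed
  show ?thesis using *[of y z] *[of z y] assms by (cases "y \<le> z") (auto simp: add.commute)
qed

lemma Avar_nat_mult: "0 \<le> z \<Longrightarrow> Avar f (real n * z) \<le> real n * Avar f z"
proof (induction n)
  case (Suc n)
  have "Avar f (real n * z + z) \<le> Avar f (real n * z) + Avar f z"
    using Suc.prems by (intro Avar_subadd) auto
  then show ?case using Suc by (simp add: algebra_simps)
qed simp

end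

section \<open>Asymptotics for regularly varying attachment rules\<close>

locale rv_rule = rule +
  fixes \<alpha> :: real
  assumes rv: "regularly_varying (step_ext f) \<alpha>"
    and \<alpha>_less: "\<alpha> < 1 / 2"
    and \<alpha>_0: "\<alpha> = 0 \<longrightarrow> filterlim f at_top sequentially"
begin

definition \<rho> :: real where "\<rho> = (1 - 2 * \<alpha>) / (1 - \<alpha>)"

definition \<kappa> :: real where "\<kappa> = (1 - \<alpha>) / (1 - 2 * \<alpha>)"

lemma \<alpha>_nonneg: "0 \<le> \<alpha>"
proof -
  have "((\<lambda>u. step_ext f (2 * u) / step_ext f u) \<longlongrightarrow> 2 powr \<alpha>) at_top"
    using rv by (auto simp: regularly_varying_def)
  moreover have "\<forall>\<^sub>F u in at_top. 1 \<le> step_ext f (2 * u) / step_ext f u"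
    using eventually_ge_at_top[of 0] by eventually_elim (simp add: step_ext_mono step_ext_pos)
  ultimately have "1 \<le> (2::real) powr \<alpha>" by (rule tendsto_lowerbound) simp
  then have "2 powr 0 \<le> (2::real) powr \<alpha>" by simp
  then show ?thesis by (subst (asm) powr_le_cancel_iff) auto
qed

lemma \<rho>_pos: "0 < \<rho>" and \<kappa>_pos: "0 < \<kappa>" and \<kappa>_ge_1: "1 \<le> \<kappa>" and \<rho>_le_1: "\<rho> \<le> 1"
  using \<alpha>_less \<alpha>_nonneg by (auto simp: \<rho>_def \<kappa>_def field_simps)

text \<open>A bounded monotone rule converges to a positive limit, so it varies regularly with index \<open>0\<close>;
  only this index is compatible with boundedness, and it is dealt with by assumption.\<close>

lemma f_at_top: "filterlim f at_top sequentially"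
proof (cases "\<alpha> = 0")
  case False
  then have a: "0 < \<alpha>" using \<alpha>_nonneg by simp
  show ?thesis
  proof (rule ccontr)
    assume "\<not> ?thesis"
    then obtain C where C: "\<not> (\<forall>\<^sub>F n in sequentially. C \<le> f n)" by (auto simp: filterlim_at_top)
    have bd: "f n \<le> C" for n
    proof (rule ccontr)
      assume "\<not> f n \<le> C"
      then have "C \<le> f m" if "n \<le> m" for m using monoD[OF f_mono that] by simp
      then show False using C by (auto simp: eventually_sequentially)
    qed
    define L where "L = (SUP n. f n)"
    have fL: "f \<longlonglongrightarrow> L"
      unfolding L_def using f_mono bd by (intro LIMSEQ_incseq_SUP) (auto simp: bdd_above_def incseq_def mono_def)
    have L: "0 < L"
      using f_pos[of 0] cSUP_upper[of 0 UNIV f] bd by (fastforce simp: L_def bdd_above_def)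
    have "filterlim (\<lambda>u::real. nat \<lfloor>u\<rfloor>) at_top at_top"
      by (rule filterlim_compose[OF filterlim_nat_sequentially filterlim_floor_sequentially])
    from filterlim_compose[OF fL this] have lim: "((\<lambda>u. step_ext f u) \<longlongrightarrow> L) at_top"
      unfolding step_ext_def .
    have "filterlim (\<lambda>u::real. 2 * u) at_top at_top"
      by (rule filterlim_tendsto_pos_mult_at_top[OF tendsto_const]) (auto intro: filterlim_ident)
    then have "((\<lambda>u. step_ext f (2 * u)) \<longlongrightarrow> L) at_top"
      by (rule filterlim_compose[OF lim])
    then have "((\<lambda>u. step_ext f (2 * u) / step_ext f u) \<longlongrightarrow> L / L) at_top"
      using L by (intro tendsto_divide lim) auto
    moreover have "((\<lambda>u. step_ext f (2 * u) / step_ext f u) \<longlongrightarrow> 2 powr \<alpha>) at_top"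
      using rv by (auto simp: regularly_varying_def)
    ultimately have "2 powr \<alpha> = L / L" using tendsto_unique[OF trivial_limit_at_top_linorder] by blast
    then have "2 powr \<alpha> = (2::real) powr 0" using L by simp
    then show False using a by (subst (asm) powr_inj) auto
  qed
qed (use \<alpha>_0 in auto)

lemma Phi_inv_at_top: "filterlim (Phi_inv f) at_top at_top"
  unfolding filterlim_at_top
proof
  fix Z :: real
  have "Z \<le> Phi_inv f z" if "max 0 (Phi f (max 0 Z)) \<le> z" for z
    using Phi_inv_mono[of "Phi f (max 0 Z)" z] Phi_nonneg[of "max 0 Z"] that by auto
  then show "\<forall>\<^sub>F z in at_top. Z \<le> Phi_inv f z"
    unfolding eventually_at_top_linorder by blast
qed

lemma rv_sq: "regularly_varying (step_ext (\<lambda>n. (f n)\<^sup>2)) (2 * \<alpha>)"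
  unfolding regularly_varying_def step_ext_sq
proof (intro allI impI)
  fix c :: real assume "0 < c"
  then have "((\<lambda>u. (step_ext f (c * u) / step_ext f u)\<^sup>2) \<longlongrightarrow> (c powr \<alpha>)\<^sup>2) at_top"
    using rv by (intro tendsto_power) (auto simp: regularly_varying_def)
  then show "((\<lambda>u. (step_ext f (c * u))\<^sup>2 / (step_ext f u)\<^sup>2) \<longlongrightarrow> c powr (2 * \<alpha>)) at_top"
    using \<open>0 < c\<close> by (simp add: power_divide power2_eq_square powr_add[symmetric])
qed

text \<open>This is the asymptotic equivalence \<open>Avar f t \<sim> \<kappa> * t / f_bar f t\<close>: by Karamata's theorem
  both \<open>Phi f\<close> and the integral of \<open>1 / f^2\<close> are explicit multiples of \<open>x / f\<close> and \<open>x / f^2\<close>.\<close>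

lemma Avar_f_bar: "((\<lambda>t. Avar f t * f_bar f t / t) \<longlongrightarrow> \<kappa>) at_top"
proof -
  let ?W = "Phi (\<lambda>n. (f n)\<^sup>2)"
  have 1: "((\<lambda>x. Phi f x * step_ext f x / x) \<longlongrightarrow> 1 / (1 - \<alpha>)) at_top"
    using \<alpha>_less by (intro Karamata rv) auto
  have 2: "((\<lambda>x. ?W x * (step_ext f x)\<^sup>2 / x) \<longlongrightarrow> 1 / (1 - 2 * \<alpha>)) at_top"
    using sq.Karamata[OF rv_sq] \<alpha>_less by (simp add: step_ext_sq)
  have "((\<lambda>x. (?W x * (step_ext f x)\<^sup>2 / x) / (Phi f x * step_ext f x / x))
      \<longlongrightarrow> (1 / (1 - 2 * \<alpha>)) / (1 / (1 - \<alpha>))) at_top"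
    using \<alpha>_less by (intro tendsto_divide 1 2) auto
  moreover have "(1 / (1 - 2 * \<alpha>)) / (1 / (1 - \<alpha>)) = \<kappa>" by (simp add: \<kappa>_def)
  moreover have "\<forall>\<^sub>F x in at_top. (?W x * (step_ext f x)\<^sup>2 / x) / (Phi f x * step_ext f x / x)
      = ?W x * step_ext f x / Phi f x"
    using eventually_gt_at_top[of 0]
  proof eventually_elim
    case (elim x)
    then show ?case using step_ext_pos[of x] Phi_strict_mono[of 0 x] by (simp add: field_simps power2_eq_square)
  qed
  ultimately have "((\<lambda>x. ?W x * step_ext f x / Phi f x) \<longlongrightarrow> \<kappa>) at_top"
    using Lim_transform_eventually by fastforce
  from filterlim_compose[OF this Phi_inv_at_top]
  have "((\<lambda>t. Avar f t * f_bar f t / Phi f (Phi_inv f t)) \<longlongrightarrow> \<kappa>) at_top"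
    by (simp add: Avar_def f_bar_eq)
  then show ?thesis
    by (rule Lim_transform_eventually) (auto intro: eventually_mono[OF eventually_ge_at_top[of 0]])
qed

lemma Avar_pos: "0 < z \<Longrightarrow> 0 < Avar f z"
  using Avar_diff(2)[of 0 z] f_bar_pos[of z] by (auto intro: less_le_trans[of _ "z / f_bar f z"])

text \<open>In terms of \<open>x = Phi_inv f t\<close>, both \<open>t\<close> and \<open>Avar f t\<close> are regularly varying functions of \<open>x\<close>, with
  the indices \<open>1 - \<alpha>\<close> and \<open>1 - 2 * \<alpha>\<close>. The multiple \<open>u * t\<close> corresponds to \<open>c * x\<close> up to factors
  arbitrarily close to \<open>1\<close>, and monotonicity absorbs these factors.\<close>

lemma Avar_rv:
  assumes u: "0 < u"
  shows "((\<lambda>t. Avar f (u * t) / Avar f t) \<longlongrightarrow> u powr \<rho>) at_top"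
proof -
  let ?W = "Phi (\<lambda>n. (f n)\<^sup>2)"
  define c where "c = u powr (1 / (1 - \<alpha>))"
  have a: "0 < 1 - \<alpha>" "0 < 1 - 2 * \<alpha>" using \<alpha>_less \<alpha>_nonneg by auto
  have c: "0 < c" "c powr (1 - \<alpha>) = u" "c powr (1 - 2 * \<alpha>) = u powr \<rho>"
    using u a by (auto simp: c_def powr_powr \<rho>_def)
  have W: "((\<lambda>t. ?W (d * Phi_inv f t) / ?W (Phi_inv f t)) \<longlongrightarrow> d powr (1 - 2 * \<alpha>)) at_top"
    and P: "((\<lambda>t. Phi f (d * Phi_inv f t) / Phi f (Phi_inv f t)) \<longlongrightarrow> d powr (1 - \<alpha>)) at_top"
    if "0 < d" for d
    using sq.Phi_regularly_varying[OF rv_sq] Phi_regularly_varying[OF rv] a that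
    by (auto simp: regularly_varying_def intro!: filterlim_compose[OF _ Phi_inv_at_top])
  have ev: "\<forall>\<^sub>F t in at_top. (0::real) < t" by (rule eventually_gt_at_top)
  show ?thesis
  proof (rule order_tendstoI)
    fix y assume y: "y < u powr \<rho>"
    have "((\<lambda>d. d powr (1 - 2 * \<alpha>)) \<longlongrightarrow> c powr (1 - 2 * \<alpha>)) (at_left c)"
      using c by (intro tendsto_intros) auto
    then have "\<forall>\<^sub>F d in at_left c. y < d powr (1 - 2 * \<alpha>) \<and> d \<in> {0<..<c}"
      using y c by (intro eventually_conj order_tendstoD(1) eventually_at_left_real) auto
    then obtain d where d: "y < d powr (1 - 2 * \<alpha>)" "0 < d" "d < c"
      using eventually_happens[of _ "at_left c"] by auto
    have "d powr (1 - \<alpha>) < u" using c(2) powr_less_mono2[of "1 - \<alpha>" d c] a d by auto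
    then have "\<forall>\<^sub>F t in at_top. Phi f (d * Phi_inv f t) / Phi f (Phi_inv f t) < u"
      by (rule order_tendstoD(2)[OF P[OF d(2)]])
    moreover have "\<forall>\<^sub>F t in at_top. y < ?W (d * Phi_inv f t) / ?W (Phi_inv f t)"
      by (rule order_tendstoD(1)[OF W[OF d(2)] d(1)])
    ultimately show "\<forall>\<^sub>F t in at_top. y < Avar f (u * t) / Avar f t"
      using ev
    proof eventually_elim
      case (elim t)
      have x: "0 \<le> d * Phi_inv f t" using d elim(3) Phi_inv_nonneg[of t] by simp
      have "Phi f (d * Phi_inv f t) \<le> u * t" using elim by (simp add: field_simps)
      then have "?W (d * Phi_inv f t) \<le> Avar f (u * t)"
        using Avar_mono[of "Phi f (d * Phi_inv f t)" "u * t"] Avar_Phi[OF x] Phi_nonneg[OF x] by simp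
      moreover have "0 < Avar f t" using Avar_pos elim by simp
      ultimately show ?case
        using elim(2) unfolding Avar_def[of f t, symmetric]
        by (meson divide_right_mono less_imp_le less_le_trans)
    qed
  next
    fix y assume y: "u powr \<rho> < y"
    have "((\<lambda>d. d powr (1 - 2 * \<alpha>)) \<longlongrightarrow> c powr (1 - 2 * \<alpha>)) (at_right c)"
      using c by (intro tendsto_intros) auto
    then have "\<forall>\<^sub>F d in at_right c. d powr (1 - 2 * \<alpha>) < y \<and> d \<in> {c<..<c+1}"
      using y c by (intro eventually_conj order_tendstoD(2) eventually_at_right_real) auto
    then obtain d where d: "d powr (1 - 2 * \<alpha>) < y" "c < d"
      using eventually_happens[of _ "at_right c"] by auto
    have d0: "0 < d" using d c by simp
    have "u < d powr (1 - \<alpha>)" using c powr_less_mono2[of "1 - \<alpha>" c d] a d by auto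
    then have "\<forall>\<^sub>F t in at_top. u < Phi f (d * Phi_inv f t) / Phi f (Phi_inv f t)"
      by (rule order_tendstoD(1)[OF P[OF d0]])
    moreover have "\<forall>\<^sub>F t in at_top. ?W (d * Phi_inv f t) / ?W (Phi_inv f t) < y"
      by (rule order_tendstoD(2)[OF W[OF d0] d(1)])
    ultimately show "\<forall>\<^sub>F t in at_top. Avar f (u * t) / Avar f t < y"
      using ev
    proof eventually_elim
      case (elim t)
      have x: "0 \<le> d * Phi_inv f t" using d0 elim(3) Phi_inv_nonneg[of t] by simp
      have "u * t \<le> Phi f (d * Phi_inv f t)" using elim by (simp add: field_simps)
      then have "Avar f (u * t) \<le> ?W (d * Phi_inv f t)"
        using Avar_mono[of "u * t" "Phi f (d * Phi_inv f t)"] Avar_Phi[OF x] u elim(3) by simp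
      moreover have "0 < Avar f t" using Avar_pos elim by simp
      ultimately show ?case
        using elim(2) unfolding Avar_def[of f t, symmetric]
        by (meson divide_right_mono less_imp_le le_less_trans)
    qed
  qed
qed

text \<open>Growth by a fixed factor when the argument is doubled makes \<open>1 / Avar f t\<close> and \<open>ln t / Avar f t\<close>
  contractive, so that both tend to \<open>0\<close>.\<close>

lemma Avar_doubling:
  obtains q X where "0 < q" "q < 1" "0 < X" "\<And>t. t \<ge> X \<Longrightarrow> Avar f (1 / 2 * t) \<le> q * Avar f t"
proof -
  have h: "(1 / 2) powr \<rho> < (1::real)" using powr_less_mono2[of \<rho> "1/2" 1] \<rho>_pos by auto
  obtain q where q: "(1 / 2) powr \<rho> < q" "q < 1" using dense[OF h] by auto
  have "\<forall>\<^sub>F t in at_top. Avar f (1 / 2 * t) / Avar f t < q \<and> 0 < t"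
    using order_tendstoD(2)[OF Avar_rv[of "1/2"] q(1)] eventually_gt_at_top
    by (intro eventually_conj) auto
  then obtain X where X: "\<And>t. t \<ge> X \<Longrightarrow> Avar f (1 / 2 * t) / Avar f t < q \<and> 0 < t"
    by (auto simp: eventually_at_top_linorder)
  show ?thesis
  proof (rule that[of q X])
    show "0 < q" by (rule le_less_trans[OF powr_ge_zero q(1)])
    show "Avar f (1 / 2 * t) \<le> q * Avar f t" if "t \<ge> X" for t
      using X[OF that] Avar_pos[of t] by (simp add: field_simps)
  qed (use q X in auto)
qed

lemma Avar_at_top: "filterlim (Avar f) at_top at_top"
proof -
  obtain q X where q: "0 < q" "q < 1" "0 < X" and
    dbl: "\<And>t. t \<ge> X \<Longrightarrow> Avar f (1 / 2 * t) \<le> q * Avar f t" using Avar_doubling by blast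
  have "((\<lambda>t. 1 / Avar f t) \<longlongrightarrow> 0) at_top"
  proof (rule tendstoI)
    fix \<epsilon> :: real assume "0 < \<epsilon>"
    have "\<forall>\<^sub>F t in at_top. 1 / Avar f t \<le> 0 / (1 - q) + \<epsilon> / 2"
    proof (rule contraction_limsup[of "1/2" q X _ 0 "1 / Avar f (1/2 * X)"])
      fix t assume t: "X \<le> t"
      then have "0 < Avar f t" "0 < Avar f (1/2 * t)" using q Avar_pos by auto
      then show "1 / Avar f t \<le> q * (1 / Avar f (1 / 2 * t)) + 0"
        using dbl[OF t] by (simp add: field_simps)
    next
      fix t assume "1 / 2 * X \<le> t" "t \<le> X"
      then show "1 / Avar f t \<le> 1 / Avar f (1/2 * X)"
        using q Avar_pos[of t] Avar_pos[of "1/2 * X"] by (intro divide_left_mono Avar_mono) auto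
    qed (use q \<open>0 < \<epsilon>\<close> in auto)
    with eventually_gt_at_top[of 0] show "\<forall>\<^sub>F t in at_top. dist (1 / Avar f t) 0 < \<epsilon>"
    proof eventually_elim
      case (elim t)
      then show ?case using Avar_pos[of t] \<open>0 < \<epsilon>\<close> by (simp add: dist_real_def)
    qed
  qed
  moreover have "\<forall>\<^sub>F t in at_top. 0 < 1 / Avar f t"
    using eventually_gt_at_top[of 0] by eventually_elim (simp add: Avar_pos)
  ultimately have "filterlim (\<lambda>t. inverse (1 / Avar f t)) at_top at_top"
    by (rule filterlim_inverse_at_top)
  then show ?thesis by simp
qed

lemma Avar_le_eps: "0 < \<epsilon> \<Longrightarrow> \<forall>\<^sub>F t in at_top. Avar f t \<le> \<epsilon> * t"
proof -
  assume \<epsilon>: "0 < \<epsilon>"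
  have "\<forall>\<^sub>F t in at_top. Avar f t * f_bar f t / t < \<kappa> + 1"
    by (rule order_tendstoD(2)[OF Avar_f_bar]) simp
  moreover have "\<forall>\<^sub>F t in at_top. (\<kappa> + 1) / \<epsilon> \<le> f_bar f t"
  proof -
    have "filterlim (\<lambda>u::real. nat \<lfloor>u\<rfloor>) at_top at_top"
      by (rule filterlim_compose[OF filterlim_nat_sequentially filterlim_floor_sequentially])
    from filterlim_compose[OF f_at_top this] have "filterlim (step_ext f) at_top at_top"
      unfolding step_ext_def[abs_def] .
    from filterlim_compose[OF this Phi_inv_at_top] show ?thesis
      unfolding f_bar_eq filterlim_at_top by blast
  qed
  ultimately show ?thesis using eventually_gt_at_top[of 0]
  proof eventually_elim
    case (elim t)
    have "Avar f t * ((\<kappa> + 1) / \<epsilon>) \<le> Avar f t * f_bar f t"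
      using elim Avar_pos[of t] by (intro mult_left_mono) auto
    also have "\<dots> \<le> (\<kappa> + 1) * t" using elim by (simp add: field_simps)
    finally have "(\<kappa> + 1) * Avar f t \<le> (\<kappa> + 1) * (\<epsilon> * t)" using \<epsilon> by (simp add: field_simps)
    then show ?case using \<kappa>_pos by simp
  qed
qed

lemma ln_le_Avar: "0 < \<epsilon> \<Longrightarrow> \<forall>\<^sub>F t in at_top. ln t \<le> \<epsilon> * Avar f t"
proof -
  assume \<epsilon>: "0 < \<epsilon>"
  obtain q X where q: "0 < q" "q < 1" "0 < X" and
    dbl: "\<And>t. t \<ge> X \<Longrightarrow> Avar f (1 / 2 * t) \<le> q * Avar f t" using Avar_doubling by blast
  define b where "b = \<epsilon> / 2 * (1 - q)"
  have b: "0 < b" using \<epsilon> q by (simp add: b_def)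
  have "\<forall>\<^sub>F t in at_top. ln 2 / b \<le> Avar f t" using Avar_at_top by (auto simp: filterlim_at_top)
  then obtain Y where Y: "\<And>t. t \<ge> Y \<Longrightarrow> ln 2 / b \<le> Avar f t" by (auto simp: eventually_at_top_linorder)
  define X' where "X' = max X (max Y 2)"
  have "\<forall>\<^sub>F t in at_top. ln t / Avar f t \<le> b / (1 - q) + \<epsilon> / 2"
  proof (rule contraction_limsup[of "1/2" q X' _ b "ln X' / Avar f (1/2 * X')"])
    fix t assume t: "X' \<le> t"
    then have t': "2 \<le> t" "X \<le> t" "Y \<le> t" by (auto simp: X'_def)
    then have p: "0 < Avar f t" "0 < Avar f (1/2 * t)" using Avar_pos by auto
    have "ln t = ln (1/2 * t) + ln 2" using t' by (simp add: ln_div)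
    then have "ln t / Avar f t = ln (1/2 * t) * (1 / Avar f t) + ln 2 / Avar f t"
      by (simp add: add_divide_distrib)
    also have "ln (1/2 * t) * (1 / Avar f t) \<le> ln (1/2 * t) * (q / Avar f (1/2 * t))"
      using t' p dbl[OF t'(2)] by (intro mult_left_mono) (auto simp: field_simps)
    also have "ln 2 / Avar f t \<le> b"
      using Y[OF t'(3)] b p by (simp add: field_simps)
    finally show "ln t / Avar f t \<le> q * (ln (1/2 * t) / Avar f (1/2 * t)) + b" by (simp add: mult.commute)
  next
    fix t assume t: "1 / 2 * X' \<le> t" "t \<le> X'"
    have X': "2 \<le> X'" by (simp add: X'_def)
    show "ln t / Avar f t \<le> ln X' / Avar f (1/2 * X')"
      using t X' Avar_pos[of t] Avar_pos[of "1/2 * X'"]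
      by (intro frac_le Avar_mono) auto
  qed (use q \<epsilon> in \<open>auto simp: X'_def\<close>)
  with eventually_gt_at_top[of 0] show ?thesis
  proof eventually_elim
    case (elim t)
    have "1 - q \<noteq> 0" using q by simp
    then have "b / (1 - q) = \<epsilon> / 2" unfolding b_def by (rule nonzero_mult_div_cancel_right)
    then have "b / (1 - q) + \<epsilon> / 2 = \<epsilon>" by linarith
    then show ?case using elim Avar_pos[of t] by (simp add: field_simps)
  qed
qed

text \<open>A term that is linear in \<open>Avar f t\<close> contributes to the variance only to a lower order.\<close>

lemma Avar_Avar_le:
  assumes \<epsilon>: "0 < \<epsilon>" and B: "0 \<le> B"
  shows "\<forall>\<^sub>F t in at_top. Avar f (B * Avar f t + B) \<le> \<epsilon> * Avar f t"
proof -
  define d where "d = (\<epsilon> / 2) powr (1 / \<rho>)"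
  have d: "0 < d" "d powr \<rho> = \<epsilon> / 2" using \<epsilon> \<rho>_pos by (auto simp: d_def powr_powr)
  have "\<forall>\<^sub>F t in at_top. Avar f (d * t) / Avar f t < \<epsilon>"
    using d \<epsilon> by (intro order_tendstoD(2)[OF Avar_rv]) auto
  moreover have "\<forall>\<^sub>F t in at_top. Avar f t \<le> (d / (2 * (B + 1))) * t"
    using d B by (intro Avar_le_eps) auto
  moreover have "\<forall>\<^sub>F t in at_top. 2 * B / d \<le> t" by (rule eventually_ge_at_top)
  ultimately show ?thesis using eventually_gt_at_top[of 0]
  proof eventually_elim
    case (elim t)
    have "B * Avar f t \<le> (B + 1) * Avar f t" using Avar_pos[of t] elim by (intro mult_right_mono) auto
    also have "\<dots> \<le> d * t / 2" using elim(2) B by (simp add: field_simps)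
    finally have 1: "B * Avar f t + B \<le> d * t" using elim d by (simp add: field_simps)
    have "Avar f (B * Avar f t + B) \<le> Avar f (d * t)"
      using B Avar_pos[of t] elim 1 by (intro Avar_mono) auto
    also have "\<dots> \<le> \<epsilon> * Avar f t" using elim Avar_pos[of t] by (simp add: field_simps)
    finally show ?case .
  qed
qed

text \<open>Pointwise convergence of monotone functions to a continuous limit is uniform.\<close>

lemma Avar_uniform:
  assumes \<epsilon>: "0 < \<epsilon>"
  shows "\<forall>\<^sub>F t in at_top. \<forall>u\<in>{0..1}. \<bar>Avar f (u * t) / Avar f t - u powr \<rho>\<bar> \<le> \<epsilon>"
proof -
  have "uniformly_continuous_on {0..1} (\<lambda>u::real. u powr \<rho>)"
    using \<rho>_pos by (intro compact_uniformly_continuous continuous_on_powr') (auto intro: continuous_intros)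
  then obtain \<delta> where \<delta>: "0 < \<delta>" "\<And>u v. u \<in> {0..1} \<Longrightarrow> v \<in> {0..1} \<Longrightarrow> dist v u < \<delta> \<Longrightarrow>
      dist (v powr \<rho>) (u powr \<rho>) < \<epsilon> / 2"
    unfolding uniformly_continuous_on_def using \<epsilon> by (metis half_gt_zero)
  obtain N :: nat where N: "1 / \<delta> < real N" using reals_Archimedean2 by blast
  have N0: "0 < N" using N \<delta> by (metis gr0I less_asym of_nat_0 zero_less_divide_1_iff)
  have "\<forall>\<^sub>F t in at_top. \<forall>i\<in>{0..N}. \<bar>Avar f (real i / N * t) / Avar f t - (real i / N) powr \<rho>\<bar> < \<epsilon> / 2"
  proof (rule eventually_ball_finite)
    show "\<forall>i\<in>{0..N}. \<forall>\<^sub>F t in at_top. \<bar>Avar f (real i / N * t) / Avar f t - (real i / N) powr \<rho>\<bar> < \<epsilon> / 2"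
    proof
      fix i
      show "\<forall>\<^sub>F t in at_top. \<bar>Avar f (real i / N * t) / Avar f t - (real i / N) powr \<rho>\<bar> < \<epsilon> / 2"
      proof (cases "i = 0")
        case False
        then have "((\<lambda>t. Avar f (real i / N * t) / Avar f t) \<longlongrightarrow> (real i / N) powr \<rho>) at_top"
          using N0 by (intro Avar_rv) auto
        from tendstoD[OF this, of "\<epsilon> / 2"] \<epsilon> show ?thesis by (simp add: dist_real_def)
      qed (use \<epsilon> in auto)
    qed
  qed simp
  with eventually_gt_at_top[of 0] show ?thesis
  proof eventually_elim
    case (elim t)
    show ?case
    proof
      fix u :: real assume u: "u \<in> {0..1}"
      define i where "i = nat \<lfloor>u * N\<rfloor>"
      have i: "real i \<le> u * N" "u * N < real i + 1" using u by (auto simp: i_def)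
      have At: "0 < Avar f t" using elim Avar_pos by simp
      define g where "g v = Avar f (v * t) / Avar f t" for v
      have gm: "g v \<le> g w" if "0 \<le> v" "v \<le> w" for v w
        unfolding g_def using that elim At by (intro divide_right_mono Avar_mono mult_right_mono) auto
      have uN: "u * N \<le> N" using u by (simp add: mult_left_le_one_le)
      have lo: "real i / N \<le> u" using i N0 by (simp add: field_simps)
      have iN: "i \<in> {0..N}" using i(1) uN by auto
      have "dist u (real i / N) < \<delta>"
        using i N N0 \<delta> lo by (simp add: dist_real_def field_simps)
      then have c1: "\<bar>u powr \<rho> - (real i / N) powr \<rho>\<bar> < \<epsilon> / 2"
        using \<delta>(2)[of "real i / N" u] u lo by (simp add: dist_real_def)
      have "\<bar>g (real i / N) - (real i / N) powr \<rho>\<bar> < \<epsilon> / 2" using elim(2) iN by (simp add: g_def)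
      moreover have "g (real i / N) \<le> g u" using lo by (intro gm) auto
      ultimately have A: "u powr \<rho> - \<epsilon> \<le> g u" using c1 by linarith
      have "g u \<le> u powr \<rho> + \<epsilon>"
      proof (cases "i = N")
        case True
        then have "u = 1" using lo u N0 by auto
        then show ?thesis using At \<epsilon> by (simp add: g_def)
      next
        case False
        then have jN: "Suc i \<in> {0..N}" using iN by auto
        have up: "u \<le> real (Suc i) / N" using i N0 by (simp add: field_simps)
        have "dist u (real (Suc i) / N) < \<delta>"
        proof -
          have "dist u (real (Suc i) / N) = real (Suc i) / N - u" using up by (simp add: dist_real_def)
          also have "\<dots> \<le> 1 / N" using lo by (simp add: add_divide_distrib)
          also have "\<dots> < \<delta>" using N \<delta> N0 by (simp add: field_simps)
          finally show ?thesis .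
        qed
        moreover have "real (Suc i) / N \<in> {0..1}" using jN N0 by auto
        ultimately have c2: "\<bar>u powr \<rho> - (real (Suc i) / N) powr \<rho>\<bar> < \<epsilon> / 2"
          using \<delta>(2)[of "real (Suc i) / N" u] u by (simp add: dist_real_def)
        have "\<bar>g (real (Suc i) / N) - (real (Suc i) / N) powr \<rho>\<bar> < \<epsilon> / 2" using elim(2) jN unfolding g_def by blast
        moreover have "g u \<le> g (real (Suc i) / N)" using up u by (intro gm) auto
        ultimately show ?thesis using c2 by linarith
      qed
      with A show "\<bar>Avar f (u * t) / Avar f t - u powr \<rho>\<bar> \<le> \<epsilon>" by (simp add: g_def abs_le_iff)
    qed
  qed
qed

text \<open>The third order term in the expansion of \<open>ln (1 + 1 / f)\<close> is negligible because \<open>f\<close> is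
  unbounded.\<close>

lemma cube_sum_le:
  assumes "0 < \<epsilon>"
  shows "\<exists>C\<ge>0. \<forall>k. (\<Sum>j<k. 1 / (3 * (f j) ^ 3)) \<le> \<epsilon> * Avar f (Phi f (real k)) + C"
proof -
  have "\<forall>\<^sub>F n in sequentially. 1 / \<epsilon> \<le> f n" using f_at_top by (auto simp: filterlim_at_top)
  then obtain N where N: "\<And>n. n \<ge> N \<Longrightarrow> 1 / \<epsilon> \<le> f n" by (auto simp: eventually_sequentially)
  define C where "C = (\<Sum>j<N. 1 / (3 * (f j) ^ 3))"
  have pos: "0 \<le> 1 / (3 * (f j) ^ 3)" for j using f_pos[of j] by simp
  have "(\<Sum>j<k. 1 / (3 * (f j) ^ 3)) \<le> \<epsilon> * Avar f (Phi f (real k)) + C" for k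
  proof -
    have "(\<Sum>j<k. 1 / (3 * (f j) ^ 3)) \<le> (\<Sum>j<k. \<epsilon> * (1 / (f j)\<^sup>2) + (if j < N then 1 / (3 * (f j) ^ 3) else 0))"
    proof (rule sum_mono)
      fix j
      show "1 / (3 * (f j) ^ 3) \<le> \<epsilon> * (1 / (f j)\<^sup>2) + (if j < N then 1 / (3 * (f j) ^ 3) else 0)"
      proof (cases "j < N")
        case False
        then have "1 \<le> \<epsilon> * f j" using N[of j] assms by (simp add: field_simps)
        then have "1 \<le> 3 * (\<epsilon> * f j)" by simp
        then show ?thesis using f_pos[of j] False
          by (simp add: field_simps power2_eq_square power3_eq_cube)
      qed (use assms in auto)
    qed
    also have "\<dots> = \<epsilon> * (\<Sum>j<k. 1 / (f j)\<^sup>2) + (\<Sum>j<k. if j < N then 1 / (3 * (f j) ^ 3) else 0)"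
      by (simp add: sum.distrib sum_distrib_left)
    also have "(\<Sum>j<k. if j < N then 1 / (3 * (f j) ^ 3) else 0) = (\<Sum>j\<in>{..<k} \<inter> {j. j < N}. 1 / (3 * (f j) ^ 3))"
      by (simp add: sum.If_cases)
    also have "\<dots> \<le> C" unfolding C_def using pos by (intro sum_mono2) auto
    finally show ?thesis by (simp add: Avar_Phi_nat)
  qed
  moreover have "0 \<le> C" unfolding C_def using pos by (intro sum_nonneg) auto
  ultimately show ?thesis by blast
qed

end

section \<open>Exponential weights\<close>

text \<open>The second order Taylor bounds for the logarithm that enter the Chernoff estimates.\<close>

lemma ln_1_plus_ge:
  assumes "0 \<le> x" shows "x - x\<^sup>2 / 2 \<le> ln (1 + x :: real)"
proof -
  let ?g = "\<lambda>x::real. ln (1 + x) - x + x\<^sup>2 / 2"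
  have "?g 0 \<le> ?g x"
  proof (rule DERIV_nonneg_imp_nondecreasing[OF assms])
    fix y :: real assume y: "0 \<le> y" "y \<le> x"
    have "(?g has_real_derivative (1 / (1 + y) - 1 + y)) (at y)"
      using y by (auto intro!: derivative_eq_intros)
    moreover have "1 / (1 + y) - 1 + y = y\<^sup>2 / (1 + y)" using y by (simp add: field_simps power2_eq_square)
    ultimately show "\<exists>z. (?g has_real_derivative z) (at y) \<and> 0 \<le> z" using y by auto
  qed
  then show ?thesis by simp
qed

lemma ln_1_plus_le:
  assumes "0 \<le> x" shows "ln (1 + x :: real) \<le> x - x\<^sup>2 / 2 + x ^ 3 / 3"
proof -
  let ?g = "\<lambda>x::real. x - x\<^sup>2 / 2 + x ^ 3 / 3 - ln (1 + x)"
  have "?g 0 \<le> ?g x"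
  proof (rule DERIV_nonneg_imp_nondecreasing[OF assms])
    fix y :: real assume y: "0 \<le> y" "y \<le> x"
    have "(?g has_real_derivative (1 - y + y\<^sup>2 - 1 / (1 + y))) (at y)"
      using y by (auto intro!: derivative_eq_intros)
    moreover have "1 - y + y\<^sup>2 - 1 / (1 + y) = y ^ 3 / (1 + y)"
      using y by (simp add: field_simps power2_eq_square power3_eq_cube)
    ultimately show "\<exists>z. (?g has_real_derivative z) (at y) \<and> 0 \<le> z" using y by auto
  qed
  then show ?thesis by simp
qed

context rule
begin

lemma Phi_Suc: "Phi f (real (Suc k)) = Phi f (real k) + 1 / f k"
  unfolding Phi_nat by simp

lemma Avar_Phi_Suc: "Avar f (Phi f (real (Suc k))) = Avar f (Phi f (real k)) + 1 / (f k)\<^sup>2"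
  unfolding Avar_Phi_nat by simp

text \<open>The factor \<open>1 + \<theta> / f k\<close> at a jump from \<open>k\<close>, which occurs with probability \<open>f k / n\<close>, contributes
  \<open>\<theta> / n\<close> to the mean relative increment. The product is the discrete counterpart of
  \<open>exp (\<theta> * Phi f k)\<close>.\<close>

definition tilt :: "real \<Rightarrow> nat \<Rightarrow> real" where
  "tilt \<theta> k = (\<Prod>j<k. 1 + \<theta> / f j)"

lemma tilt_0 [simp]: "tilt \<theta> 0 = 1"
  by (simp add: tilt_def)

lemma tilt_Suc: "tilt \<theta> (Suc k) = tilt \<theta> k * (1 + \<theta> / f k)"
  by (simp add: tilt_def)

lemma tilt_factor_pos: "- f 0 < \<theta> \<Longrightarrow> 0 < 1 + \<theta> / f j"
  using f_ge_0[of j] f_pos[of j] by (simp add: field_simps)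

lemma tilt_pos: "- f 0 < \<theta> \<Longrightarrow> 0 < tilt \<theta> k"
  unfolding tilt_def by (intro prod_pos ballI tilt_factor_pos)

lemma tilt_mono:
  assumes "0 \<le> \<theta>" "j \<le> k" shows "tilt \<theta> j \<le> tilt \<theta> k"
  using assms(2)
proof (induction rule: dec_induct)
  case (step n)
  have "tilt \<theta> n * 1 \<le> tilt \<theta> n * (1 + \<theta> / f n)"
    using assms f_pos[of n] f_pos[of 0] tilt_pos[of \<theta> n] by (intro mult_left_mono) auto
  then show ?case using step by (simp add: tilt_Suc)
qed simp

text \<open>On a tail event the weight for one parameter is bounded by the weight for another one, with the
  worst ratio at the threshold.\<close>

lemma tilt_ratio_mono:
  assumes \<theta>: "0 \<le> \<theta>" "\<theta> \<le> \<theta>'" and "j \<le> k"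
  shows "tilt \<theta> k / tilt \<theta>' k \<le> tilt \<theta> j / tilt \<theta>' j"
  using \<open>j \<le> k\<close>
proof (induction rule: dec_induct)
  case (step n)
  have p: "0 < tilt \<theta> n" "0 < tilt \<theta>' n" using \<theta> f_pos[of 0] by (auto intro!: tilt_pos)
  have q: "0 < 1 + \<theta> / f n" "1 + \<theta> / f n \<le> 1 + \<theta>' / f n"
    using \<theta> f_pos[of n] by (auto intro: divide_right_mono add_pos_nonneg)
  have "tilt \<theta> (Suc n) / tilt \<theta>' (Suc n) = tilt \<theta> n / tilt \<theta>' n * ((1 + \<theta> / f n) / (1 + \<theta>' / f n))"
    by (simp add: tilt_Suc)
  also have "\<dots> \<le> tilt \<theta> n / tilt \<theta>' n * 1"
    using p q by (intro mult_left_mono) auto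
  finally show ?case using step by simp
qed simp

text \<open>The common form of the lower bounds for positive and negative \<open>\<theta>\<close>: a quadratic lower bound for
  the logarithm with constant \<open>c\<close> is summed over the indegrees from \<open>j\<close> to \<open>k\<close>.\<close>

lemma tilt_quotient_ge:
  assumes "- f 0 < \<theta>" and "j \<le> k"
    and c: "\<And>i. \<theta> / f i - c * (1 / (f i)\<^sup>2) \<le> ln (1 + \<theta> / f i)"
  shows "exp (\<theta> * (Phi f (real k) - Phi f (real j)) - c * (Avar f (Phi f (real k)) - Avar f (Phi f (real j))))
    \<le> tilt \<theta> k / tilt \<theta> j"
  using \<open>j \<le> k\<close>
proof (induction rule: dec_induct)
  case (step n)
  have p: "0 < tilt \<theta> n" "0 < tilt \<theta> j" using assms by (auto intro!: tilt_pos)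
  have "exp (\<theta> / f n - c * (1 / (f n)\<^sup>2)) \<le> exp (ln (1 + \<theta> / f n))"
    by (rule exp_mono[OF c])
  also have "\<dots> = 1 + \<theta> / f n" using tilt_factor_pos[OF assms(1)] by simp
  finally have "exp (\<theta> * (Phi f (real n) - Phi f (real j)) - c * (Avar f (Phi f (real n)) - Avar f (Phi f (real j))))
      * exp (\<theta> / f n - c * (1 / (f n)\<^sup>2)) \<le> tilt \<theta> n / tilt \<theta> j * (1 + \<theta> / f n)"
    using step p by (intro mult_mono) auto
  then show ?case
    unfolding Avar_Phi_Suc unfolding Phi_Suc tilt_Suc by (simp add: exp_add[symmetric] algebra_simps)
qed (use tilt_pos[OF assms(1), of j] in auto)

lemma tilt_quotient_ge_pos:
  assumes "0 \<le> \<theta>" "j \<le> k"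
  shows "exp (\<theta> * (Phi f (real k) - Phi f (real j)) - \<theta>\<^sup>2 / 2 * (Avar f (Phi f (real k)) - Avar f (Phi f (real j))))
    \<le> tilt \<theta> k / tilt \<theta> j"
proof (rule tilt_quotient_ge)
  show "\<theta> / f i - \<theta>\<^sup>2 / 2 * (1 / (f i)\<^sup>2) \<le> ln (1 + \<theta> / f i)" for i
    using ln_1_plus_ge[of "\<theta> / f i"] assms f_pos[of i] by (simp add: power_divide)
qed (use assms f_pos[of 0] in auto)

lemma tilt_quotient_ge_neg:
  assumes "0 \<le> \<eta>" "\<eta> \<le> f 0 / 2" "j \<le> k"
  shows "exp (- \<eta> * (Phi f (real k) - Phi f (real j)) - 2 * \<eta>\<^sup>2 * (Avar f (Phi f (real k)) - Avar f (Phi f (real j))))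
    \<le> tilt (- \<eta>) k / tilt (- \<eta>) j"
proof (rule tilt_quotient_ge)
  fix i
  have "\<eta> / f i \<le> 1 / 2" using assms f_ge_0[of i] f_pos[of i] by (simp add: field_simps)
  then show "- \<eta> / f i - 2 * \<eta>\<^sup>2 * (1 / (f i)\<^sup>2) \<le> ln (1 + - \<eta> / f i)"
    using ln_one_minus_pos_lower_bound[of "\<eta> / f i"] assms f_pos[of i] by (simp add: power_divide)
qed (use assms f_pos[of 0] in auto)

lemma tilt_ge:
  "0 \<le> \<theta> \<Longrightarrow> exp (\<theta> * Phi f (real k) - \<theta>\<^sup>2 / 2 * Avar f (Phi f (real k))) \<le> tilt \<theta> k"
  using tilt_quotient_ge_pos[of \<theta> 0 k] by simp

definition cubes :: "nat \<Rightarrow> real" where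
  "cubes k = (\<Sum>j<k. 1 / (3 * (f j) ^ 3))"

lemma tilt_1_le:
  "tilt 1 k \<le> exp (Phi f (real k) - Avar f (Phi f (real k)) / 2 + cubes k)"
proof (induction k)
  case (Suc k)
  have "1 + 1 / f k = exp (ln (1 + 1 / f k))" using f_pos[of k] by (simp add: add_pos_pos)
  also have "\<dots> \<le> exp (1 / f k - (1 / f k)\<^sup>2 / 2 + (1 / f k) ^ 3 / 3)"
    using f_pos[of k] by (intro exp_mono ln_1_plus_le) auto
  finally have "tilt 1 k * (1 + 1 / f k) \<le> exp (Phi f (real k) - Avar f (Phi f (real k)) / 2 + cubes k)
      * exp (1 / f k - (1 / f k)\<^sup>2 / 2 + (1 / f k) ^ 3 / 3)"
    using Suc tilt_pos[of 1 k] f_pos[of 0] f_pos[of k] by (intro mult_mono) auto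
  then show ?case
    unfolding Avar_Phi_Suc unfolding Phi_Suc tilt_Suc cubes_def
    by (simp add: exp_add[symmetric] algebra_simps power_divide add_divide_distrib)
qed (simp add: cubes_def)

lemma Avar_Phi_diff_le:
  assumes "j \<le> k"
  shows "Avar f (Phi f (real k)) - Avar f (Phi f (real j)) \<le> Avar f (Phi f (real k) - Phi f (real j))"
  using Avar_subadd[of "Phi f (real j)" "Phi f (real k) - Phi f (real j)"] assms
    Phi_le_iff[of "real j" "real k"] Phi_nonneg[of "real j"] by simp

end

section \<open>Artificial time\<close>

lemma Psi_Suc: "1 \<le> n \<Longrightarrow> Psi (Suc n) = Psi n + 1 / real n"
  by (simp add: Psi_def)

lemma Psi_1 [simp]: "Psi (Suc 0) = 0"
  by (simp add: Psi_def)

lemma Psi_diff: "1 \<le> m \<Longrightarrow> m \<le> n \<Longrightarrow> Psi n - Psi m = (\<Sum>i=m..<n. 1 / real i)"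
  unfolding Psi_def by (subst sum_diff_nat_ivl) auto

lemma Psi_less: "1 \<le> m \<Longrightarrow> m < n \<Longrightarrow> Psi m < Psi n"
proof (induction n)
  case (Suc n)
  then have "1 \<le> n" by simp
  then have "Psi n < Psi (Suc n)" using Psi_Suc by simp
  then show ?case using Suc by (cases "m = n") auto
qed simp

lemma Psi_le_iff: "1 \<le> m \<Longrightarrow> 1 \<le> n \<Longrightarrow> Psi m \<le> Psi n \<longleftrightarrow> m \<le> n"
  using Psi_less[of m n] Psi_less[of n m] by (cases m n rule: linorder_cases) auto

lemma Psi_nonneg: "0 \<le> Psi n"
  unfolding Psi_def by (intro sum_nonneg) auto

lemma Psi_inj: "inj_on Psi {1..}"
  by (intro inj_onI) (metis Psi_le_iff atLeast_iff order_antisym order_refl)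

lemma label_Psi [simp]: "1 \<le> m \<Longrightarrow> label (Psi m) = m"
  unfolding label_def by (intro inv_into_f_f Psi_inj) auto

lemma ln_le_Psi: "1 \<le> n \<Longrightarrow> ln (real n) \<le> Psi n"
proof (induction n rule: dec_induct)
  case (step n)
  have "ln (real (Suc n)) - ln (real n) = ln (real (Suc n) / real n)"
    using step by (subst ln_div) auto
  also have "real (Suc n) / real n = 1 + 1 / real n" using step by (simp add: field_simps)
  also have "ln \<dots> \<le> 1 / real n" using step by (intro ln_add_one_self_le_self) auto
  finally show ?case using step by (simp add: Psi_Suc)
qed simp

lemma Psi_le_ln: "1 \<le> n \<Longrightarrow> Psi n \<le> 1 + ln (real n)"
proof -
  have "Psi (Suc n) \<le> 1 + ln (real n)" if "1 \<le> n" for n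
    using that
  proof (induction n rule: dec_induct)
    case (step n)
    let ?x = "1 / (real n + 1)"
    have "ln (real n) - ln (real (Suc n)) = ln (real n / real (Suc n))"
      using step by (subst ln_div) auto
    moreover have "real n / real (Suc n) = 1 - ?x" by (simp add: field_simps)
    moreover have "ln (1 - ?x) \<le> - ?x" using step ln_le_minus_one[of "1 - ?x"] by simp
    ultimately show ?case using step by (simp add: Psi_Suc add.commute)
  qed (simp add: Psi_def)
  then show "1 \<le> n \<Longrightarrow> Psi n \<le> 1 + ln (real n)"
    using Psi_le_iff[of n "Suc n"] by force
qed

lemma Psi_unbounded: obtains n where "1 \<le> n" "t < Psi n"
proof -
  obtain n :: nat where n: "exp t < real n" using reals_Archimedean2 by blast
  then have "0 < real n" using exp_gt_zero[of t] by linarith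
  then have "t < ln (real n)" using n by (metis exp_ln exp_less_cancel_iff)
  then show ?thesis using ln_le_Psi[of n] that[of n] \<open>0 < real n\<close> by force
qed

text \<open>\<open>clock t\<close> is the label of the youngest vertex at artificial time \<open>t\<close>.\<close>

definition clock :: "real \<Rightarrow> nat" where
  "clock t = label (last_time t)"

context
  fixes t :: real
  assumes t: "0 \<le> t"
begin

lemma finite_art_times: "finite (art_times \<inter> {0..t})"
proof -
  obtain n where n: "1 \<le> n" "t < Psi n" by (rule Psi_unbounded)
  have "art_times \<inter> {0..t} \<subseteq> Psi ` {..n}"
  proof
    fix s assume "s \<in> art_times \<inter> {0..t}"
    then obtain m where m: "1 \<le> m" "s = Psi m" "Psi m \<le> t" by (auto simp: art_times_def)
    then have "m \<le> n" using Psi_le_iff[of m n] n by simp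
    then show "s \<in> Psi ` {..n}" using m by auto
  qed
  then show ?thesis by (rule finite_subset) simp
qed

lemma last_time_in: "last_time t \<in> art_times \<inter> {0..t}"
proof -
  have "Psi 1 \<in> art_times \<inter> {0..t}" using t by (simp add: art_times_def image_iff) (metis Psi_1 atLeast_iff le_refl)
  then show ?thesis unfolding last_time_def by (intro Max_in finite_art_times) auto
qed

lemma clock_ge_1: "1 \<le> clock t" and Psi_clock: "Psi (clock t) = last_time t"
  using last_time_in by (auto simp: clock_def art_times_def)

lemma Psi_clock_le: "Psi (clock t) \<le> t"
  using last_time_in by (simp add: Psi_clock)

lemma le_clock_iff: assumes "1 \<le> m" shows "m \<le> clock t \<longleftrightarrow> Psi m \<le> t"
proof
  assume "m \<le> clock t"
  then show "Psi m \<le> t" using Psi_le_iff[OF assms clock_ge_1] Psi_clock_le by simp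
next
  assume "Psi m \<le> t"
  then have "Psi m \<in> art_times \<inter> {0..t}" using assms Psi_nonneg[of m] by (auto simp: art_times_def)
  then have "Psi m \<le> last_time t" unfolding last_time_def by (intro Max_ge finite_art_times)
  then show "m \<le> clock t" using Psi_le_iff[OF assms clock_ge_1] Psi_clock by simp
qed

lemma clock_gt: "t - 1 < Psi (clock t)"
proof -
  have "\<not> Suc (clock t) \<le> clock t" by simp
  then have "t < Psi (Suc (clock t))" using le_clock_iff[of "Suc (clock t)"] by auto
  also have "\<dots> = Psi (clock t) + 1 / real (clock t)" using clock_ge_1 by (rule Psi_Suc)
  also have "\<dots> \<le> Psi (clock t) + 1" using clock_ge_1 by simp
  finally show ?thesis by simp
qed

end

lemma clock_mono: "0 \<le> t \<Longrightarrow> t \<le> t' \<Longrightarrow> clock t \<le> clock t'"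
  using clock_ge_1[of t] Psi_clock_le[of t] le_clock_iff[of t' "clock t"] by simp

lemma sum_inverse_le_clock: "0 \<le> t \<Longrightarrow> (\<Sum>m=1..clock t. 1 / real m) \<le> t + 1"
proof -
  assume t: "0 \<le> t"
  have "(\<Sum>m=1..clock t. 1 / real m) = Psi (Suc (clock t))"
    by (simp add: Psi_def atLeastLessThanSuc_atLeastAtMost)
  also have "\<dots> = Psi (clock t) + 1 / real (clock t)" using clock_ge_1[OF t] by (rule Psi_Suc)
  also have "\<dots> \<le> t + 1" using Psi_clock_le[OF t] clock_ge_1[OF t] by (intro add_mono) auto
  finally show ?thesis .
qed

lemma Z_Psi:
  assumes "1 \<le> m" "0 \<le> t"
  shows "Z f \<gamma> (Psi m) t = Phi f (real (indegree (\<gamma> (max m (clock t))) m))"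
proof -
  have "max (Psi m) (last_time t) = Psi (max m (clock t))"
    using Psi_le_iff[of m "clock t"] Psi_le_iff[of "clock t" m] clock_ge_1[of t] Psi_clock[of t] assms
    by (auto simp: max_def)
  then show ?thesis using assms clock_ge_1[of t] by (simp add: Z_def)
qed

lemma art_times_upto: "0 \<le> t \<Longrightarrow> art_times \<inter> {0..t} = Psi ` {1..clock t}"
  using le_clock_iff[of t] Psi_nonneg by (fastforce simp: art_times_def)

lemma hubs_iff:
  assumes "0 \<le> t"
  shows "s \<in> hubs f \<gamma> t \<longleftrightarrow> (\<exists>m\<in>{1..clock t}. s = Psi m \<and>
    (\<forall>m'\<in>{1..clock t}. Phi f (real (indegree (\<gamma> (clock t)) m')) \<le> Phi f (real (indegree (\<gamma> (clock t)) m))))"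
  using assms unfolding hubs_def art_times_upto[OF assms] by (fastforce simp: Z_Psi max_def)

text \<open>The normalisation of the weights is explicit for \<open>\<theta> = 1\<close> and at most exponential in
  artificial time in general.\<close>

lemma prod_le_exp_Psi:
  assumes "1 \<le> m" "m \<le> n" "-1 \<le> \<theta>"
  shows "(\<Prod>i=m..<n. 1 + \<theta> / real i) \<le> exp (\<theta> * (Psi n - Psi m))"
proof -
  have "(\<Prod>i=m..<n. 1 + \<theta> / real i) \<le> (\<Prod>i=m..<n. exp (\<theta> / real i))"
  proof (intro prod_mono conjI)
    fix i assume "i \<in> {m..<n}"
    then have "1 \<le> real i" using assms by auto
    then have "- 1 \<le> \<theta> / real i" using assms by (simp add: field_simps)
    then show "0 \<le> 1 + \<theta> / real i" by simp
  qed (rule exp_ge_add_one_self)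
  also have "\<dots> = exp (\<theta> * (Psi n - Psi m))"
    unfolding Psi_diff[OF assms(1,2)] by (simp add: exp_sum[symmetric] sum_distrib_left)
  finally show ?thesis .
qed

lemma prod_1_plus_inverse:
  assumes "1 \<le> m" "m \<le> n"
  shows "(\<Prod>i=m..<n. 1 + 1 / real i) = real n / real m"
  using assms(2)
proof (induction rule: dec_induct)
  case (step n)
  have "(\<Prod>i=m..<Suc n. 1 + 1 / real i) = real n / real m * (1 + 1 / real n)"
    using step by (simp add: prod.op_ivl_Suc)
  also have "\<dots> = real (Suc n) / real m" using step assms by (simp add: field_simps)
  finally show ?case .
qed (use assms in auto)

lemma prod_1_plus_inverse_ge:
  assumes "1 \<le> m" "m \<le> n"
  shows "exp (Psi n - Psi m - 1) \<le> (\<Prod>i=m..<n. 1 + 1 / real i)"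
proof -
  have "Psi n - Psi m - 1 \<le> ln (real n / real m)"
    using Psi_le_ln[of n] ln_le_Psi[of m] assms by (simp add: ln_div)
  then have "exp (Psi n - Psi m - 1) \<le> exp (ln (real n / real m))" by (rule exp_mono)
  also have "\<dots> = real n / real m" using assms by simp
  finally show ?thesis by (simp add: prod_1_plus_inverse[OF assms])
qed

section \<open>The indegrees of the network\<close>

definition possible_edges :: "nat \<Rightarrow> network" where
  "possible_edges n = {(k, m). 1 \<le> m \<and> m < k \<and> k \<le> n}"

definition restrict_network :: "nat \<Rightarrow> network \<Rightarrow> network" where
  "restrict_network n g = {(k, m) \<in> g. k \<le> n}"

lemma finite_possible_edges: "finite (possible_edges n)"
  by (rule finite_subset[of _ "{1..n} \<times> {1..n}"]) (auto simp: possible_edges_def)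

locale network = rule +
  fixes M :: "'w measure" and G :: "nat \<Rightarrow> 'w \<Rightarrow> network"
  assumes process: "network_process M f G"
begin

sublocale prob_space M
  using process by (simp add: network_process_def)

abbreviation D :: "nat \<Rightarrow> nat \<Rightarrow> 'w \<Rightarrow> nat" where
  "D m n \<omega> \<equiv> indegree (G n \<omega>) m"

lemma G_measurable: "1 \<le> n \<Longrightarrow> G n \<in> measurable M (count_space UNIV)"
  using process by (simp add: network_process_def)

lemma G_1: "\<omega> \<in> space M \<Longrightarrow> G (Suc 0) \<omega> = {}"
  using process by (simp add: network_process_def)

lemma G_Suc:
  assumes "1 \<le> n" "\<omega> \<in> space M"
  obtains A where "A \<subseteq> {1..n}" "G (Suc n) \<omega> = G n \<omega> \<union> {Suc n} \<times> A"
proof -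
  have "\<forall>n\<ge>1. \<forall>\<omega>\<in>space M. \<exists>A\<subseteq>{1..n}. G (n + 1) \<omega> = G n \<omega> \<union> {n + 1} \<times> A"
    using process unfolding network_process_def by (elim conjE)
  then obtain A where "A \<subseteq> {1..n}" "G (n + 1) \<omega> = G n \<omega> \<union> {n + 1} \<times> A"
    using assms by meson
  then show ?thesis using that by simp
qed

lemma G_subset: "1 \<le> n \<Longrightarrow> \<omega> \<in> space M \<Longrightarrow> G n \<omega> \<subseteq> possible_edges n"
proof (induction n rule: dec_induct)
  case (step n)
  then obtain A where "A \<subseteq> {1..n}" "G (Suc n) \<omega> = G n \<omega> \<union> {Suc n} \<times> A" using G_Suc by metis
  then show ?case using step by (fastforce simp: possible_edges_def)
qed (simp add: G_1)

lemma finite_in_edges: "1 \<le> n \<Longrightarrow> \<omega> \<in> space M \<Longrightarrow> finite {k. (k, m) \<in> G n \<omega>}"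
  by (rule finite_subset[of _ "{..n}"]) (use G_subset[of n \<omega>] in \<open>auto simp: possible_edges_def\<close>)

lemma D_Suc:
  assumes "1 \<le> n" "\<omega> \<in> space M"
  shows "D m (Suc n) \<omega> = D m n \<omega> + (if (Suc n, m) \<in> G (Suc n) \<omega> then 1 else 0)"
proof -
  obtain A where A: "A \<subseteq> {1..n}" "G (Suc n) \<omega> = G n \<omega> \<union> {Suc n} \<times> A" using G_Suc[OF assms] by metis
  have no: "(Suc n, m) \<notin> G n \<omega>" using G_subset[OF assms] by (auto simp: possible_edges_def)
  have "{k. (k, m) \<in> G (Suc n) \<omega>} =
      (if (Suc n, m) \<in> G (Suc n) \<omega> then insert (Suc n) {k. (k, m) \<in> G n \<omega>} else {k. (k, m) \<in> G n \<omega>})"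
    using A no by auto
  then show ?thesis using no finite_in_edges[OF assms, of m] by (simp add: indegree_def)
qed

lemma D_mono:
  assumes "1 \<le> n" "n \<le> n'" "\<omega> \<in> space M"
  shows "D m n \<omega> \<le> D m n' \<omega>"
  using assms(2)
proof (induction rule: dec_induct)
  case (step k)
  then show ?case using D_Suc[of k \<omega> m] assms by auto
qed simp

lemma D_diag: "1 \<le> n \<Longrightarrow> n \<le> m \<Longrightarrow> \<omega> \<in> space M \<Longrightarrow> D m n \<omega> = 0"
proof -
  assume "1 \<le> n" "n \<le> m" "\<omega> \<in> space M"
  then have "{k. (k, m) \<in> G n \<omega>} = {}" using G_subset[of n \<omega>] by (auto simp: possible_edges_def)
  then show ?thesis by (simp add: indegree_def)
qed

lemma G_restrict:
  assumes "1 \<le> n" "n \<le> N" "\<omega> \<in> space M"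
  shows "G n \<omega> = restrict_network n (G N \<omega>)"
  using assms(2)
proof (induction rule: dec_induct)
  case base
  then show ?case using G_subset[OF assms(1,3)] by (auto simp: possible_edges_def restrict_network_def)
next
  case (step k)
  then obtain A where "A \<subseteq> {1..k}" "G (Suc k) \<omega> = G k \<omega> \<union> {Suc k} \<times> A"
    using G_Suc[of k \<omega>] assms by (metis le_trans)
  then show ?case using step by (auto simp: restrict_network_def)
qed

lemma sets_G: "1 \<le> n \<Longrightarrow> {\<omega> \<in> space M. Q (G n \<omega>)} \<in> events"
  using measurable_sets[OF G_measurable, of n "{g. Q g}"] by (simp add: vimage_def Int_def conj_commute)

lemma borel_G: "1 \<le> n \<Longrightarrow> (\<lambda>\<omega>. (h :: network \<Rightarrow> real) (G n \<omega>)) \<in> borel_measurable M"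
  by (rule measurable_compose[OF G_measurable]) auto

lemma integrable_G:
  assumes "1 \<le> n"
  shows "integrable M (\<lambda>\<omega>. (h :: network \<Rightarrow> real) (G n \<omega>))"
proof (rule integrable_const_bound)
  show "AE \<omega> in M. norm (h (G n \<omega>)) \<le> Max ((\<lambda>g. \<bar>h g\<bar>) ` Pow (possible_edges n))"
    using G_subset[OF assms] finite_possible_edges[of n] by (intro AE_I2) (auto intro!: Max_ge)
qed (rule borel_G[OF assms])

lemma prob_G: "1 \<le> n \<Longrightarrow> prob {\<omega> \<in> space M. Q (G n \<omega>)} = expectation (\<lambda>\<omega>. if Q (G n \<omega>) then 1 else 0)"
proof -
  assume n: "1 \<le> n"
  have "prob {\<omega> \<in> space M. Q (G n \<omega>)} = expectation (indicator {\<omega> \<in> space M. Q (G n \<omega>)})"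
    using sets_G[OF n] by simp
  also have "\<dots> = expectation (\<lambda>\<omega>. if Q (G n \<omega>) then 1 else 0)"
    by (intro Bochner_Integration.integral_cong) (auto simp: indicator_def)
  finally show ?thesis .
qed

text \<open>Given the network at time \<open>n\<close>, the new edges are independent with the prescribed
  probabilities; multiplying with the probability of the condition extends this to conditions of
  probability \<open>0\<close>.\<close>

lemma prob_new_edges:
  assumes n: "1 \<le> n" and J: "J \<subseteq> {1..n}"
  shows "prob {\<omega> \<in> space M. G n \<omega> = g \<and> (\<forall>m\<in>J. (Suc n, m) \<in> G (Suc n) \<omega>)}
    = prob {\<omega> \<in> space M. G n \<omega> = g} * (\<Prod>m\<in>J. f (indegree g m) / real n)"
proof -
  let ?B = "{\<omega> \<in> space M. G n \<omega> = g}" and ?A = "{\<omega> \<in> space M. G n \<omega> = g \<and> (\<forall>m\<in>J. (Suc n, m) \<in> G (Suc n) \<omega>)}"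
  let ?E = "\<lambda>m. {\<omega> \<in> space M. (Suc n, m) \<in> G (Suc n) \<omega>}" and ?C = "uniform_measure M ?B"
  have B: "?B \<in> events" using sets_G[OF n] .
  show ?thesis
  proof (cases "prob ?B = 0")
    case True
    have "prob ?A \<le> prob ?B" by (intro finite_measure_mono B) auto
    then show ?thesis using True by (simp add: measure_le_0_iff)
  next
    case False
    then have pos: "0 < prob ?B" by (simp add: zero_less_measure_iff)
    then have indep: "prob_space.indep_events ?C ?E {1..n}"
      and E: "\<And>m. m \<in> {1..n} \<Longrightarrow> measure ?C (?E m) = f (indegree g m) / real n"
      using process n unfolding network_process_def by (auto simp: Let_def)
    have PC: "prob_space ?C"
      using pos by (intro prob_space_uniform_measure) (auto simp: emeasure_eq_measure)
    have Eev: "?E m \<in> events" for m using sets_G[of "Suc n" "\<lambda>g. (Suc n, m) \<in> g"] by simp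
    show ?thesis
    proof (cases "J = {}")
      case False
      have "measure ?C (\<Inter>m\<in>J. ?E m) = (\<Prod>m\<in>J. measure ?C (?E m))"
        using indep False J finite_subset[OF J] unfolding prob_space.indep_events_def[OF PC] by auto
      also have "\<dots> = (\<Prod>m\<in>J. f (indegree g m) / real n)" using E J by (intro prod.cong) auto
      also have "measure ?C (\<Inter>m\<in>J. ?E m) = measure M (?B \<inter> (\<Inter>m\<in>J. ?E m)) / measure M ?B"
        using False finite_subset[OF J] Eev pos B
        by (intro measure_uniform_measure) (auto simp: emeasure_eq_measure)
      also have "?B \<inter> (\<Inter>m\<in>J. ?E m) = ?A" using False by auto
      finally show ?thesis using pos by (simp add: field_simps)
    qed simp
  qed
qed

text \<open>The transition operator of the indegree of a fixed vertex, which jumps from \<open>k\<close> to \<open>k + 1\<close> with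
  probability \<open>f k / n\<close>.\<close>

definition transition :: "nat \<Rightarrow> (nat \<Rightarrow> real) \<Rightarrow> nat \<Rightarrow> real" where
  "transition n \<phi> k = \<phi> k + f k / real n * (\<phi> (Suc k) - \<phi> k)"

text \<open>Given the network \<open>g\<close> at time \<open>n\<close>, every factor is an affine function of the indicator of one new
  edge. Expanding the product into a sum over sets of edges reduces the claim to the joint
  probabilities of new edges, and the same expansion read backwards collects the result.\<close>

lemma one_step:
  assumes n: "1 \<le> n"
  shows "expectation (\<lambda>\<omega>. h (G n \<omega>) * (\<Prod>m=1..n. \<psi> m (D m (Suc n) \<omega>)))
    = expectation (\<lambda>\<omega>. h (G n \<omega>) * (\<Prod>m=1..n. transition n (\<psi> m) (D m n \<omega>)))"
proof -
  let ?B = "\<lambda>g. {\<omega> \<in> space M. G n \<omega> = g}"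
  let ?P = "Pow (possible_edges n)"
  let ?X = "\<lambda>\<omega>. \<Prod>m=1..n. \<psi> m (D m (Suc n) \<omega>)"
  define \<Delta> where "\<Delta> g m = \<psi> m (Suc (indegree g m)) - \<psi> m (indegree g m)" for g m
  define a where "a g m = \<psi> m (indegree g m)" for g m
  define p where "p g m = f (indegree g m) / real n" for g m
  let ?A = "\<lambda>g J. {\<omega> \<in> space M. G n \<omega> = g \<and> (\<forall>m\<in>J. (Suc n, m) \<in> G (Suc n) \<omega>)}"
  have fin: "finite ?P" using finite_possible_edges by simp
  have A: "?A g J \<in> events" for g J
  proof -
    have "?A g J = {\<omega> \<in> space M. restrict_network n (G (Suc n) \<omega>) = g \<and> (\<forall>m\<in>J. (Suc n, m) \<in> G (Suc n) \<omega>)}"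
      using G_restrict[OF n, of "Suc n"] by auto
    also have "\<dots> \<in> events" by (rule sets_G) simp
    finally show ?thesis .
  qed
  have int: "integrable M (indicator (?A g J) :: _ \<Rightarrow> real)" for g J
    using A by (simp add: integrable_indicator_iff emeasure_eq_measure)
  have expand: "h (G n \<omega>) * ?X \<omega> =
      (\<Sum>g\<in>?P. h g * (\<Sum>J\<in>Pow {1..n}. (\<Prod>m\<in>J. \<Delta> g m) * (\<Prod>m\<in>{1..n}-J. a g m) * indicator (?A g J) \<omega>))"
    if \<omega>: "\<omega> \<in> space M" for \<omega>
  proof -
    let ?g = "G n \<omega>"
    have g: "?g \<in> ?P" using G_subset[OF n \<omega>] by simp
    have "?X \<omega> = (\<Prod>m=1..n. \<Delta> ?g m * (if (Suc n, m) \<in> G (Suc n) \<omega> then 1 else 0) + a ?g m)"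
      by (intro prod.cong) (auto simp: D_Suc[OF n \<omega>] \<Delta>_def a_def)
    also have "\<dots> = (\<Sum>J\<in>Pow {1..n}. (\<Prod>m\<in>J. \<Delta> ?g m * (if (Suc n, m) \<in> G (Suc n) \<omega> then 1 else 0)) * (\<Prod>m\<in>{1..n}-J. a ?g m))"
      by (rule prod_add) simp
    also have "\<dots> = (\<Sum>J\<in>Pow {1..n}. (\<Prod>m\<in>J. \<Delta> ?g m) * (\<Prod>m\<in>{1..n}-J. a ?g m) * indicator (?A ?g J) \<omega>)"
    proof (rule sum.cong[OF refl])
      fix J assume "J \<in> Pow {1..n}"
      then have "finite J" using finite_subset by auto
      then have "(\<Prod>m\<in>J. if (Suc n, m) \<in> G (Suc n) \<omega> then 1 else 0 :: real) = indicator (?A ?g J) \<omega>"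
        using \<omega> by (auto simp: indicator_def prod_zero_iff)
      then show "(\<Prod>m\<in>J. \<Delta> ?g m * (if (Suc n, m) \<in> G (Suc n) \<omega> then 1 else 0)) * (\<Prod>m\<in>{1..n}-J. a ?g m)
          = (\<Prod>m\<in>J. \<Delta> ?g m) * (\<Prod>m\<in>{1..n}-J. a ?g m) * indicator (?A ?g J) \<omega>"
        by (simp only: prod.distrib) simp
    qed
    finally have "h ?g * ?X \<omega> = h ?g * (\<Sum>J\<in>Pow {1..n}. (\<Prod>m\<in>J. \<Delta> ?g m) * (\<Prod>m\<in>{1..n}-J. a ?g m) * indicator (?A ?g J) \<omega>)"
      by simp
    also have "\<dots> = (\<Sum>g\<in>?P. if g = ?g then h g * (\<Sum>J\<in>Pow {1..n}. (\<Prod>m\<in>J. \<Delta> g m) * (\<Prod>m\<in>{1..n}-J. a g m) * indicator (?A g J) \<omega>) else 0)"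
      using fin g by simp
    also have "\<dots> = (\<Sum>g\<in>?P. h g * (\<Sum>J\<in>Pow {1..n}. (\<Prod>m\<in>J. \<Delta> g m) * (\<Prod>m\<in>{1..n}-J. a g m) * indicator (?A g J) \<omega>))"
      by (intro sum.cong) (auto intro!: sum.neutral)
    finally show ?thesis .
  qed
  have "expectation (\<lambda>\<omega>. h (G n \<omega>) * ?X \<omega>) = expectation (\<lambda>\<omega>.
      \<Sum>g\<in>?P. h g * (\<Sum>J\<in>Pow {1..n}. (\<Prod>m\<in>J. \<Delta> g m) * (\<Prod>m\<in>{1..n}-J. a g m) * indicator (?A g J) \<omega>))"
    by (intro Bochner_Integration.integral_cong expand) auto
  also have "\<dots> = (\<Sum>g\<in>?P. h g * (\<Sum>J\<in>Pow {1..n}. (\<Prod>m\<in>J. \<Delta> g m) * (\<Prod>m\<in>{1..n}-J. a g m) * prob (?A g J)))"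
  proof -
    define S where "S g J = ?A g J" for g J
    have "integrable M (indicator (S g J) :: _ \<Rightarrow> real)" "S g J \<in> events" for g J
      using int A by (auto simp: S_def)
    then show ?thesis unfolding S_def[symmetric]
      by (simp add: Bochner_Integration.integral_sum del: sum_mult_indicator)
  qed
  also have "\<dots> = (\<Sum>g\<in>?P. h g * (prob (?B g) * (\<Prod>m=1..n. transition n (\<psi> m) (indegree g m))))"
  proof (intro sum.cong refl arg_cong2[of _ _ _ _ "(*)"])
    fix g
    have "(\<Sum>J\<in>Pow {1..n}. (\<Prod>m\<in>J. \<Delta> g m) * (\<Prod>m\<in>{1..n}-J. a g m) * prob (?A g J))
      = (\<Sum>J\<in>Pow {1..n}. prob (?B g) * ((\<Prod>m\<in>J. \<Delta> g m * p g m) * (\<Prod>m\<in>{1..n}-J. a g m)))"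
    proof (intro sum.cong refl)
      fix J assume J: "J \<in> Pow {1..n}"
      then have "prob (?A g J) = prob (?B g) * (\<Prod>m\<in>J. p g m)"
        using prob_new_edges[OF n, of J g] by (simp add: p_def)
      then show "(\<Prod>m\<in>J. \<Delta> g m) * (\<Prod>m\<in>{1..n}-J. a g m) * prob (?A g J)
          = prob (?B g) * ((\<Prod>m\<in>J. \<Delta> g m * p g m) * (\<Prod>m\<in>{1..n}-J. a g m))"
        by (simp only: prod.distrib) simp
    qed
    also have "\<dots> = prob (?B g) * (\<Prod>m=1..n. \<Delta> g m * p g m + a g m)"
      unfolding sum_distrib_left[symmetric] by (subst prod_add) auto
    also have "(\<Prod>m=1..n. \<Delta> g m * p g m + a g m) = (\<Prod>m=1..n. transition n (\<psi> m) (indegree g m))"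
      by (simp add: transition_def \<Delta>_def p_def a_def algebra_simps)
    finally show "(\<Sum>J\<in>Pow {1..n}. (\<Prod>m\<in>J. \<Delta> g m) * (\<Prod>m\<in>{1..n}-J. a g m) * prob (?A g J))
      = prob (?B g) * (\<Prod>m=1..n. transition n (\<psi> m) (indegree g m))" .
  qed
  also have "\<dots> = expectation (\<lambda>\<omega>. \<Sum>g\<in>?P. h g * ((\<Prod>m=1..n. transition n (\<psi> m) (indegree g m)) * indicator (?B g) \<omega>))"
  proof -
    have "integrable M (indicator (?B g) :: _ \<Rightarrow> real)" for g
      using sets_G[OF n] by (simp add: integrable_indicator_iff emeasure_eq_measure)
    then show ?thesis using sets_G[OF n] by (simp add: Bochner_Integration.integral_sum mult.commute)
  qed
  also have "\<dots> = expectation (\<lambda>\<omega>. h (G n \<omega>) * (\<Prod>m=1..n. transition n (\<psi> m) (D m n \<omega>)))"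
  proof (intro Bochner_Integration.integral_cong refl)
    fix \<omega> assume \<omega>: "\<omega> \<in> space M"
    have "(\<Sum>g\<in>?P. h g * ((\<Prod>m=1..n. transition n (\<psi> m) (indegree g m)) * indicator (?B g) \<omega>))
      = (\<Sum>g\<in>?P. if g = G n \<omega> then h g * (\<Prod>m=1..n. transition n (\<psi> m) (indegree g m)) else 0)"
      using \<omega> by (intro sum.cong) auto
    then show "(\<Sum>g\<in>?P. h g * ((\<Prod>m=1..n. transition n (\<psi> m) (indegree g m)) * indicator (?B g) \<omega>))
      = h (G n \<omega>) * (\<Prod>m=1..n. transition n (\<psi> m) (D m n \<omega>))"
      using fin G_subset[OF n \<omega>] by simp
  qed
  finally show ?thesis .
qed

lemma one_step_single:
  assumes n: "1 \<le> n" and m: "m \<in> {1..n}"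
  shows "expectation (\<lambda>\<omega>. h (G n \<omega>) * \<phi> (D m (Suc n) \<omega>))
    = expectation (\<lambda>\<omega>. h (G n \<omega>) * transition n \<phi> (D m n \<omega>))"
proof -
  let ?\<psi> = "\<lambda>i. if i = m then \<phi> else (\<lambda>_. 1)"
  have "(\<Prod>i=1..n. ?\<psi> i (x i)) = \<phi> (x m)" for x
    using m by (subst prod.remove[of _ m]) auto
  moreover have "(\<Prod>i=1..n. transition n (?\<psi> i) (x i)) = transition n \<phi> (x m)" for x
    using m by (subst prod.remove[of _ m]) (auto simp: transition_def)
  ultimately show ?thesis using one_step[OF n, of h ?\<psi>] by simp
qed

text \<open>A step of the evolution acts on each factor separately, so products remain products; the
  independence of the indegrees follows by going back to the initial network.\<close>

lemma indegrees_independent: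
  fixes \<phi> :: "nat \<Rightarrow> nat \<Rightarrow> real"
  assumes "1 \<le> n"
  shows "expectation (\<lambda>\<omega>. \<Prod>m=1..n. \<phi> m (D m n \<omega>)) = (\<Prod>m=1..n. expectation (\<lambda>\<omega>. \<phi> m (D m n \<omega>)))"
  using assms
proof (induction n arbitrary: \<phi> rule: dec_induct)
  case base
  have "expectation (\<lambda>\<omega>. \<phi> 1 (D 1 1 \<omega>)) = expectation (\<lambda>\<omega>. \<phi> 1 0)"
    by (intro Bochner_Integration.integral_cong) (auto simp: D_diag)
  then show ?case by (simp add: prob_space)
next
  case (step n)
  have new: "\<phi> (Suc n) (D (Suc n) (Suc n) \<omega>) = \<phi> (Suc n) 0" if "\<omega> \<in> space M" for \<omega>
    using D_diag[of "Suc n" "Suc n" \<omega>] that by simp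
  have "expectation (\<lambda>\<omega>. \<Prod>m=1..Suc n. \<phi> m (D m (Suc n) \<omega>))
      = expectation (\<lambda>\<omega>. \<phi> (Suc n) 0 * (\<Prod>m=1..n. \<phi> m (D m (Suc n) \<omega>)))"
    by (intro Bochner_Integration.integral_cong) (auto simp: prod.cl_ivl_Suc new mult.commute)
  also have "\<dots> = expectation (\<lambda>\<omega>. \<phi> (Suc n) 0 * (\<Prod>m=1..n. transition n (\<phi> m) (D m n \<omega>)))"
    using step by (intro one_step)
  also have "\<dots> = \<phi> (Suc n) 0 * (\<Prod>m=1..n. expectation (\<lambda>\<omega>. transition n (\<phi> m) (D m n \<omega>)))"
    using step.IH[of "\<lambda>m. transition n (\<phi> m)"] by simp
  also have "(\<Prod>m=1..n. expectation (\<lambda>\<omega>. transition n (\<phi> m) (D m n \<omega>)))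
      = (\<Prod>m=1..n. expectation (\<lambda>\<omega>. \<phi> m (D m (Suc n) \<omega>)))"
    using one_step_single[of n _ "\<lambda>_. 1"] step by (intro prod.cong) auto
  also have "\<phi> (Suc n) 0 = expectation (\<lambda>\<omega>. \<phi> (Suc n) (D (Suc n) (Suc n) \<omega>))"
    using Bochner_Integration.integral_cong[OF refl new, of M] by (simp add: prob_space)
  finally show ?case by (simp add: prod.cl_ivl_Suc mult.commute)
qed

text \<open>The weight \<open>tilt \<theta>\<close> is chosen such that it is an eigenfunction of all transition
  operators, with eigenvalues that do not depend on the state; hence its moments are explicit.\<close>

lemma transition_tilt: "transition n (tilt \<theta>) k = (1 + \<theta> / real n) * tilt \<theta> k"
  using f_pos[of k] by (simp add: transition_def tilt_Suc field_simps)

lemma expectation_tilt: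
  assumes "1 \<le> m" "m \<le> n\<^sub>0" "n\<^sub>0 \<le> n"
  shows "expectation (\<lambda>\<omega>. h (G n\<^sub>0 \<omega>) * tilt \<theta> (D m n \<omega>))
    = (\<Prod>i=n\<^sub>0..<n. 1 + \<theta> / real i) * expectation (\<lambda>\<omega>. h (G n\<^sub>0 \<omega>) * tilt \<theta> (D m n\<^sub>0 \<omega>))"
  using assms(3)
proof (induction rule: dec_induct)
  case (step n)
  have n: "1 \<le> n" "m \<in> {1..n}" and n0: "1 \<le> n\<^sub>0" using step assms by auto
  have "expectation (\<lambda>\<omega>. h (G n\<^sub>0 \<omega>) * tilt \<theta> (D m (Suc n) \<omega>))
      = expectation (\<lambda>\<omega>. h (restrict_network n\<^sub>0 (G n \<omega>)) * tilt \<theta> (D m (Suc n) \<omega>))"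
    using G_restrict[OF n0, of n] step by (intro Bochner_Integration.integral_cong) auto
  also have "\<dots> = expectation (\<lambda>\<omega>. h (restrict_network n\<^sub>0 (G n \<omega>)) * transition n (tilt \<theta>) (D m n \<omega>))"
    by (rule one_step_single[OF n, of "\<lambda>g. h (restrict_network n\<^sub>0 g)"])
  also have "\<dots> = expectation (\<lambda>\<omega>. (1 + \<theta> / real n) * (h (G n\<^sub>0 \<omega>) * tilt \<theta> (D m n \<omega>)))"
    using G_restrict[OF n0, of n] step by (intro Bochner_Integration.integral_cong) (auto simp: transition_tilt)
  also have "\<dots> = (1 + \<theta> / real n) * expectation (\<lambda>\<omega>. h (G n\<^sub>0 \<omega>) * tilt \<theta> (D m n \<omega>))"
    by simp
  finally show ?case using step by (simp add: prod.op_ivl_Suc)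
qed simp

lemma expectation_tilt_born:
  assumes "1 \<le> m" "m \<le> n"
  shows "expectation (\<lambda>\<omega>. tilt \<theta> (D m n \<omega>)) = (\<Prod>i=m..<n. 1 + \<theta> / real i)"
proof -
  have "expectation (\<lambda>\<omega>. tilt \<theta> (D m m \<omega>)) = expectation (\<lambda>\<omega>. 1)"
    using assms by (intro Bochner_Integration.integral_cong) (auto simp: D_diag)
  then show ?thesis using expectation_tilt[of m m n "\<lambda>_. 1" \<theta>] assms by (simp add: prob_space)
qed

end

section \<open>Probability estimates\<close>

context rule
begin

text \<open>Between consecutive values of \<open>Phi f\<close> on the integers there is a gap of at most \<open>1 / f 0\<close>.\<close>

lemma least_level:
  assumes "0 \<le> z"
  obtains k where "z \<le> Phi f (real k)" "Phi f (real k) \<le> z + 1 / f 0" "\<And>d. z \<le> Phi f (real d) \<Longrightarrow> k \<le> d"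
proof -
  define x where "x = Phi_inv f z"
  define k where "k = nat \<lceil>x\<rceil>"
  have x: "0 \<le> x" "Phi f x = z" using assms by (auto simp: x_def Phi_inv_nonneg)
  have k: "x \<le> real k" "real k \<le> x + 1" using x by (auto simp: k_def)
  have "Phi f (real k) - Phi f x \<le> (real k - x) / step_ext f x" using x k by (intro Phi_diff_le)
  also have "\<dots> \<le> 1 / f 0" using k f_pos[of 0] step_ext_ge_0[of x] by (intro frac_le) auto
  finally have 2: "Phi f (real k) \<le> z + 1 / f 0" using x by simp
  have 3: "k \<le> d" if "z \<le> Phi f (real d)" for d
  proof -
    have "x \<le> real d" using that x Phi_le_iff[of x "real d"] by simp
    then show ?thesis by (simp add: k_def ceiling_le_iff nat_le_iff)
  qed
  have "z \<le> Phi f (real k)" using Phi_le_iff[of x "real k"] x k by simp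
  then show ?thesis using 2 3 by (rule that)
qed

lemma greatest_level:
  assumes "0 \<le> z"
  obtains k where "Phi f (real k) \<le> z" "z \<le> Phi f (real k) + 1 / f 0" "\<And>d. Phi f (real d) \<le> z \<Longrightarrow> d \<le> k"
proof -
  define x where "x = Phi_inv f z"
  define k where "k = nat \<lfloor>x\<rfloor>"
  have x: "0 \<le> x" "Phi f x = z" using assms by (auto simp: x_def Phi_inv_nonneg)
  have k: "real k \<le> x" "x \<le> real k + 1" using x by (auto simp: k_def)
  have "Phi f x - Phi f (real k) \<le> (x - real k) / step_ext f (real k)" using x k by (intro Phi_diff_le) auto
  also have "\<dots> \<le> 1 / f 0" using k f_pos[of 0] step_ext_ge_0[of "real k"] by (intro frac_le) auto
  finally have 2: "z \<le> Phi f (real k) + 1 / f 0" using x by simp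
  have 3: "d \<le> k" if "Phi f (real d) \<le> z" for d
  proof -
    have "real d \<le> x" using that x Phi_le_iff[of "real d" x] by simp
    then show ?thesis by (simp add: k_def le_nat_iff le_floor_iff)
  qed
  have "Phi f (real k) \<le> z" using Phi_le_iff[of "real k" x] x k by simp
  then show ?thesis using 2 3 by (rule that)
qed

end

context rv_rule
begin

text \<open>This collects what \<open>t\<close> being large is used for: constants up to \<open>B\<close>, variances over times of order
  \<open>Avar f t\<close> and third order corrections are all at most \<open>\<gamma> * Avar f t\<close>.\<close>

definition regime :: "real \<Rightarrow> real \<Rightarrow> real \<Rightarrow> bool" where
  "regime B \<gamma> t \<longleftrightarrow> 1 \<le> t \<and> B \<le> \<gamma> * Avar f t \<and> Avar f t \<le> \<gamma> * t \<and>
    Avar f (B * Avar f t + B) \<le> \<gamma> * Avar f t \<and>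
    (\<forall>k. Phi f (real k) \<le> 4 * t \<longrightarrow> cubes k \<le> \<gamma> * Avar f t)"

lemma eventually_le_Avar: "0 < \<gamma> \<Longrightarrow> \<forall>\<^sub>F t in at_top. C \<le> \<gamma> * Avar f t"
proof -
  assume \<gamma>: "0 < \<gamma>"
  have "\<forall>\<^sub>F t in at_top. C / \<gamma> \<le> Avar f t" using Avar_at_top by (auto simp: filterlim_at_top)
  then show ?thesis by eventually_elim (use \<gamma> in \<open>simp add: field_simps\<close>)
qed

lemma eventually_regime:
  assumes "0 \<le> B" "0 < \<gamma>"
  shows "\<forall>\<^sub>F t in at_top. regime B \<gamma> t"
proof -
  obtain C where C: "\<And>k. cubes k \<le> \<gamma> / 8 * Avar f (Phi f (real k)) + C"
    using cube_sum_le[of "\<gamma> / 8"] assms unfolding cubes_def by auto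
  have "\<forall>\<^sub>F t in at_top. C \<le> \<gamma> / 2 * Avar f t" using assms by (intro eventually_le_Avar) auto
  moreover have "\<forall>\<^sub>F t in at_top. B \<le> \<gamma> * Avar f t" using assms by (intro eventually_le_Avar)
  moreover have "\<forall>\<^sub>F t in at_top. Avar f t \<le> \<gamma> * t" using assms by (intro Avar_le_eps)
  moreover have "\<forall>\<^sub>F t in at_top. Avar f (B * Avar f t + B) \<le> \<gamma> * Avar f t"
    using assms by (intro Avar_Avar_le)
  moreover have "\<forall>\<^sub>F t in at_top. (1::real) \<le> t" by (rule eventually_ge_at_top)
  ultimately show ?thesis
  proof eventually_elim
    case (elim t)
    have "cubes k \<le> \<gamma> * Avar f t" if "Phi f (real k) \<le> 4 * t" for k
    proof -
      have "Avar f (Phi f (real k)) \<le> Avar f (4 * t)"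
        using that by (intro Avar_mono Phi_nonneg) auto
      also have "\<dots> \<le> 4 * Avar f t" using Avar_nat_mult[of t 4] elim by simp
      finally have "\<gamma> / 8 * Avar f (Phi f (real k)) \<le> \<gamma> / 8 * (4 * Avar f t)"
        using assms by (intro mult_left_mono) auto
      then show ?thesis using C[of k] elim by simp
    qed
    then show ?case using elim by (simp add: regime_def)
  qed
qed

lemma regimeD:
  assumes "regime B \<gamma> t"
  shows "1 \<le> t" "B \<le> \<gamma> * Avar f t" "Avar f t \<le> \<gamma> * t" "0 < Avar f t"
    and "\<And>k. Phi f (real k) \<le> 4 * t \<Longrightarrow> cubes k \<le> \<gamma> * Avar f t"
    and "0 \<le> x \<Longrightarrow> x \<le> B * Avar f t + B \<Longrightarrow> Avar f x \<le> \<gamma> * Avar f t"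
  using assms Avar_pos[of t] Avar_mono[of x "B * Avar f t + B"] unfolding regime_def by auto

end

locale rv_network = rv_rule f \<alpha> + network f M G for f \<alpha> and M :: "'w measure" and G
begin

abbreviation level :: "nat \<Rightarrow> nat \<Rightarrow> 'w \<Rightarrow> real" where
  "level m n \<omega> \<equiv> Phi f (real (D m n \<omega>))"

lemma level_mono: "1 \<le> n \<Longrightarrow> n \<le> n' \<Longrightarrow> \<omega> \<in> space M \<Longrightarrow> level m n \<omega> \<le> level m n' \<omega>"
  using D_mono Phi_le_iff by simp

text \<open>Weighted masses of events that depend on the indegree only are estimated by changing the
  parameter from \<open>1\<close> to \<open>\<theta>\<close>, at the price of the largest ratio of the weights on the event.\<close>

lemma expectation_tilt_restrict:
  assumes m: "1 \<le> m" "m \<le> n" and \<theta>: "0 \<le> \<theta>" and c: "0 \<le> c"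
    and Q: "\<And>d. Q d \<Longrightarrow> tilt 1 d / tilt \<theta> d \<le> c"
  shows "expectation (\<lambda>\<omega>. (if Q (D m n \<omega>) then 1 else 0) * tilt 1 (D m n \<omega>)) \<le> c * exp (\<theta> * (Psi n - Psi m))"
proof -
  have n: "1 \<le> n" using m by simp
  have p: "0 < tilt \<theta> d" for d using \<theta> f_pos[of 0] by (intro tilt_pos) auto
  have "expectation (\<lambda>\<omega>. (if Q (D m n \<omega>) then 1 else 0) * tilt 1 (D m n \<omega>)) \<le> expectation (\<lambda>\<omega>. c * tilt \<theta> (D m n \<omega>))"
  proof (rule integral_mono)
    show "integrable M (\<lambda>\<omega>. (if Q (D m n \<omega>) then 1 else 0) * tilt 1 (D m n \<omega>))"
      using integrable_G[OF n, of "\<lambda>g. (if Q (indegree g m) then 1 else 0) * tilt 1 (indegree g m)"] .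
    show "integrable M (\<lambda>\<omega>. c * tilt \<theta> (D m n \<omega>))"
      using integrable_G[OF n, of "\<lambda>g. c * tilt \<theta> (indegree g m)"] .
    show "(if Q (D m n \<omega>) then 1 else 0) * tilt 1 (D m n \<omega>) \<le> c * tilt \<theta> (D m n \<omega>)" for \<omega>
      using Q[of "D m n \<omega>"] p[of "D m n \<omega>"] c by (auto simp: field_simps)
  qed
  also have "\<dots> = c * (\<Prod>i=m..<n. 1 + \<theta> / real i)" using expectation_tilt_born[OF m] by simp
  also have "\<dots> \<le> c * exp (\<theta> * (Psi n - Psi m))"
    using prod_le_exp_Psi[OF m, of \<theta>] \<theta> c by (intro mult_left_mono) auto
  finally show ?thesis .
qed

text \<open>Weighting with \<open>tilt 1\<close> turns the degree evolution of a vertex into one that at age \<open>r\<close>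
  concentrates around level \<open>r + Avar f r\<close>. Outside of a window around this value, the weighted
  mass is bounded by changing the tilting parameter slightly, to \<open>1 + \<epsilon>\<close> or \<open>1 - \<epsilon>\<close>.\<close>

definition far :: "real \<Rightarrow> real \<Rightarrow> nat \<Rightarrow> nat \<Rightarrow> nat \<Rightarrow> bool" where
  "far \<epsilon> t m n d \<longleftrightarrow>
    \<epsilon> * Avar f t \<le> \<bar>Phi f (real d) - ((Psi n - Psi m) + Avar f (Psi n - Psi m))\<bar>"

lemma expectation_tilt_far:
  assumes R: "regime B \<gamma> t" and B: "2 + 1 / f 0 \<le> B" and \<gamma>: "0 < \<gamma>" "\<gamma> \<le> 1 / 4"
    and \<epsilon>: "0 < \<epsilon>" "\<epsilon> \<le> 1" and m: "1 \<le> m" "m \<le> n" and n: "Psi n \<le> t"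
  shows "expectation (\<lambda>\<omega>. (if far \<epsilon> t m n (D m n \<omega>) then 1 else 0) * tilt 1 (D m n \<omega>))
    \<le> 2 * exp (Psi n - Psi m - (\<epsilon>\<^sup>2 / 2 - 3 * \<gamma>) * Avar f t)"
proof -
  note rD = regimeD[OF R]
  define a where "a = Avar f t"
  define r where "r = Psi n - Psi m"
  define V where "V = Avar f r"
  have a0: "0 < a" using rD by (simp add: a_def)
  have r: "0 \<le> r" "r \<le> t" using m n Psi_le_iff[of m n] Psi_nonneg[of m] by (auto simp: r_def)
  have V: "0 \<le> V" "V \<le> a" using r by (auto simp: V_def a_def intro: Avar_nonneg Avar_mono)
  have "\<gamma> * t \<le> 1 / 4 * t" using rD(1) \<gamma> by (intro mult_right_mono) auto
  then have at: "a \<le> t / 4" using rD(3) unfolding a_def by linarith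
  have B2: "2 \<le> B" "1 / f 0 \<le> B" using B f_pos[of 0] by (auto intro: order_trans[OF _ B])
  have Bt: "B \<le> t / 4"
  proof -
    have "\<gamma> * a \<le> 1 * a" using \<gamma> a0 by (intro mult_right_mono) auto
    then show ?thesis using rD(2) at unfolding a_def by linarith
  qed
  have \<epsilon>a: "0 \<le> \<epsilon> * a" "\<epsilon> * a \<le> a" using \<epsilon> a0 by (auto simp: mult_left_le_one_le)
  have small: "Avar f x \<le> \<gamma> * a" if "0 \<le> x" "x \<le> 2 * a + B" for x
  proof -
    have "2 * a \<le> B * a" using B2 a0 by (intro mult_right_mono) auto
    then show ?thesis using rD(6)[of x] that by (simp add: a_def)
  qed
  have n1: "1 \<le> n" using m by simp
  define g where "g = \<gamma> * a"
  have bd_eq: "r - (\<epsilon>\<^sup>2 / 2 - 3 * \<gamma>) * a = r - \<epsilon>\<^sup>2 / 2 * a + 3 * g"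
    by (simp add: g_def algebra_simps)
  let ?U = "\<lambda>d. r + V + \<epsilon> * a \<le> Phi f (real d)"
  let ?L = "\<lambda>d. Phi f (real d) \<le> r + V - \<epsilon> * a"
  let ?bd = "exp (r - (\<epsilon>\<^sup>2 / 2 - 3 * \<gamma>) * a)"
  \<comment> \<open>Above the window: compare with the parameter \<open>1 + \<epsilon>\<close> at the threshold \<open>k\<close>.\<close>
  have upper: "expectation (\<lambda>\<omega>. (if ?U (D m n \<omega>) then 1 else 0) * tilt 1 (D m n \<omega>)) \<le> ?bd"
  proof -
    have z: "0 \<le> r + V + \<epsilon> * a" using r V \<epsilon>a by simp
    obtain k where k: "r + V + \<epsilon> * a \<le> Phi f (real k)" "Phi f (real k) \<le> r + V + \<epsilon> * a + 1 / f 0"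
      and k_least: "\<And>d. ?U d \<Longrightarrow> k \<le> d" using least_level[OF z] by blast
    define P where "P = Phi f (real k)"
    define W where "W = Avar f P"
    have W: "W \<le> V + \<gamma> * a"
    proof -
      have "W \<le> Avar f (r + (P - r))" by (simp add: W_def)
      also have "\<dots> \<le> V + Avar f (P - r)"
        unfolding V_def using r k V \<epsilon>a by (intro Avar_subadd) (auto simp: P_def)
      also have "Avar f (P - r) \<le> \<gamma> * a"
        using k V \<epsilon>a B2 by (intro small) (auto simp: P_def)
      finally show ?thesis by simp
    qed
    have cub: "cubes k \<le> \<gamma> * a"
      unfolding a_def using k r V at \<epsilon>a B2 Bt by (intro rD(5)) auto
    have "tilt 1 k / tilt (1 + \<epsilon>) k \<le> exp (P - W / 2 + cubes k) / exp ((1 + \<epsilon>) * P - (1 + \<epsilon>)\<^sup>2 / 2 * W)"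
      unfolding P_def W_def using tilt_1_le[of k] tilt_ge[of "1 + \<epsilon>" k] \<epsilon> tilt_pos[of 1 k] f_pos[of 0]
      by (intro frac_le) auto
    also have "\<dots> = exp (- \<epsilon> * P + (\<epsilon> + \<epsilon>\<^sup>2 / 2) * W + cubes k)"
      by (simp add: exp_diff[symmetric] power2_eq_square algebra_simps add_divide_distrib)
    finally have c: "tilt 1 k / tilt (1 + \<epsilon>) k \<le> exp (- \<epsilon> * P + (\<epsilon> + \<epsilon>\<^sup>2 / 2) * W + cubes k)" .
    have "expectation (\<lambda>\<omega>. (if ?U (D m n \<omega>) then 1 else 0) * tilt 1 (D m n \<omega>))
        \<le> exp (- \<epsilon> * P + (\<epsilon> + \<epsilon>\<^sup>2 / 2) * W + cubes k) * exp ((1 + \<epsilon>) * (Psi n - Psi m))"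
    proof (rule expectation_tilt_restrict[OF m])
      fix d assume "?U d"
      then show "tilt 1 d / tilt (1 + \<epsilon>) d \<le> exp (- \<epsilon> * P + (\<epsilon> + \<epsilon>\<^sup>2 / 2) * W + cubes k)"
        using tilt_ratio_mono[of 1 "1 + \<epsilon>" k d] \<epsilon> k_least c by fastforce
    qed (use \<epsilon> in auto)
    also have "\<dots> = exp (r + (\<epsilon> * (r - P) + (\<epsilon> + \<epsilon>\<^sup>2 / 2) * W + cubes k))"
      by (simp add: exp_add[symmetric] r_def algebra_simps)
    also have "\<dots> \<le> ?bd"
    proof (rule exp_mono)
      have "\<epsilon> * (r - P) \<le> \<epsilon> * (- V - \<epsilon> * a)" using \<epsilon> k by (intro mult_left_mono) (auto simp: P_def)
      moreover have "(\<epsilon> + \<epsilon>\<^sup>2 / 2) * W \<le> (\<epsilon> + \<epsilon>\<^sup>2 / 2) * (V + \<gamma> * a)" using \<epsilon> W by (intro mult_left_mono) auto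
      moreover have "\<epsilon>\<^sup>2 / 2 * V \<le> \<epsilon>\<^sup>2 / 2 * a" using V by (intro mult_left_mono) auto
      moreover have "(\<epsilon> + \<epsilon>\<^sup>2 / 2) * (\<gamma> * a) \<le> 2 * (\<gamma> * a)"
      proof (rule mult_right_mono)
        have "\<epsilon>\<^sup>2 \<le> 1" using \<epsilon> by (simp add: power_le_one)
        then show "\<epsilon> + \<epsilon>\<^sup>2 / 2 \<le> 2" using \<epsilon> by simp
      qed (use \<gamma> a0 in auto)
      ultimately have "\<epsilon> * (r - P) + (\<epsilon> + \<epsilon>\<^sup>2 / 2) * W + cubes k \<le> - (\<epsilon>\<^sup>2 / 2) * a + 3 * g"
        using cub unfolding g_def[symmetric]
        by (simp add: algebra_simps power2_eq_square add_divide_distrib diff_divide_distrib; linarith)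
      then show "r + (\<epsilon> * (r - P) + (\<epsilon> + \<epsilon>\<^sup>2 / 2) * W + cubes k) \<le> r - (\<epsilon>\<^sup>2 / 2 - 3 * \<gamma>) * a"
        unfolding bd_eq by linarith
    qed
    finally show ?thesis .
  qed
  \<comment> \<open>Below the window: compare with the parameter \<open>1 - \<epsilon>\<close>. If the threshold is negative, no
    indegree is below it.\<close>
  have lower: "expectation (\<lambda>\<omega>. (if ?L (D m n \<omega>) then 1 else 0) * tilt 1 (D m n \<omega>)) \<le> ?bd"
  proof (cases "0 \<le> r + V - \<epsilon> * a")
    case z: True
    obtain k where k: "Phi f (real k) \<le> r + V - \<epsilon> * a" "r + V - \<epsilon> * a \<le> Phi f (real k) + 1 / f 0"
      and k_greatest: "\<And>d. ?L d \<Longrightarrow> d \<le> k" using greatest_level[OF z] by blast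
    define P where "P = Phi f (real k)"
    define W where "W = Avar f P"
    have P0: "0 \<le> P" by (simp add: P_def Phi_nonneg)
    have W: "V \<le> W + \<gamma> * a"
    proof -
      have "V \<le> Avar f (P + (\<epsilon> * a + 1 / f 0))"
        unfolding V_def using r V k by (intro Avar_mono) (auto simp: P_def)
      also have "\<dots> \<le> W + Avar f (\<epsilon> * a + 1 / f 0)"
        unfolding W_def using P0 \<epsilon>a f_pos[of 0] by (intro Avar_subadd) auto
      also have "Avar f (\<epsilon> * a + 1 / f 0) \<le> \<gamma> * a"
        using \<epsilon>a B2 f_pos[of 0] by (intro small) auto
      finally show ?thesis by simp
    qed
    have cub: "cubes k \<le> \<gamma> * a"
      unfolding a_def using k r V at \<epsilon>a B2 Bt by (intro rD(5)) auto
    have "tilt 1 k / tilt (1 - \<epsilon>) k \<le> exp (P - W / 2 + cubes k) / exp ((1 - \<epsilon>) * P - (1 - \<epsilon>)\<^sup>2 / 2 * W)"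
      unfolding P_def W_def using tilt_1_le[of k] tilt_ge[of "1 - \<epsilon>" k] \<epsilon> tilt_pos[of 1 k] f_pos[of 0]
      by (intro frac_le) auto
    also have "\<dots> = exp (\<epsilon> * P - (\<epsilon> - \<epsilon>\<^sup>2 / 2) * W + cubes k)"
      by (simp add: exp_diff[symmetric] power2_eq_square algebra_simps add_divide_distrib diff_divide_distrib)
    finally have c: "tilt 1 k / tilt (1 - \<epsilon>) k \<le> exp (\<epsilon> * P - (\<epsilon> - \<epsilon>\<^sup>2 / 2) * W + cubes k)" .
    have "expectation (\<lambda>\<omega>. (if ?L (D m n \<omega>) then 1 else 0) * tilt 1 (D m n \<omega>))
        \<le> exp (\<epsilon> * P - (\<epsilon> - \<epsilon>\<^sup>2 / 2) * W + cubes k) * exp ((1 - \<epsilon>) * (Psi n - Psi m))"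
    proof (rule expectation_tilt_restrict[OF m])
      fix d assume "?L d"
      then have "tilt (1 - \<epsilon>) k / tilt 1 k \<le> tilt (1 - \<epsilon>) d / tilt 1 d"
        using tilt_ratio_mono[of "1 - \<epsilon>" 1 d k] \<epsilon> k_greatest by fastforce
      moreover have "0 < tilt (1 - \<epsilon>) i" "0 < tilt 1 i" for i
        using \<epsilon> f_pos[of 0] by (auto intro!: tilt_pos)
      ultimately have "tilt 1 d / tilt (1 - \<epsilon>) d \<le> tilt 1 k / tilt (1 - \<epsilon>) k"
        by (simp add: field_simps)
      then show "tilt 1 d / tilt (1 - \<epsilon>) d \<le> exp (\<epsilon> * P - (\<epsilon> - \<epsilon>\<^sup>2 / 2) * W + cubes k)"
        using c by simp
    qed (use \<epsilon> in auto)
    also have "\<dots> = exp (r + (- \<epsilon> * (r - P) - (\<epsilon> - \<epsilon>\<^sup>2 / 2) * W + cubes k))"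
      by (simp add: exp_add[symmetric] r_def algebra_simps)
    also have "\<dots> \<le> ?bd"
    proof (rule exp_mono)
      have e: "0 \<le> \<epsilon> - \<epsilon>\<^sup>2 / 2" "\<epsilon> - \<epsilon>\<^sup>2 / 2 \<le> 1"
      proof -
        have "\<epsilon>\<^sup>2 \<le> \<epsilon>" using \<epsilon> by (simp add: power2_eq_square mult_left_le)
        then show "0 \<le> \<epsilon> - \<epsilon>\<^sup>2 / 2" "\<epsilon> - \<epsilon>\<^sup>2 / 2 \<le> 1"
          using \<epsilon> zero_le_power2[of \<epsilon>] by linarith+
      qed
      have "\<epsilon> * (- V + \<epsilon> * a) \<le> \<epsilon> * (r - P)" using \<epsilon> k by (intro mult_left_mono) (auto simp: P_def)
      moreover have "(\<epsilon> - \<epsilon>\<^sup>2 / 2) * (V - \<gamma> * a) \<le> (\<epsilon> - \<epsilon>\<^sup>2 / 2) * W" using e W by (intro mult_left_mono) auto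
      moreover have "\<epsilon>\<^sup>2 / 2 * V \<le> \<epsilon>\<^sup>2 / 2 * a" using V by (intro mult_left_mono) auto
      moreover have "(\<epsilon> - \<epsilon>\<^sup>2 / 2) * (\<gamma> * a) \<le> 1 * (\<gamma> * a)"
        using e \<gamma> a0 by (intro mult_right_mono) auto
      ultimately have "- \<epsilon> * (r - P) - (\<epsilon> - \<epsilon>\<^sup>2 / 2) * W + cubes k \<le> - (\<epsilon>\<^sup>2 / 2) * a + 2 * g"
        using cub unfolding g_def[symmetric]
        by (simp add: algebra_simps power2_eq_square add_divide_distrib diff_divide_distrib; linarith)
      moreover have "0 \<le> g" using \<gamma> a0 by (simp add: g_def)
      ultimately show "r + (- \<epsilon> * (r - P) - (\<epsilon> - \<epsilon>\<^sup>2 / 2) * W + cubes k) \<le> r - (\<epsilon>\<^sup>2 / 2 - 3 * \<gamma>) * a"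
        unfolding bd_eq by linarith
    qed
    finally show ?thesis .
  next
    case False
    have "\<not> ?L d" for d using False Phi_nonneg[of "real d"] by linarith
    then show ?thesis by simp
  qed
  let ?h = "\<lambda>Q g. (if Q (indegree g m) then 1 else 0) * tilt 1 (indegree g m)"
  have int: "integrable M (\<lambda>\<omega>. ?h Q (G n \<omega>))" for Q by (rule integrable_G[OF n1])
  have pos: "0 < tilt 1 d" for d using f_pos[of 0] by (intro tilt_pos) auto
  have "expectation (\<lambda>\<omega>. ?h (far \<epsilon> t m n) (G n \<omega>)) \<le> expectation (\<lambda>\<omega>. ?h ?U (G n \<omega>) + ?h ?L (G n \<omega>))"
  proof (rule integral_mono)
    show "?h (far \<epsilon> t m n) (G n \<omega>) \<le> ?h ?U (G n \<omega>) + ?h ?L (G n \<omega>)" for \<omega>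
      using pos[of "D m n \<omega>"] by (auto simp: far_def a_def[symmetric] r_def[symmetric] V_def[symmetric] abs_real_def split: if_splits)
  qed (intro Bochner_Integration.integrable_add int)+
  also have "\<dots> = expectation (\<lambda>\<omega>. ?h ?U (G n \<omega>)) + expectation (\<lambda>\<omega>. ?h ?L (G n \<omega>))"
    by (intro Bochner_Integration.integral_add int)
  finally show ?thesis using upper lower by (simp add: a_def r_def)
qed

text \<open>Chernoff's bound at time \<open>n\<close>: on the event, \<open>tilt 1\<close> is at least its value at level \<open>t + b\<close>,
  and between the times \<open>n\<^sub>1\<close> and \<open>n\<close> the weighted mass grows by an explicit factor. So it
  suffices to know the weighted mass of the condition \<open>Q\<close> at the earlier time.\<close>

lemma prob_and_large:
  assumes R: "regime B \<gamma> t" and B: "2 + 1 / f 0 \<le> B" and b: "0 \<le> b" "b \<le> Avar f t"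
    and m: "1 \<le> m" "m \<le> n\<^sub>1" "n\<^sub>1 \<le> n"
    and C: "expectation (\<lambda>\<omega>. (if Q (D m n\<^sub>1 \<omega>) then 1 else 0) * tilt 1 (D m n\<^sub>1 \<omega>)) \<le> C"
  shows "prob {\<omega> \<in> space M. Q (D m n\<^sub>1 \<omega>) \<and> t + b \<le> level m n \<omega>}
    \<le> C * exp (Psi n - Psi n\<^sub>1 - t - b + (1 + \<gamma>) / 2 * Avar f t)"
proof -
  note rD = regimeD[OF R]
  define a where "a = Avar f t"
  have a0: "0 < a" and ba: "b \<le> a" using rD b by (auto simp: a_def)
  have n0: "1 \<le> n\<^sub>1" "1 \<le> n" using m by auto
  have z: "0 \<le> t + b" using rD(1) b by simp
  obtain k where k: "t + b \<le> Phi f (real k)" "Phi f (real k) \<le> t + b + 1 / f 0"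
    and k_least: "\<And>d. t + b \<le> Phi f (real d) \<Longrightarrow> k \<le> d"
    using least_level[OF z] by blast
  define P where "P = Phi f (real k)"
  define W where "W = Avar f P"
  have pos: "0 < tilt 1 d" for d using f_pos[of 0] by (intro tilt_pos) auto
  have W: "W \<le> a + \<gamma> * a"
  proof -
    have d: "0 \<le> P - t" using k b unfolding P_def by linarith
    have "W \<le> Avar f (t + (P - t))" by (simp add: W_def)
    also have "\<dots> \<le> a + Avar f (P - t)"
      unfolding a_def using rD(1) d by (intro Avar_subadd) auto
    also have "Avar f (P - t) \<le> \<gamma> * a"
      unfolding a_def
    proof (rule rD(6)[OF d])
      have "1 * a \<le> B * a" using B a0 f_pos[of 0] by (intro mult_right_mono) (auto intro: order_trans[OF _ B])
      then show "P - t \<le> B * Avar f t + B" using k B ba unfolding P_def a_def by linarith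
    qed
    finally show ?thesis by simp
  qed
  let ?A = "{\<omega> \<in> space M. Q (D m n\<^sub>1 \<omega>) \<and> t + b \<le> level m n \<omega>}"
  let ?h = "\<lambda>g. if Q (indegree g m) then 1 else 0 :: real"
  let ?past = "restrict_network n\<^sub>1"
  have A: "?A = {\<omega> \<in> space M. Q (indegree (?past (G n \<omega>)) m) \<and> t + b \<le> level m n \<omega>}"
    using G_restrict[OF n0(1) m(3)] by auto
  have "prob ?A = expectation (\<lambda>\<omega>. if Q (indegree (?past (G n \<omega>)) m) \<and> t + b \<le> level m n \<omega> then 1 else 0)"
    unfolding A by (rule prob_G[OF n0(2)])
  also have "\<dots> \<le> expectation (\<lambda>\<omega>. ?h (?past (G n \<omega>)) * tilt 1 (D m n \<omega>) / tilt 1 k)"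
  proof (rule integral_mono)
    show "integrable M (\<lambda>\<omega>. if Q (indegree (?past (G n \<omega>)) m) \<and> t + b \<le> level m n \<omega> then 1 else 0 :: real)"
      using integrable_G[OF n0(2), of "\<lambda>g. if Q (indegree (?past g) m) \<and> t + b \<le> Phi f (real (indegree g m)) then 1 else 0"] .
    show "integrable M (\<lambda>\<omega>. ?h (?past (G n \<omega>)) * tilt 1 (D m n \<omega>) / tilt 1 k)"
      using integrable_G[OF n0(2), of "\<lambda>g. ?h (?past g) * tilt 1 (indegree g m) / tilt 1 k"] .
    fix \<omega>
    have "1 \<le> tilt 1 (D m n \<omega>) / tilt 1 k" if "t + b \<le> level m n \<omega>"
      using tilt_mono[of 1 k "D m n \<omega>"] k_least[OF that] pos[of k] by simp
    then show "(if Q (indegree (?past (G n \<omega>)) m) \<and> t + b \<le> level m n \<omega> then 1 else 0 :: real)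
        \<le> ?h (?past (G n \<omega>)) * tilt 1 (D m n \<omega>) / tilt 1 k"
      using pos[of "D m n \<omega>"] pos[of k] by auto
  qed
  also have "\<dots> = expectation (\<lambda>\<omega>. ?h (G n\<^sub>1 \<omega>) * tilt 1 (D m n \<omega>)) / tilt 1 k"
  proof -
    have "expectation (\<lambda>\<omega>. ?h (?past (G n \<omega>)) * tilt 1 (D m n \<omega>) / tilt 1 k)
        = expectation (\<lambda>\<omega>. ?h (G n\<^sub>1 \<omega>) * tilt 1 (D m n \<omega>) / tilt 1 k)"
      using G_restrict[OF n0(1) m(3)] by (intro Bochner_Integration.integral_cong) auto
    then show ?thesis by simp
  qed
  also have "expectation (\<lambda>\<omega>. ?h (G n\<^sub>1 \<omega>) * tilt 1 (D m n \<omega>))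
      = (\<Prod>i=n\<^sub>1..<n. 1 + 1 / real i) * expectation (\<lambda>\<omega>. ?h (G n\<^sub>1 \<omega>) * tilt 1 (D m n\<^sub>1 \<omega>))"
    using m by (intro expectation_tilt)
  also have "\<dots> / tilt 1 k \<le> exp (1 * (Psi n - Psi n\<^sub>1)) * C / exp (1 * P - 1\<^sup>2 / 2 * W)"
  proof (intro frac_le mult_mono C)
    show "(\<Prod>i=n\<^sub>1..<n. 1 + 1 / real i) \<le> exp (1 * (Psi n - Psi n\<^sub>1))"
      using prod_le_exp_Psi[of n\<^sub>1 n 1] n0 m by simp
    show 0: "0 \<le> expectation (\<lambda>\<omega>. ?h (G n\<^sub>1 \<omega>) * tilt 1 (D m n\<^sub>1 \<omega>))"
      using pos by (intro integral_nonneg_AE AE_I2) (auto simp: less_imp_le)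
    show "0 \<le> exp (1 * (Psi n - Psi n\<^sub>1)) * C" using order_trans[OF 0 C] by simp
    show "exp (1 * P - 1\<^sup>2 / 2 * W) \<le> tilt 1 k" unfolding P_def W_def by (rule tilt_ge) simp
  qed auto
  also have "\<dots> = C * exp (Psi n - Psi n\<^sub>1 - P + W / 2)"
  proof -
    have *: "exp x * C / exp y = C * exp (x - y)" for x y :: real by (simp add: exp_diff)
    show ?thesis unfolding * by (simp add: algebra_simps)
  qed
  also have "\<dots> \<le> C * exp (Psi n - Psi n\<^sub>1 - t - b + (1 + \<gamma>) / 2 * a)"
  proof (intro mult_left_mono exp_mono)
    have "W / 2 \<le> (a + \<gamma> * a) / 2" using W by (intro divide_right_mono) auto
    also have "\<dots> = (1 + \<gamma>) / 2 * a" by (simp add: algebra_simps)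
    finally have W2: "W / 2 \<le> (1 + \<gamma>) / 2 * a" .
    have "x - p + w \<le> x - y - z + v" if "y + z \<le> p" "w \<le> v" for x p w y z v :: real
      using that by linarith
    from this[OF k(1)[folded P_def] W2]
    show "Psi n - Psi n\<^sub>1 - P + W / 2 \<le> Psi n - Psi n\<^sub>1 - t - b + (1 + \<gamma>) / 2 * a" .
    have "0 \<le> expectation (\<lambda>\<omega>. ?h (G n\<^sub>1 \<omega>) * tilt 1 (D m n\<^sub>1 \<omega>))"
      using pos by (intro integral_nonneg_AE AE_I2) (auto simp: less_imp_le)
    then show "0 \<le> C" using C by (rule order_trans)
  qed
  finally show ?thesis by (simp add: a_def)
qed

text \<open>With \<open>b\<close> near \<open>Avar f t / 2\<close>, the factor of the previous bound balances the weighted mass up to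
  \<open>exp (- Psi m)\<close>, which sums over all vertices to at most \<open>t + 1\<close>. The deviation from the window
  then wins.\<close>

lemma prob_far_and_large:
  assumes R: "regime B \<gamma> t" and B: "2 + 1 / f 0 \<le> B" and \<gamma>: "0 < \<gamma>" "\<gamma> \<le> 1 / 4"
    and \<epsilon>: "0 < \<epsilon>" "\<epsilon> \<le> 1" and \<delta>: "0 \<le> \<delta>" "\<delta> \<le> 1 / 2"
    and m: "1 \<le> m" "m \<le> n\<^sub>1" "n\<^sub>1 \<le> n" and n: "Psi n \<le> t"
  shows "prob {\<omega> \<in> space M. far \<epsilon> t m n\<^sub>1 (D m n\<^sub>1 \<omega>) \<and> t + (1 / 2 - \<delta>) * Avar f t \<le> level m n \<omega>}
    \<le> 2 * exp (- Psi m - (\<epsilon>\<^sup>2 / 2 - \<delta> - 4 * \<gamma>) * Avar f t)"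
proof -
  let ?a = "Avar f t"
  have a0: "0 < ?a" using regimeD(4)[OF R] .
  have b: "0 \<le> (1 / 2 - \<delta>) * ?a" "(1 / 2 - \<delta>) * ?a \<le> ?a"
    using \<delta> a0 by (simp_all add: mult_left_le_one_le)
  have n1: "Psi n\<^sub>1 \<le> t" using Psi_le_iff[of n\<^sub>1 n] m n by simp
  have "prob {\<omega> \<in> space M. far \<epsilon> t m n\<^sub>1 (D m n\<^sub>1 \<omega>) \<and> t + (1 / 2 - \<delta>) * ?a \<le> level m n \<omega>}
      \<le> 2 * exp (Psi n\<^sub>1 - Psi m - (\<epsilon>\<^sup>2 / 2 - 3 * \<gamma>) * ?a)
        * exp (Psi n - Psi n\<^sub>1 - t - (1 / 2 - \<delta>) * ?a + (1 + \<gamma>) / 2 * ?a)"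
    using expectation_tilt_far[OF R B \<gamma> \<epsilon> m(1,2) n1] by (rule prob_and_large[OF R B b m])
  also have "\<dots> = 2 * exp (- Psi m - (\<epsilon>\<^sup>2 / 2 - \<delta> - 4 * \<gamma>) * ?a + (Psi n - t - \<gamma> / 2 * ?a))"
  proof -
    have *: "2 * exp x * exp y = 2 * exp (x + y)" for x y :: real by (simp add: exp_add)
    show ?thesis unfolding * by (simp add: field_simps)
  qed
  also have "\<dots> \<le> 2 * exp (- Psi m - (\<epsilon>\<^sup>2 / 2 - \<delta> - 4 * \<gamma>) * ?a)"
  proof -
    have "0 \<le> \<gamma> / 2 * ?a" using \<gamma> a0 by simp
    then have "Psi n - t - \<gamma> / 2 * ?a \<le> 0" using n by linarith
    then show ?thesis by simp
  qed
  finally show ?thesis .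
qed

lemma prob_too_large:
  assumes R: "regime B \<gamma> t" and B: "2 + 1 / f 0 \<le> B" and \<gamma>: "0 < \<gamma>"
    and \<delta>: "0 \<le> \<delta>" "\<delta> \<le> 1 / 2" and m: "1 \<le> m" "m \<le> n" and n: "Psi n \<le> t"
  shows "prob {\<omega> \<in> space M. t + (1 / 2 + \<delta>) * Avar f t \<le> level m n \<omega>}
    \<le> exp (- Psi m - (\<delta> - \<gamma>) * Avar f t)"
proof -
  let ?a = "Avar f t"
  have a0: "0 < ?a" using regimeD(4)[OF R] .
  have b: "0 \<le> (1 / 2 + \<delta>) * ?a" "(1 / 2 + \<delta>) * ?a \<le> ?a"
    using \<delta> a0 by (simp_all add: mult_left_le_one_le)
  have C: "expectation (\<lambda>\<omega>. (if (\<lambda>_. True) (D m n \<omega>) then 1 else 0) * tilt 1 (D m n \<omega>)) \<le> exp (Psi n - Psi m)"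
    using expectation_tilt_born[OF m, of 1] prod_le_exp_Psi[OF m, of 1] by simp
  have "prob {\<omega> \<in> space M. t + (1 / 2 + \<delta>) * ?a \<le> level m n \<omega>}
      \<le> exp (Psi n - Psi m) * exp (Psi n - Psi n - t - (1 / 2 + \<delta>) * ?a + (1 + \<gamma>) / 2 * ?a)"
    using prob_and_large[OF R B b m order_refl C] by simp
  also have "\<dots> = exp (- Psi m - (\<delta> - \<gamma>) * ?a + (Psi n - t - \<gamma> / 2 * ?a))"
    unfolding exp_add[symmetric] by (simp add: field_simps)
  also have "\<dots> \<le> exp (- Psi m - (\<delta> - \<gamma>) * ?a)"
  proof -
    have "0 \<le> \<gamma> / 2 * ?a" using \<gamma> a0 by simp
    then have "Psi n - t - \<gamma> / 2 * ?a \<le> 0" using n by linarith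
    then show ?thesis by simp
  qed
  finally show ?thesis .
qed

text \<open>Most of the weighted mass lies in the window, where the weight itself is controlled. This
  bounds the probability of a large deviation from below.\<close>

lemma prob_large_ge:
  assumes R: "regime B \<gamma> t" and B: "2 + 1 / f 0 \<le> B" and \<gamma>: "0 < \<gamma>" "\<gamma> \<le> 1 / 4"
    and \<eta>: "0 < \<eta>" "\<eta> \<le> 1" "3 * \<gamma> \<le> \<eta>\<^sup>2 / 4" and big: "3 \<le> \<eta>\<^sup>2 / 4 * Avar f t"
    and m: "1 \<le> m" "m \<le> n" and n: "Psi n \<le> t"
  shows "exp (- 2 - (1 / 2 + \<eta> + 2 * \<gamma>) * Avar f t)
    \<le> prob {\<omega> \<in> space M. Psi n - Psi m + Avar f (Psi n - Psi m) - \<eta> * Avar f t < level m n \<omega>}"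
proof -
  note rD = regimeD[OF R]
  define a where "a = Avar f t"
  define r where "r = Psi n - Psi m"
  define V where "V = Avar f r"
  have a0: "0 < a" using rD by (simp add: a_def)
  have r: "0 \<le> r" "r \<le> t" using m n Psi_le_iff[of m n] Psi_nonneg[of m] by (auto simp: r_def)
  have V: "0 \<le> V" "V \<le> a" using r by (auto simp: V_def a_def intro: Avar_nonneg Avar_mono)
  have \<eta>a: "0 \<le> \<eta> * a" "\<eta> * a \<le> a" using \<eta> a0 by (auto simp: mult_left_le_one_le)
  have "\<gamma> * t \<le> 1 / 4 * t" using rD(1) \<gamma> by (intro mult_right_mono) auto
  then have at: "a \<le> t / 4" using rD(3) unfolding a_def by linarith
  have n1: "1 \<le> n" using m by simp
  have pos: "0 < tilt 1 d" for d using f_pos[of 0] by (intro tilt_pos) auto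
  let ?far = "far \<eta> t m n"
  let ?Q = "\<lambda>d. r + V - \<eta> * a < Phi f (real d)"
  let ?c = "exp (r + (1 / 2 + \<eta> + 2 * \<gamma>) * a)"
  let ?h = "\<lambda>Q g. (if Q (indegree g m) then 1 else 0) * tilt 1 (indegree g m)"
  have int: "integrable M (\<lambda>\<omega>. h (G n \<omega>))" for h :: "network \<Rightarrow> real" by (rule integrable_G[OF n1])
  have win: "?h (\<lambda>d. \<not> ?far d) g \<le> (if ?Q (indegree g m) then 1 else 0) * ?c" for g
  proof (cases "?far (indegree g m)")
    case False
    define P where "P = Phi f (real (indegree g m))"
    have P: "r + V - \<eta> * a < P" "P < r + V + \<eta> * a"
      using False by (auto simp: far_def P_def a_def[symmetric] r_def[symmetric] V_def[symmetric])
    have P0: "0 \<le> P" by (simp add: P_def Phi_nonneg)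
    have "V \<le> Avar f (P + \<eta> * a)" unfolding V_def using r P V by (intro Avar_mono) auto
    also have "\<dots> \<le> Avar f P + Avar f (\<eta> * a)" using P0 \<eta>a by (intro Avar_subadd)
    also have "Avar f (\<eta> * a) \<le> \<gamma> * a"
      unfolding a_def
    proof (rule rD(6))
      have "1 * a \<le> B * a" using B a0 f_pos[of 0] by (intro mult_right_mono) (auto intro: order_trans[OF _ B])
      moreover have "0 \<le> B" using B f_pos[of 0] by (auto intro: order_trans[OF _ B])
      ultimately show "\<eta> * Avar f t \<le> B * Avar f t + B" using \<eta>a unfolding a_def by linarith
    qed (use \<eta>a in \<open>simp add: a_def\<close>)
    finally have AP: "V \<le> Avar f P + \<gamma> * a" by simp
    have cub: "cubes (indegree g m) \<le> \<gamma> * a"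
      unfolding a_def using P r V at \<eta>a by (intro rD(5)) (auto simp: P_def)
    have "tilt 1 (indegree g m) \<le> exp (P - Avar f P / 2 + cubes (indegree g m))"
      unfolding P_def by (rule tilt_1_le)
    also have "\<dots> \<le> ?c"
    proof (rule exp_mono)
      have e: "(1 / 2 + \<eta> + 2 * \<gamma>) * a = a / 2 + \<eta> * a + 2 * (\<gamma> * a)" by (simp add: algebra_simps)
      have "0 \<le> \<gamma> * a" using \<gamma> a0 by simp
      then show "P - Avar f P / 2 + cubes (indegree g m) \<le> r + (1 / 2 + \<eta> + 2 * \<gamma>) * a"
        unfolding e using P(2) AP cub V by linarith
    qed
    finally show ?thesis using False P by (simp add: P_def)
  qed simp
  have Q: "prob {\<omega> \<in> space M. ?Q (D m n \<omega>)} = expectation (\<lambda>\<omega>. if ?Q (D m n \<omega>) then 1 else 0)"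
    by (rule prob_G[OF n1])
  have "exp (r - 1) \<le> expectation (\<lambda>\<omega>. tilt 1 (D m n \<omega>))"
    unfolding expectation_tilt_born[OF m] r_def by (rule prod_1_plus_inverse_ge[OF m])
  also have "\<dots> = expectation (\<lambda>\<omega>. ?h ?far (G n \<omega>) + ?h (\<lambda>d. \<not> ?far d) (G n \<omega>))"
    by (intro Bochner_Integration.integral_cong) auto
  also have "\<dots> = expectation (\<lambda>\<omega>. ?h ?far (G n \<omega>)) + expectation (\<lambda>\<omega>. ?h (\<lambda>d. \<not> ?far d) (G n \<omega>))"
    using int[of "?h ?far"] int[of "?h (\<lambda>d. \<not> ?far d)"] by (rule Bochner_Integration.integral_add)
  also have "expectation (\<lambda>\<omega>. ?h (\<lambda>d. \<not> ?far d) (G n \<omega>)) \<le> expectation (\<lambda>\<omega>. (if ?Q (D m n \<omega>) then 1 else 0) * ?c)"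
    using int[of "?h (\<lambda>d. \<not> ?far d)"] int[of "\<lambda>g. (if ?Q (indegree g m) then 1 else 0) * ?c"] win
    by (rule integral_mono)
  also have "\<dots> = prob {\<omega> \<in> space M. ?Q (D m n \<omega>)} * ?c" unfolding Q by simp
  also have "expectation (\<lambda>\<omega>. ?h ?far (G n \<omega>)) \<le> 2 * exp (r - (\<eta>\<^sup>2 / 2 - 3 * \<gamma>) * a)"
    unfolding a_def r_def by (rule expectation_tilt_far[OF R B \<gamma> \<eta>(1,2) m n])
  also have "\<dots> \<le> 2 * exp (r - 3)"
  proof -
    have "\<eta>\<^sup>2 / 4 * a \<le> (\<eta>\<^sup>2 / 2 - 3 * \<gamma>) * a" using \<eta>(3) a0 by (intro mult_right_mono) auto
    then show ?thesis using big by (simp add: a_def)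
  qed
  finally have "exp (r - 1) - 2 * exp (r - 3) \<le> prob {\<omega> \<in> space M. ?Q (D m n \<omega>)} * ?c" by simp
  moreover have "exp (r - 2) \<le> exp (r - 1) - 2 * exp (r - 3)"
  proof -
    define y where "y = exp (- 1 :: real)"
    have "2 \<le> exp (1::real)" using exp_ge_add_one_self[of 1] by simp
    then have y: "0 < y" "y \<le> 1 / 2" by (auto simp: y_def exp_minus field_simps)
    have "exp (r - 1) = exp r * y" "exp (r - 2) = exp r * (y * y)" "exp (r - 3) = exp r * (y * y * y)"
      by (simp_all add: y_def exp_add[symmetric])
    moreover have "y * y \<le> 1 / 2 * y" "2 * y * (y * y) \<le> 1 * (y * y)"
      using y by (intro mult_right_mono; simp)+
    then have "y * y \<le> y - 2 * (y * y * y)" by (simp add: mult.assoc)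
    then have "exp r * (y * y) \<le> exp r * (y - 2 * (y * y * y))" by (intro mult_left_mono) auto
    ultimately show ?thesis by (simp add: algebra_simps)
  qed
  ultimately have "exp (r - 2) / ?c \<le> prob {\<omega> \<in> space M. ?Q (D m n \<omega>)}"
    by (simp add: pos_divide_le_eq)
  then show ?thesis by (simp add: exp_diff[symmetric] r_def V_def a_def algebra_simps)
qed

text \<open>There are so many vertices born slightly after artificial time \<open>Avar f t / 2\<close> that, by
  independence, one of them attains the critical level.\<close>

lemma prob_none_large:
  assumes R: "regime B \<gamma> t" and B: "4 + 1 / f 0 \<le> B" and \<gamma>: "0 < \<gamma>" "\<gamma> \<le> 1 / 8"
    and \<eta>: "0 < \<eta>" "\<eta> \<le> 1" "3 * \<gamma> \<le> \<eta>\<^sup>2 / 4" and big: "3 \<le> \<eta>\<^sup>2 / 4 * Avar f t"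
  shows "prob {\<omega> \<in> space M. \<forall>m\<in>{1..clock t}. level m (clock t) \<omega> < t + (1 / 2 - 4 * \<eta>) * Avar f t}
    \<le> exp (- exp ((\<eta> - 2 * \<gamma>) * Avar f t - 2))"
proof -
  note rD = regimeD[OF R]
  define a where "a = Avar f t"
  define n where "n = clock t"
  \<comment> \<open>The birth times considered are near \<open>b\<close>. The term \<open>2 * \<eta>\<close> provides more vertices than the
    reciprocal of the success probability, and costs only as much in the level reached.\<close>
  define b where "b = (1 / 2 + 2 * \<eta>) * a"
  define N where "N = nat \<lceil>exp b\<rceil>"
  define Q where "Q m d \<longleftrightarrow> Psi n - Psi m + Avar f (Psi n - Psi m) - \<eta> * a < Phi f (real d)" for m d
  define p where "p = exp (- 2 - (1 / 2 + \<eta> + 2 * \<gamma>) * a)"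
  have a0: "0 < a" using rD by (simp add: a_def)
  have t0: "0 \<le> t" using rD by simp
  have n1: "1 \<le> n" and nt: "Psi n \<le> t" "t - 1 < Psi n"
    using clock_ge_1[OF t0] Psi_clock_le[OF t0] clock_gt[OF t0] by (auto simp: n_def)
  have b: "0 \<le> b" "b \<le> 3 * a" using \<eta> a0 by (auto simp: b_def intro: mult_right_mono)
  have Ne: "exp b \<le> real N" "real N \<le> exp b + 1" by (auto simp: N_def)
  have e1: "1 \<le> exp b" using b by simp
  have N1: "1 \<le> N" using Ne e1 by linarith
  have "\<gamma> * t \<le> 1 / 8 * t" using rD(1) \<gamma> by (intro mult_right_mono) auto
  then have at: "a \<le> t / 8" using rD(3) unfolding a_def by linarith
  have B4: "4 \<le> B" "2 + 1 / f 0 \<le> B" using B f_pos[of 0] by (auto intro: order_trans[OF _ B])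
  have ga: "4 \<le> \<gamma> * a" using rD(2) B4 by (simp add: a_def)
  have ga': "\<gamma> * a \<le> 1 / 8 * a" using \<gamma> a0 by (intro mult_right_mono) auto
  have Psi_m: "Psi m \<le> 3 + b" if "m \<in> {N..<2 * N}" for m
  proof -
    have m1: "1 \<le> m" using that N1 by auto
    have "real m \<le> real (2 * N)" using that by simp
    also have "\<dots> \<le> exp 1 * (exp 1 * exp b)"
    proof -
      have "real (2 * N) = 2 * real N" by simp
      then have "real (2 * N) \<le> 2 * (2 * exp b)" using Ne e1 by linarith
      also have "\<dots> \<le> exp 1 * (exp 1 * exp b)"
        using exp_ge_add_one_self[of "1::real"] by (intro mult_mono) auto
      finally show ?thesis .
    qed
    also have "\<dots> = exp (2 + b)" by (simp add: exp_add[symmetric])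
    finally have "ln (real m) \<le> 2 + b" using m1 ln_mono[of "real m" "exp (2 + b)"] by simp
    then show ?thesis using Psi_le_ln[OF m1] by simp
  qed
  have Bs: "{N..<2 * N} \<subseteq> {1..n}"
  proof
    fix m assume m: "m \<in> {N..<2 * N}"
    then have m1: "1 \<le> m" using N1 by auto
    have "Psi m \<le> t" using Psi_m[OF m] b at ga ga' by linarith
    then have "m \<le> n" using le_clock_iff[OF t0 m1] by (simp add: n_def)
    then show "m \<in> {1..n}" using m1 by simp
  qed
  have QI: "t + (1 / 2 - 4 * \<eta>) * a \<le> level m n \<omega>" if m: "m \<in> {N..<2 * N}" and q: "Q m (D m n \<omega>)" for m \<omega>
  proof -
    let ?r = "Psi n - Psi m"
    have r0: "0 \<le> ?r" using m Bs Psi_le_iff[of m n] n1 by auto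
    have rt: "t - ?r \<le> 4 + b" using Psi_m[OF m] nt by linarith
    have rt0: "0 \<le> t - ?r" using nt Psi_nonneg[of m] by linarith
    have "a \<le> Avar f (?r + (t - ?r))" by (simp add: a_def)
    also have "\<dots> \<le> Avar f ?r + Avar f (t - ?r)" using r0 rt0 by (intro Avar_subadd)
    also have "Avar f (t - ?r) \<le> \<gamma> * a"
      unfolding a_def
    proof (rule rD(6)[OF rt0])
      have "4 * a \<le> B * a" using B4 a0 by (intro mult_right_mono) auto
      then show "t - ?r \<le> B * Avar f t + B" using rt b a0 B4 unfolding a_def by linarith
    qed
    finally have "a \<le> Avar f ?r + \<gamma> * a" by simp
    moreover have "2 * (\<gamma> * a) \<le> \<eta> * a"
    proof -
      have "\<eta>\<^sup>2 \<le> \<eta>" using \<eta> by (simp add: power2_eq_square mult_left_le)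
      then have "2 * \<gamma> \<le> \<eta>" using \<eta> by linarith
      then have "(2 * \<gamma>) * a \<le> \<eta> * a" using a0 by (intro mult_right_mono) auto
      then show ?thesis by simp
    qed
    ultimately have "t + (a - b - 2 * (\<eta> * a)) \<le> level m n \<omega>"
      using q rt ga unfolding Q_def by linarith
    moreover have "a - b - 2 * (\<eta> * a) = (1 / 2 - 4 * \<eta>) * a" by (simp add: b_def algebra_simps)
    ultimately show ?thesis by simp
  qed
  let ?\<phi> = "\<lambda>m d. if m \<in> {N..<2 * N} \<and> Q m d then 0 else 1 :: real"
  have p0: "0 < p" by (simp add: p_def)
  have factor: "0 \<le> expectation (\<lambda>\<omega>. ?\<phi> m (D m n \<omega>)) \<and>
      expectation (\<lambda>\<omega>. ?\<phi> m (D m n \<omega>)) \<le> (if m \<in> {N..<2 * N} then exp (- p) else 1)" if "m \<in> {1..n}" for m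
  proof (intro conjI)
    show "0 \<le> expectation (\<lambda>\<omega>. ?\<phi> m (D m n \<omega>))" by (intro integral_nonneg_AE AE_I2) auto
    show "expectation (\<lambda>\<omega>. ?\<phi> m (D m n \<omega>)) \<le> (if m \<in> {N..<2 * N} then exp (- p) else 1)"
    proof (cases "m \<in> {N..<2 * N}")
      case True
      have "expectation (\<lambda>\<omega>. ?\<phi> m (D m n \<omega>)) = expectation (\<lambda>\<omega>. 1 - (if Q m (D m n \<omega>) then 1 else 0))"
        using True by (intro Bochner_Integration.integral_cong) auto
      also have "\<dots> = 1 - expectation (\<lambda>\<omega>. if Q m (D m n \<omega>) then 1 else 0)"
        using integrable_G[OF n1, of "\<lambda>g. if Q m (indegree g m) then 1 else 0"]
        by (subst Bochner_Integration.integral_diff) (auto simp: prob_space)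
      also have "expectation (\<lambda>\<omega>. if Q m (D m n \<omega>) then 1 else 0) = prob {\<omega> \<in> space M. Q m (D m n \<omega>)}"
        by (rule prob_G[OF n1, symmetric])
      also have "p \<le> \<dots>"
        unfolding p_def Q_def a_def using that \<gamma> nt
        by (intro prob_large_ge[OF R B4(2) _ _ \<eta> big]) auto
      then have "1 - prob {\<omega> \<in> space M. Q m (D m n \<omega>)} \<le> 1 + - p" by simp
      also have "\<dots> \<le> exp (- p)" by (rule exp_ge_add_one_self)
      finally show ?thesis using True by simp
    next
      case False
      then have "expectation (\<lambda>\<omega>. ?\<phi> m (D m n \<omega>)) = expectation (\<lambda>\<omega>. 1)"
        by (intro Bochner_Integration.integral_cong) auto
      then show ?thesis unfolding if_not_P[OF False] by (simp add: prob_space)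
    qed
  qed
  have "prob {\<omega> \<in> space M. \<forall>m\<in>{1..n}. level m n \<omega> < t + (1 / 2 - 4 * \<eta>) * a}
      \<le> prob {\<omega> \<in> space M. \<forall>m\<in>{1..n}. \<not> (m \<in> {N..<2 * N} \<and> Q m (D m n \<omega>))}"
  proof (rule finite_measure_mono)
    show "{\<omega> \<in> space M. \<forall>m\<in>{1..n}. \<not> (m \<in> {N..<2 * N} \<and> Q m (D m n \<omega>))} \<in> events"
      using sets_G[OF n1, of "\<lambda>g. \<forall>m\<in>{1..n}. \<not> (m \<in> {N..<2 * N} \<and> Q m (indegree g m))"] .
    show "{\<omega> \<in> space M. \<forall>m\<in>{1..n}. level m n \<omega> < t + (1 / 2 - 4 * \<eta>) * a}
        \<subseteq> {\<omega> \<in> space M. \<forall>m\<in>{1..n}. \<not> (m \<in> {N..<2 * N} \<and> Q m (D m n \<omega>))}"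
      using QI by fastforce
  qed
  also have "\<dots> = expectation (\<lambda>\<omega>. if \<forall>m\<in>{1..n}. \<not> (m \<in> {N..<2 * N} \<and> Q m (D m n \<omega>)) then 1 else 0)"
    by (rule prob_G[OF n1])
  also have "\<dots> = expectation (\<lambda>\<omega>. \<Prod>m=1..n. ?\<phi> m (D m n \<omega>))"
  proof (rule Bochner_Integration.integral_cong[OF refl])
    fix \<omega>
    show "(if \<forall>m\<in>{1..n}. \<not> (m \<in> {N..<2 * N} \<and> Q m (D m n \<omega>)) then 1 else 0) = (\<Prod>m=1..n. ?\<phi> m (D m n \<omega>))"
    proof (cases "\<forall>m\<in>{1..n}. \<not> (m \<in> {N..<2 * N} \<and> Q m (D m n \<omega>))")
      case False
      then have "(\<Prod>m=1..n. ?\<phi> m (D m n \<omega>)) = 0" by (intro prod_zero) auto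
      then show ?thesis using False by (simp only: if_False)
    qed (auto intro: prod.neutral)
  qed
  also have "\<dots> = (\<Prod>m=1..n. expectation (\<lambda>\<omega>. ?\<phi> m (D m n \<omega>)))"
    by (rule indegrees_independent[OF n1])
  also have "\<dots> \<le> (\<Prod>m=1..n. if m \<in> {N..<2 * N} then exp (- p) else 1)"
    using factor by (intro prod_mono) auto
  also have "\<dots> = (\<Prod>m\<in>{N..<2 * N}. exp (- p))"
    using Bs by (intro prod.mono_neutral_cong_right) auto
  also have "\<dots> = exp (- (real N * p))" by (simp add: exp_of_nat_mult[symmetric])
  also have "\<dots> \<le> exp (- exp ((\<eta> - 2 * \<gamma>) * a - 2))"
  proof -
    have "exp ((\<eta> - 2 * \<gamma>) * a - 2) = exp b * p"
      by (simp add: p_def b_def exp_add[symmetric] algebra_simps)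
    also have "\<dots> \<le> real N * p" using Ne p0 by (intro mult_right_mono) auto
    finally show ?thesis by simp
  qed
  finally show ?thesis by (simp add: a_def n_def)
qed

text \<open>A vertex selected by the network at time \<open>n\<close> evolves afterwards like a fixed vertex. The
  selection is arbitrary, but must not anticipate the evolution after time \<open>n\<close>.\<close>

lemma expectation_tilt_selected:
  assumes n: "1 \<le> n" "n \<le> n\<^sub>2" and H: "\<And>\<omega>. \<omega> \<in> space M \<Longrightarrow> H (G n \<omega>) \<in> {1..n}"
    and \<theta>: "- f 0 < \<theta>" "- 1 \<le> \<theta>"
  shows "expectation (\<lambda>\<omega>. tilt \<theta> (D (H (G n \<omega>)) n\<^sub>2 \<omega>) / tilt \<theta> (D (H (G n \<omega>)) n \<omega>)) \<le> exp (\<theta> * (Psi n\<^sub>2 - Psi n))"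
proof -
  define h where "h m g = (if H g = m then 1 / tilt \<theta> (indegree g m) else 0)" for m g
  have pos: "0 < tilt \<theta> d" for d using \<theta> by (intro tilt_pos)
  have n2: "1 \<le> n\<^sub>2" using n by simp
  have int: "integrable M (\<lambda>\<omega>. h m (G n \<omega>) * tilt \<theta> (D m n\<^sub>2 \<omega>))" for m
  proof -
    have "integrable M (\<lambda>\<omega>. h m (restrict_network n (G n\<^sub>2 \<omega>)) * tilt \<theta> (D m n\<^sub>2 \<omega>))"
      using integrable_G[OF n2, of "\<lambda>g. h m (restrict_network n g) * tilt \<theta> (indegree g m)"] .
    then show ?thesis
      by (rule Bochner_Integration.integrable_cong[THEN iffD1, rotated 2]) (auto simp: G_restrict[OF n, symmetric])
  qed
  have "expectation (\<lambda>\<omega>. tilt \<theta> (D (H (G n \<omega>)) n\<^sub>2 \<omega>) / tilt \<theta> (D (H (G n \<omega>)) n \<omega>))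
      = expectation (\<lambda>\<omega>. \<Sum>m=1..n. h m (G n \<omega>) * tilt \<theta> (D m n\<^sub>2 \<omega>))"
  proof (rule Bochner_Integration.integral_cong[OF refl])
    fix \<omega> assume "\<omega> \<in> space M"
    have "(\<Sum>m=1..n. h m (G n \<omega>) * tilt \<theta> (D m n\<^sub>2 \<omega>))
        = (\<Sum>m=1..n. if m = H (G n \<omega>) then tilt \<theta> (D m n\<^sub>2 \<omega>) / tilt \<theta> (D m n \<omega>) else 0)"
      by (intro sum.cong) (auto simp: h_def)
    also have "\<dots> = tilt \<theta> (D (H (G n \<omega>)) n\<^sub>2 \<omega>) / tilt \<theta> (D (H (G n \<omega>)) n \<omega>)"
      using H[OF \<open>\<omega> \<in> space M\<close>] by simp
    finally show "tilt \<theta> (D (H (G n \<omega>)) n\<^sub>2 \<omega>) / tilt \<theta> (D (H (G n \<omega>)) n \<omega>)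
        = (\<Sum>m=1..n. h m (G n \<omega>) * tilt \<theta> (D m n\<^sub>2 \<omega>))" by simp
  qed
  also have "\<dots> = (\<Sum>m=1..n. expectation (\<lambda>\<omega>. h m (G n \<omega>) * tilt \<theta> (D m n\<^sub>2 \<omega>)))"
    using int by (rule Bochner_Integration.integral_sum)
  also have "\<dots> = (\<Sum>m=1..n. (\<Prod>i=n..<n\<^sub>2. 1 + \<theta> / real i) * expectation (\<lambda>\<omega>. h m (G n \<omega>) * tilt \<theta> (D m n \<omega>)))"
    using n by (intro sum.cong expectation_tilt) auto
  also have "\<dots> = (\<Prod>i=n..<n\<^sub>2. 1 + \<theta> / real i) * expectation (\<lambda>\<omega>. \<Sum>m=1..n. h m (G n \<omega>) * tilt \<theta> (D m n \<omega>))"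
    using integrable_G[OF n(1), of "\<lambda>g. h m g * tilt \<theta> (indegree g m)" for m]
    by (simp add: sum_distrib_left[symmetric] Bochner_Integration.integral_sum)
  also have "expectation (\<lambda>\<omega>. \<Sum>m=1..n. h m (G n \<omega>) * tilt \<theta> (D m n \<omega>)) = expectation (\<lambda>\<omega>. 1)"
  proof (rule Bochner_Integration.integral_cong[OF refl])
    fix \<omega> assume "\<omega> \<in> space M"
    have "(\<Sum>m=1..n. h m (G n \<omega>) * tilt \<theta> (D m n \<omega>)) = (\<Sum>m=1..n. if m = H (G n \<omega>) then 1 else 0)"
      using pos by (intro sum.cong) (auto simp: h_def less_imp_neq[OF pos, symmetric])
    then show "(\<Sum>m=1..n. h m (G n \<omega>) * tilt \<theta> (D m n \<omega>)) = 1" using H[OF \<open>\<omega> \<in> space M\<close>] by simp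
  qed
  also have "(\<Prod>i=n..<n\<^sub>2. 1 + \<theta> / real i) * expectation (\<lambda>\<omega>. 1) \<le> exp (\<theta> * (Psi n\<^sub>2 - Psi n))"
    using prod_le_exp_Psi[OF n \<theta>(2)] by (simp add: prob_space)
  finally show ?thesis .
qed

text \<open>Chernoff bounds with the small parameters \<open>\<eta>\<close> and \<open>- \<eta>\<close>. Over a time of order \<open>t\<close> the variance is
  of order \<open>Avar f t\<close>, so a deviation of this order is exponentially unlikely in \<open>Avar f t\<close>.\<close>

lemma prob_selected_far:
  assumes n: "1 \<le> n" "n \<le> n\<^sub>2" and H: "\<And>\<omega>. \<omega> \<in> space M \<Longrightarrow> H (G n \<omega>) \<in> {1..n}"
    and t: "0 < t" and \<epsilon>: "0 < \<epsilon>" and N: "1 \<le> N" "Psi n\<^sub>2 - Psi n + \<epsilon> * Avar f t \<le> real N * t"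
    and \<eta>: "0 < \<eta>" "\<eta> \<le> \<epsilon> / (4 * real N)" "\<eta> \<le> f 0 / 2" "\<eta> \<le> 1 / 2"
  shows "prob {\<omega> \<in> space M. \<epsilon> * Avar f t \<le> \<bar>level (H (G n \<omega>)) n\<^sub>2 \<omega> - level (H (G n \<omega>)) n \<omega> - (Psi n\<^sub>2 - Psi n)\<bar>}
    \<le> 2 * exp (- \<eta> * \<epsilon> / 2 * Avar f t)"
proof -
  define a where "a = Avar f t"
  define r where "r = Psi n\<^sub>2 - Psi n"
  define x where "x = r + \<epsilon> * a"
  have a0: "0 < a" using t Avar_pos by (simp add: a_def)
  have n2: "1 \<le> n\<^sub>2" using n by simp
  have r0: "0 \<le> r" using Psi_le_iff[of n n\<^sub>2] n n2 by (simp add: r_def)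
  have x0: "0 \<le> x" using r0 \<epsilon> a0 by (simp add: x_def)
  have "Avar f x \<le> Avar f (real N * t)" using x0 N by (intro Avar_mono) (auto simp: x_def r_def a_def)
  also have "\<dots> \<le> real N * a" unfolding a_def using t by (intro Avar_nat_mult) simp
  finally have Ax: "Avar f x \<le> real N * a" .
  have Ar: "Avar f r \<le> real N * a"
    using Avar_mono[of r x] r0 \<epsilon> a0 Ax by (simp add: x_def)
  have \<eta>N: "\<eta> * real N \<le> \<epsilon> / 4" using \<eta>(2) N by (simp add: field_simps)
  have posp: "0 < tilt \<eta> d" and posm: "0 < tilt (- \<eta>) d" for d
    using \<eta> f_pos[of 0] by (auto intro!: tilt_pos)
  let ?R = "\<lambda>\<theta> \<omega>. tilt \<theta> (D (H (G n \<omega>)) n\<^sub>2 \<omega>) / tilt \<theta> (D (H (G n \<omega>)) n \<omega>)"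
  let ?\<Delta> = "\<lambda>\<omega>. level (H (G n \<omega>)) n\<^sub>2 \<omega> - level (H (G n \<omega>)) n \<omega>"
  let ?u = "exp (\<eta> * x - \<eta>\<^sup>2 / 2 * Avar f x)"
  let ?l = "exp (- \<eta> * (r - \<epsilon> * a) - 2 * \<eta>\<^sup>2 * Avar f r)"
  have intR: "integrable M (?R \<theta>)" for \<theta>
  proof -
    have "integrable M (\<lambda>\<omega>. (\<lambda>g. tilt \<theta> (indegree g (H (restrict_network n g))) / tilt \<theta> (indegree (restrict_network n g) (H (restrict_network n g)))) (G n\<^sub>2 \<omega>))"
      by (rule integrable_G[OF n2])
    then show ?thesis
      by (rule Bochner_Integration.integrable_cong[THEN iffD1, rotated 2]) (auto simp: G_restrict[OF n, symmetric])
  qed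
  have up: "?u \<le> ?R \<eta> \<omega>" if \<omega>: "\<omega> \<in> space M" "x \<le> ?\<Delta> \<omega>" for \<omega>
  proof -
    let ?d = "?\<Delta> \<omega>"
    have le: "D (H (G n \<omega>)) n \<omega> \<le> D (H (G n \<omega>)) n\<^sub>2 \<omega>" using D_mono[OF n \<omega>(1)] .
    have "Avar f ?d - Avar f x \<le> (?d - x) / f 0" using Avar_diff_le_linear[OF x0 \<omega>(2)] .
    then have "Avar f (level (H (G n \<omega>)) n\<^sub>2 \<omega>) - Avar f (level (H (G n \<omega>)) n \<omega>) \<le> Avar f x + (?d - x) / f 0"
      using Avar_Phi_diff_le[OF le] by linarith
    then have 1: "\<eta>\<^sup>2 / 2 * (Avar f (level (H (G n \<omega>)) n\<^sub>2 \<omega>) - Avar f (level (H (G n \<omega>)) n \<omega>))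
        \<le> \<eta>\<^sup>2 / 2 * (Avar f x + (?d - x) / f 0)" by (intro mult_left_mono) auto
    have "\<eta> * (\<eta> / (2 * f 0)) \<le> \<eta> * 1" using \<eta> f_pos[of 0] by (intro mult_left_mono) (auto simp: field_simps)
    then have "\<eta>\<^sup>2 / 2 / f 0 * (?d - x) \<le> \<eta> * (?d - x)"
      using \<omega>(2) by (intro mult_right_mono) (auto simp: power2_eq_square)
    moreover have "\<eta>\<^sup>2 / 2 * (Avar f x + (?d - x) / f 0) = \<eta>\<^sup>2 / 2 * Avar f x + \<eta>\<^sup>2 / 2 / f 0 * (?d - x)"
      by (simp add: distrib_left)
    moreover have "\<eta> * (?d - x) = \<eta> * ?d - \<eta> * x" by (rule right_diff_distrib)
    ultimately have 2: "\<eta>\<^sup>2 / 2 * (Avar f x + (?d - x) / f 0) \<le> \<eta>\<^sup>2 / 2 * Avar f x + \<eta> * ?d - \<eta> * x"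
      by linarith
    have "?u \<le> exp (\<eta> * ?d - \<eta>\<^sup>2 / 2 * (Avar f (level (H (G n \<omega>)) n\<^sub>2 \<omega>) - Avar f (level (H (G n \<omega>)) n \<omega>)))"
      using 1 2 by (intro exp_mono) linarith
    also have "\<dots> \<le> ?R \<eta> \<omega>" using \<eta> le by (intro tilt_quotient_ge_pos) auto
    finally show ?thesis .
  qed
  have lo: "?l \<le> ?R (- \<eta>) \<omega>" if \<omega>: "\<omega> \<in> space M" "?\<Delta> \<omega> \<le> r - \<epsilon> * a" for \<omega>
  proof -
    let ?d = "?\<Delta> \<omega>"
    have le: "D (H (G n \<omega>)) n \<omega> \<le> D (H (G n \<omega>)) n\<^sub>2 \<omega>" using D_mono[OF n \<omega>(1)] .
    have d0: "0 \<le> ?d" using level_mono[OF n \<omega>(1)] by simp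
    have "0 \<le> \<epsilon> * a" using \<epsilon> a0 by simp
    then have "Avar f ?d \<le> Avar f r" using \<omega>(2) d0 by (intro Avar_mono) auto
    then have 1: "2 * \<eta>\<^sup>2 * (Avar f (level (H (G n \<omega>)) n\<^sub>2 \<omega>) - Avar f (level (H (G n \<omega>)) n \<omega>)) \<le> 2 * \<eta>\<^sup>2 * Avar f r"
      using Avar_Phi_diff_le[OF le] by (intro mult_left_mono) auto
    have "\<eta> * ?d \<le> \<eta> * (r - \<epsilon> * a)" using \<omega>(2) \<eta> by (intro mult_left_mono) auto
    then have "?l \<le> exp (- \<eta> * ?d - 2 * \<eta>\<^sup>2 * (Avar f (level (H (G n \<omega>)) n\<^sub>2 \<omega>) - Avar f (level (H (G n \<omega>)) n \<omega>)))"
      using 1 by (intro exp_mono) simp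
    also have "\<dots> \<le> ?R (- \<eta>) \<omega>" using \<eta> le by (intro tilt_quotient_ge_neg) auto
    finally show ?thesis .
  qed
  let ?A = "{\<omega> \<in> space M. \<epsilon> * a \<le> \<bar>?\<Delta> \<omega> - r\<bar>}"
  have A: "?A = {\<omega> \<in> space M. \<epsilon> * a \<le> \<bar>Phi f (real (indegree (G n\<^sub>2 \<omega>) (H (restrict_network n (G n\<^sub>2 \<omega>)))))
      - Phi f (real (indegree (restrict_network n (G n\<^sub>2 \<omega>)) (H (restrict_network n (G n\<^sub>2 \<omega>))))) - r\<bar>}"
    using G_restrict[OF n] by auto
  have Aev: "?A \<in> events" unfolding A by (rule sets_G[OF n2])
  have R0: "0 \<le> ?R \<eta> \<omega>" "0 \<le> ?R (- \<eta>) \<omega>" for \<omega> using posp posm by (auto simp: less_imp_le)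
  have "prob ?A = expectation (indicator ?A)" using Aev by simp
  also have "\<dots> \<le> expectation (\<lambda>\<omega>. ?R \<eta> \<omega> / ?u + ?R (- \<eta>) \<omega> / ?l)"
  proof (rule integral_mono)
    show "integrable M (indicator ?A :: _ \<Rightarrow> real)" using Aev by (simp add: integrable_indicator_iff emeasure_eq_measure)
    show "integrable M (\<lambda>\<omega>. ?R \<eta> \<omega> / ?u + ?R (- \<eta>) \<omega> / ?l)"
      by (intro Bochner_Integration.integrable_add integrable_divide intR)
    fix \<omega> assume \<omega>: "\<omega> \<in> space M"
    show "indicator ?A \<omega> \<le> ?R \<eta> \<omega> / ?u + ?R (- \<eta>) \<omega> / ?l"
    proof (cases "\<omega> \<in> ?A")
      case True
      then consider "x \<le> ?\<Delta> \<omega>" | "?\<Delta> \<omega> \<le> r - \<epsilon> * a" by (auto simp: x_def abs_real_def split: if_splits)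
      then show ?thesis
      proof cases
        case 1
        have "?u / ?u \<le> ?R \<eta> \<omega> / ?u" by (intro divide_right_mono up \<omega> 1) simp
        then have "1 \<le> ?R \<eta> \<omega> / ?u" by (simp only: divide_self exp_not_eq_zero not_False_eq_True)
        moreover have "0 \<le> ?R (- \<eta>) \<omega> / ?l" by (rule divide_nonneg_pos[OF R0(2) exp_gt_zero])
        ultimately show ?thesis using True by simp
      next
        case 2
        have "?l / ?l \<le> ?R (- \<eta>) \<omega> / ?l" by (intro divide_right_mono lo \<omega> 2) simp
        then have "1 \<le> ?R (- \<eta>) \<omega> / ?l" by (simp only: divide_self exp_not_eq_zero not_False_eq_True)
        moreover have "0 \<le> ?R \<eta> \<omega> / ?u" by (rule divide_nonneg_pos[OF R0(1) exp_gt_zero])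
        ultimately show ?thesis using True by simp
      qed
    next
      case False
      have "0 \<le> ?R (- \<eta>) \<omega> / ?l" by (rule divide_nonneg_pos[OF R0(2) exp_gt_zero])
      moreover have "0 \<le> ?R \<eta> \<omega> / ?u" by (rule divide_nonneg_pos[OF R0(1) exp_gt_zero])
      ultimately have "0 \<le> ?R \<eta> \<omega> / ?u + ?R (- \<eta>) \<omega> / ?l" by (intro add_nonneg_nonneg)
      then show ?thesis using False by simp
    qed
  qed
  also have "\<dots> = expectation (?R \<eta>) / ?u + expectation (?R (- \<eta>)) / ?l"
  proof -
    have "expectation (\<lambda>\<omega>. X \<omega> / u + Y \<omega> / l) = expectation X / u + expectation Y / l"
      if "integrable M X" "integrable M Y" for X Y and u l :: real
      using that by simp
    then show ?thesis using intR by blast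
  qed
  also have "\<dots> \<le> exp (\<eta> * r) / ?u + exp (- \<eta> * r) / ?l"
    unfolding r_def using \<eta> f_pos[of 0]
    by (intro add_mono divide_right_mono expectation_tilt_selected[where H = H, OF n H]) auto
  also have "\<dots> \<le> exp (- \<eta> * \<epsilon> / 2 * a) + exp (- \<eta> * \<epsilon> / 2 * a)"
  proof (rule add_mono)
    have key: "\<eta>\<^sup>2 * (real N * a) \<le> \<eta> * \<epsilon> / 4 * a"
    proof -
      have "\<eta> * real N * (\<eta> * a) \<le> \<epsilon> / 4 * (\<eta> * a)" using \<eta>N \<eta> a0 by (intro mult_right_mono) auto
      then show ?thesis by (simp add: power2_eq_square algebra_simps)
    qed
    have "\<eta>\<^sup>2 * Avar f x \<le> \<eta>\<^sup>2 * (real N * a)" using Ax by (intro mult_left_mono) auto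
    then have k1: "\<eta>\<^sup>2 * Avar f x \<le> \<eta> * \<epsilon> / 4 * a" using key by simp
    have "\<eta>\<^sup>2 * Avar f r \<le> \<eta>\<^sup>2 * (real N * a)" using Ar by (intro mult_left_mono) auto
    then have k2: "\<eta>\<^sup>2 * Avar f r \<le> \<eta> * \<epsilon> / 4 * a" using key by simp
    have nn: "0 \<le> \<eta> * \<epsilon> * a" using \<eta> \<epsilon> a0 by simp
    show "exp (\<eta> * r) / ?u \<le> exp (- \<eta> * \<epsilon> / 2 * a)"
      unfolding exp_diff[symmetric] using k1 nn by (intro exp_mono) (simp add: x_def algebra_simps)
    show "exp (- \<eta> * r) / ?l \<le> exp (- \<eta> * \<epsilon> / 2 * a)"
      unfolding exp_diff[symmetric] using k2 nn by (intro exp_mono) (simp add: algebra_simps)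
  qed
  finally show ?thesis by (simp add: a_def r_def)
qed

end

section \<open>The hub\<close>

locale hub_network = rv_network f \<alpha> M G for f \<alpha> and M :: "'w measure" and G +
  fixes S :: "real \<Rightarrow> 'w \<Rightarrow> real"
  assumes hub: "hub_index M f G S"
begin

definition hub_label :: "real \<Rightarrow> 'w \<Rightarrow> nat" where
  "hub_label t \<omega> = label (S t \<omega>)"

text \<open>The tie-breaking rule makes the hub a function of the current network.\<close>

definition hub_select :: "real \<Rightarrow> network \<Rightarrow> nat" where
  "hub_select t g = label (S t (SOME \<omega>. \<omega> \<in> space M \<and> G (clock t) \<omega> = g))"

context
  fixes t :: real and \<omega> :: 'w
  assumes t: "0 \<le> t" and \<omega>: "\<omega> \<in> space M"
begin

lemma hub_facts:
  "hub_label t \<omega> \<in> {1..clock t}" "S t \<omega> = Psi (hub_label t \<omega>)"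
  "m \<in> {1..clock t} \<Longrightarrow> level m (clock t) \<omega> \<le> level (hub_label t \<omega>) (clock t) \<omega>"
proof -
  have "S t \<omega> \<in> hubs f (\<lambda>n. G n \<omega>) t" using hub t \<omega> unfolding hub_index_def by blast
  then obtain m' where m': "m' \<in> {1..clock t}"
    and m'2: "S t \<omega> = Psi m' \<and> (\<forall>m\<in>{1..clock t}. level m (clock t) \<omega> \<le> level m' (clock t) \<omega>)"
    unfolding hubs_iff[OF t] by (rule bexE)
  have "hub_label t \<omega> = m'" using m' m'2 by (simp add: hub_label_def)
  with m' m'2 show "hub_label t \<omega> \<in> {1..clock t}" "S t \<omega> = Psi (hub_label t \<omega>)"
    "m \<in> {1..clock t} \<Longrightarrow> level m (clock t) \<omega> \<le> level (hub_label t \<omega>) (clock t) \<omega>" by auto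
qed

lemma hub_select_eq: "hub_select t (G (clock t) \<omega>) = hub_label t \<omega>"
proof -
  let ?\<omega>' = "SOME \<omega>'. \<omega>' \<in> space M \<and> G (clock t) \<omega>' = G (clock t) \<omega>"
  have "?\<omega>' \<in> space M \<and> G (clock t) ?\<omega>' = G (clock t) \<omega>"
    by (rule someI[of _ \<omega>]) (simp add: \<omega>)
  then have "S t ?\<omega>' = S t \<omega>" using hub t \<omega> unfolding hub_index_def clock_def by blast
  then show ?thesis by (simp add: hub_select_def hub_label_def)
qed

end

text \<open>All events of interest are determined by the network at one sufficiently late time, because every
  network contains the earlier ones.\<close>

lemma sets_hub:
  assumes "0 \<le> t" "clock t \<le> N"
  shows "{\<omega> \<in> space M. Q (S t \<omega>) (G N \<omega>)} \<in> events"
proof -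
  have N: "1 \<le> N" using clock_ge_1[OF assms(1)] assms(2) by simp
  have "S t \<omega> = Psi (hub_select t (restrict_network (clock t) (G N \<omega>)))" if "\<omega> \<in> space M" for \<omega>
    using hub_facts(2)[OF assms(1) that] hub_select_eq[OF assms(1) that]
      G_restrict[OF clock_ge_1[OF assms(1)] assms(2) that] by simp
  then have "{\<omega> \<in> space M. Q (S t \<omega>) (G N \<omega>)} =
      {\<omega> \<in> space M. Q (Psi (hub_select t (restrict_network (clock t) (G N \<omega>)))) (G N \<omega>)}" by auto
  also have "\<dots> \<in> events" by (rule sets_G[OF N])
  finally show ?thesis .
qed

text \<open>Outside of the following four events, the hub has the asserted birth time, level and path. The
  past and the future are inspected only at times that differ from \<open>t\<close> by integers; between them
  levels are monotone, and the errors of size \<open>1\<close> are negligible.\<close>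

definition too_large :: "real \<Rightarrow> real \<Rightarrow> 'w set" where
  "too_large \<delta> t = {\<omega> \<in> space M. \<exists>m\<in>{1..clock t}. t + (1 / 2 + \<delta>) * Avar f t \<le> level m (clock t) \<omega>}"

definition none_large :: "real \<Rightarrow> real \<Rightarrow> 'w set" where
  "none_large \<delta> t = {\<omega> \<in> space M. \<forall>m\<in>{1..clock t}. level m (clock t) \<omega> < t + (1 / 2 - \<delta>) * Avar f t}"

definition unusual_past :: "real \<Rightarrow> real \<Rightarrow> real \<Rightarrow> 'w set" where
  "unusual_past \<epsilon> \<delta> t = {\<omega> \<in> space M. \<exists>j\<in>{0..nat \<lfloor>t\<rfloor>}. \<exists>m\<in>{1..clock (t - real j)}.
    far \<epsilon> t m (clock (t - real j)) (D m (clock (t - real j)) \<omega>) \<and> t + (1 / 2 - \<delta>) * Avar f t \<le> level m (clock t) \<omega>}"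

text \<open>The number of mesh points after \<open>t\<close> that are needed to cover \<open>S t + t * u\<close> for \<open>u \<le> U\<close>, as \<open>S t \<le> t\<close>.\<close>

definition horizon :: "real \<Rightarrow> real \<Rightarrow> nat" where
  "horizon U t = nat \<lceil>U * t\<rceil> + 1"

definition unusual_future :: "real \<Rightarrow> real \<Rightarrow> real \<Rightarrow> 'w set" where
  "unusual_future \<epsilon> U t = {\<omega> \<in> space M. \<exists>j\<in>{0..horizon U t}.
    \<epsilon> * Avar f t \<le> \<bar>level (hub_label t \<omega>) (clock (t + real j)) \<omega> - level (hub_label t \<omega>) (clock t) \<omega>
      - (Psi (clock (t + real j)) - Psi (clock t))\<bar>}"

lemma exp_minus_Psi_le: "1 \<le> m \<Longrightarrow> exp (- Psi m) \<le> 1 / real m"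
proof -
  assume m: "1 \<le> m"
  have "exp (- Psi m) \<le> exp (- ln (real m))" using ln_le_Psi[OF m] by simp
  also have "\<dots> = 1 / real m" using m by (simp add: exp_minus inverse_eq_divide)
  finally show ?thesis .
qed

lemma sum_exp_minus_Psi_le: "0 \<le> t \<Longrightarrow> (\<Sum>m=1..clock t. exp (- Psi m)) \<le> t + 1"
  by (rule order_trans[OF sum_mono sum_inverse_le_clock]) (auto intro: exp_minus_Psi_le)

text \<open>Summed over the vertices and the mesh, the Chernoff bounds lose at most a factor quadratic in
  \<open>t\<close>, which is harmless because \<open>ln t\<close> is negligible compared with \<open>Avar f t\<close>.\<close>

lemma poly_decay:
  assumes "0 < c"
  shows "((\<lambda>t. (t + 1)\<^sup>2 * exp (- c * Avar f t)) \<longlongrightarrow> 0) at_top"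
proof -
  have "filterlim (\<lambda>t. c / 2 * Avar f t) at_top at_top"
    using assms by (intro filterlim_tendsto_pos_mult_at_top[OF tendsto_const _ Avar_at_top]) auto
  then have "((\<lambda>t. exp (- (c / 2 * Avar f t))) \<longlongrightarrow> 0) at_top"
    by (intro filterlim_compose[OF exp_at_bot]) (simp add: filterlim_uminus_at_top)
  then have lim: "((\<lambda>t. 4 * exp (- (c / 2 * Avar f t))) \<longlongrightarrow> 0) at_top"
    using tendsto_mult[OF tendsto_const, of _ 0 at_top 4] by fastforce
  show ?thesis
  proof (rule tendsto_sandwich[OF _ _ tendsto_const lim])
    have "\<forall>\<^sub>F t in at_top. ln t \<le> c / 4 * Avar f t" using assms by (intro ln_le_Avar) auto
    then show "\<forall>\<^sub>F t in at_top. (t + 1)\<^sup>2 * exp (- c * Avar f t) \<le> 4 * exp (- (c / 2 * Avar f t))"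
      using eventually_ge_at_top[of 1]
    proof eventually_elim
      case (elim t)
      have "t = exp (ln t)" using elim by simp
      also have "\<dots> \<le> exp (c / 4 * Avar f t)" using elim(1) by (rule exp_mono)
      finally have "t\<^sup>2 \<le> (exp (c / 4 * Avar f t))\<^sup>2" using elim by (intro power_mono) auto
      also have "\<dots> = exp (c / 2 * Avar f t)" by (simp add: power2_eq_square exp_add[symmetric])
      finally have "t\<^sup>2 \<le> exp (c / 2 * Avar f t)" .
      moreover have "(t + 1)\<^sup>2 \<le> (2 * t)\<^sup>2" using elim by (intro power_mono) auto
      ultimately have "(t + 1)\<^sup>2 \<le> 4 * exp (c / 2 * Avar f t)" by (simp add: power_mult_distrib)
      then have "(t + 1)\<^sup>2 * exp (- c * Avar f t) \<le> 4 * exp (c / 2 * Avar f t) * exp (- c * Avar f t)"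
        by (intro mult_right_mono) auto
      also have "\<dots> = 4 * exp (- (c / 2 * Avar f t))" by (simp add: exp_add[symmetric])
      finally show ?case .
    qed
  qed auto
qed

lemma tendsto_0_poly_decay:
  assumes c: "0 < c" and le: "\<forall>\<^sub>F t in at_top. prob (X t) \<le> C * ((t + 1)\<^sup>2 * exp (- c * Avar f t))"
  shows "((\<lambda>t. prob (X t)) \<longlongrightarrow> 0) at_top"
proof (rule tendsto_sandwich[OF _ le tendsto_const])
  show "((\<lambda>t. C * ((t + 1)\<^sup>2 * exp (- c * Avar f t))) \<longlongrightarrow> 0) at_top"
    using tendsto_mult[OF tendsto_const poly_decay[OF c], of C] by simp
qed auto

lemma too_large_null:
  assumes \<delta>: "0 < \<delta>" "\<delta> \<le> 1 / 2"
  shows "((\<lambda>t. prob (too_large \<delta> t)) \<longlongrightarrow> 0) at_top"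
proof (rule tendsto_0_poly_decay[of "\<delta> / 2" _ 1])
  have "\<forall>\<^sub>F t in at_top. regime (2 + 1 / f 0) (\<delta> / 2) t"
    using \<delta> f_pos[of 0] by (intro eventually_regime) auto
  then show "\<forall>\<^sub>F t in at_top. prob (too_large \<delta> t) \<le> 1 * ((t + 1)\<^sup>2 * exp (- (\<delta> / 2) * Avar f t))"
  proof eventually_elim
    case (elim t)
    note R = elim
    have t: "1 \<le> t" "0 \<le> t" using regimeD(1)[OF R] by auto
    let ?n = "clock t"
    have n1: "1 \<le> ?n" using clock_ge_1 t by simp
    let ?E = "\<lambda>m. {\<omega> \<in> space M. t + (1 / 2 + \<delta>) * Avar f t \<le> level m ?n \<omega>}"
    have "too_large \<delta> t = (\<Union>m\<in>{1..?n}. ?E m)" by (auto simp: too_large_def)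
    then have "prob (too_large \<delta> t) \<le> (\<Sum>m=1..?n. prob (?E m))"
      using sets_G[OF n1] by (auto intro!: finite_measure_subadditive_finite)
    also have "\<dots> \<le> (\<Sum>m=1..?n. exp (- Psi m) * exp (- (\<delta> / 2) * Avar f t))"
    proof (rule sum_mono)
      fix m assume m: "m \<in> {1..?n}"
      have "prob (?E m) \<le> exp (- Psi m - (\<delta> - \<delta> / 2) * Avar f t)"
        using m \<delta> Psi_clock_le[OF t(2)] by (intro prob_too_large[OF R]) auto
      then show "prob (?E m) \<le> exp (- Psi m) * exp (- (\<delta> / 2) * Avar f t)"
        by (simp add: exp_add[symmetric])
    qed
    also have "\<dots> = (\<Sum>m=1..?n. exp (- Psi m)) * exp (- (\<delta> / 2) * Avar f t)"
      by (simp add: sum_distrib_right)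
    also have "\<dots> \<le> (t + 1)\<^sup>2 * exp (- (\<delta> / 2) * Avar f t)"
      using sum_exp_minus_Psi_le[OF t(2)] t by (intro mult_right_mono) (auto simp: power2_eq_square intro: order_trans)
    finally show ?case by simp
  qed
qed (use \<delta> in auto)

lemma none_large_null:
  assumes \<delta>: "0 < \<delta>" "\<delta> \<le> 1 / 2"
  shows "((\<lambda>t. prob (none_large \<delta> t)) \<longlongrightarrow> 0) at_top"
proof -
  define \<eta> where "\<eta> = \<delta> / 4"
  define \<gamma> where "\<gamma> = \<eta>\<^sup>2 / 12"
  have \<eta>: "0 < \<eta>" "\<eta> \<le> 1 / 8" using \<delta> by (auto simp: \<eta>_def)
  have "\<eta>\<^sup>2 \<le> \<eta> * (1 / 8)" using \<eta> unfolding power2_eq_square by (intro mult_left_mono) auto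
  then have \<gamma>: "0 < \<gamma>" "\<gamma> \<le> 1 / 8" "3 * \<gamma> \<le> \<eta>\<^sup>2 / 4" "0 < \<eta> - 2 * \<gamma>" using \<eta> by (auto simp: \<gamma>_def)
  show ?thesis
  proof (rule tendsto_0_poly_decay[of "\<eta> - 2 * \<gamma>" _ "exp 2"])
    have "\<forall>\<^sub>F t in at_top. regime (4 + 1 / f 0) \<gamma> t"
      using \<gamma> f_pos[of 0] by (intro eventually_regime) auto
    moreover have "\<forall>\<^sub>F t in at_top. 3 \<le> \<eta>\<^sup>2 / 4 * Avar f t"
      using \<eta> by (intro eventually_le_Avar) auto
    ultimately show "\<forall>\<^sub>F t in at_top. prob (none_large \<delta> t) \<le> exp 2 * ((t + 1)\<^sup>2 * exp (- (\<eta> - 2 * \<gamma>) * Avar f t))"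
    proof eventually_elim
      case (elim t)
      have t: "1 \<le> t" using regimeD(1)[OF elim(1)] .
      have "4 * \<eta> = \<delta>" by (simp add: \<eta>_def)
      then have "prob (none_large \<delta> t) \<le> exp (- exp ((\<eta> - 2 * \<gamma>) * Avar f t - 2))"
        using prob_none_large[OF elim(1) order_refl \<gamma>(1,2) \<eta>(1) _ \<gamma>(3) elim(2)] \<eta> by (simp add: none_large_def)
      also have "\<dots> \<le> exp (- ((\<eta> - 2 * \<gamma>) * Avar f t - 2))"
        using exp_ge_add_one_self[of "(\<eta> - 2 * \<gamma>) * Avar f t - 2"] by (intro exp_mono) linarith
      also have "\<dots> = exp 2 * (1 * exp (- (\<eta> - 2 * \<gamma>) * Avar f t))" by (simp add: exp_add[symmetric] algebra_simps)
      also have "\<dots> \<le> exp 2 * ((t + 1)\<^sup>2 * exp (- (\<eta> - 2 * \<gamma>) * Avar f t))"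
        using t by (intro mult_left_mono mult_right_mono) (auto intro: one_le_power)
      finally show ?case .
    qed
  qed (use \<gamma> in auto)
qed

lemma unusual_past_null:
  assumes \<epsilon>: "0 < \<epsilon>" "\<epsilon> \<le> 1"
  shows "((\<lambda>t. prob (unusual_past \<epsilon> (\<epsilon>\<^sup>2 / 8) t)) \<longlongrightarrow> 0) at_top"
proof (rule tendsto_0_poly_decay[of "\<epsilon>\<^sup>2 / 4" _ 2])
  let ?\<gamma> = "\<epsilon>\<^sup>2 / 32"
  have e2: "0 < \<epsilon>\<^sup>2" "\<epsilon>\<^sup>2 \<le> 1" using \<epsilon> by (auto simp: power_le_one)
  have "\<forall>\<^sub>F t in at_top. regime (2 + 1 / f 0) ?\<gamma> t"
    using \<epsilon> f_pos[of 0] by (intro eventually_regime) auto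
  then show "\<forall>\<^sub>F t in at_top. prob (unusual_past \<epsilon> (\<epsilon>\<^sup>2 / 8) t) \<le> 2 * ((t + 1)\<^sup>2 * exp (- (\<epsilon>\<^sup>2 / 4) * Avar f t))"
  proof eventually_elim
    case (elim t)
    note R = elim
    have t: "1 \<le> t" "0 \<le> t" using regimeD(1)[OF R] by auto
    let ?n = "clock t"
    have n1: "1 \<le> ?n" using clock_ge_1 t by simp
    let ?q = "exp (- (\<epsilon>\<^sup>2 / 4) * Avar f t)"
    let ?E = "\<lambda>j m. {\<omega> \<in> space M. far \<epsilon> t m (clock (t - real j)) (D m (clock (t - real j)) \<omega>) \<and>
      t + (1 / 2 - \<epsilon>\<^sup>2 / 8) * Avar f t \<le> level m ?n \<omega>}"
    let ?F = "\<lambda>j. \<Union>m\<in>{1..clock (t - real j)}. ?E j m"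
    have tj: "0 \<le> t - real j" "1 \<le> clock (t - real j)" "clock (t - real j) \<le> ?n" if "j \<in> {0..nat \<lfloor>t\<rfloor>}" for j
    proof -
      show "0 \<le> t - real j" using that t by (auto simp: le_nat_iff le_floor_iff)
      then show "1 \<le> clock (t - real j)" "clock (t - real j) \<le> ?n" 
        using clock_ge_1[of "t - real j"] clock_mono[of "t - real j" t] by auto
    qed
    have E: "?E j m \<in> events" if "j \<in> {0..nat \<lfloor>t\<rfloor>}" for j m
    proof -
      have "?E j m = {\<omega> \<in> space M. far \<epsilon> t m (clock (t - real j)) (D m (clock (t - real j)) \<omega>)}
          \<inter> {\<omega> \<in> space M. t + (1 / 2 - \<epsilon>\<^sup>2 / 8) * Avar f t \<le> level m ?n \<omega>}" by auto
      then show ?thesis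
        using sets_G[OF tj(2)[OF that], of "\<lambda>g. far \<epsilon> t m (clock (t - real j)) (indegree g m)"]
          sets_G[OF n1, of "\<lambda>g. t + (1 / 2 - \<epsilon>\<^sup>2 / 8) * Avar f t \<le> Phi f (real (indegree g m))"] by auto
    qed
    have "unusual_past \<epsilon> (\<epsilon>\<^sup>2 / 8) t = (\<Union>j\<in>{0..nat \<lfloor>t\<rfloor>}. ?F j)" by (auto simp: unusual_past_def)
    then have "prob (unusual_past \<epsilon> (\<epsilon>\<^sup>2 / 8) t) \<le> (\<Sum>j\<in>{0..nat \<lfloor>t\<rfloor>}. prob (?F j))"
      using E by (auto intro!: finite_measure_subadditive_finite)
    also have "\<dots> \<le> (\<Sum>j\<in>{0..nat \<lfloor>t\<rfloor>}. (t + 1) * (2 * ?q))"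
    proof (rule sum_mono)
      fix j assume j: "j \<in> {0..nat \<lfloor>t\<rfloor>}"
      have "prob (?F j) \<le> (\<Sum>m=1..clock (t - real j). prob (?E j m))"
        using E[OF j] by (intro finite_measure_subadditive_finite) auto
      also have "\<dots> \<le> (\<Sum>m=1..clock (t - real j). exp (- Psi m) * (2 * ?q))"
      proof (rule sum_mono)
        fix m assume m: "m \<in> {1..clock (t - real j)}"
        have "prob (?E j m) \<le> 2 * exp (- Psi m - (\<epsilon>\<^sup>2 / 2 - \<epsilon>\<^sup>2 / 8 - 4 * ?\<gamma>) * Avar f t)"
          using m tj[OF j] \<epsilon> e2 Psi_clock_le[OF t(2)]
          by (intro prob_far_and_large[OF R order_refl]) auto
        also have "\<epsilon>\<^sup>2 / 2 - \<epsilon>\<^sup>2 / 8 - 4 * ?\<gamma> = \<epsilon>\<^sup>2 / 4" by simp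
        finally show "prob (?E j m) \<le> exp (- Psi m) * (2 * ?q)"
          using exp_add[of "- Psi m" "- (\<epsilon>\<^sup>2 / 4) * Avar f t"] by simp
      qed
      also have "\<dots> = (\<Sum>m=1..clock (t - real j). exp (- Psi m)) * (2 * ?q)"
        by (simp only: sum_distrib_right)
      also have "\<dots> \<le> (t + 1) * (2 * ?q)"
        using sum_exp_minus_Psi_le[OF tj(1)[OF j]] by (intro mult_right_mono) auto
      finally show "prob (?F j) \<le> (t + 1) * (2 * ?q)" .
    qed
    also have "\<dots> = real (nat \<lfloor>t\<rfloor> + 1) * ((t + 1) * (2 * ?q))" by simp
    also have "\<dots> \<le> (t + 1) * ((t + 1) * (2 * ?q))"
    proof (rule mult_right_mono)
      show "real (nat \<lfloor>t\<rfloor> + 1) \<le> t + 1" using t by simp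
    qed (use t in auto)
    finally show ?case by (simp add: power2_eq_square algebra_simps)
  qed
qed (use \<epsilon> in auto)

lemma unusual_future_null:
  assumes \<epsilon>: "0 < \<epsilon>" "\<epsilon> \<le> 1" and U: "0 \<le> U"
  shows "((\<lambda>t. prob (unusual_future \<epsilon> U t)) \<longlongrightarrow> 0) at_top"
    and "\<forall>\<^sub>F t in at_top. unusual_future \<epsilon> U t \<in> events"
proof -
  define N where "N = nat \<lceil>U\<rceil> + 5"
  define \<eta> where "\<eta> = min (\<epsilon> / (4 * real N)) (min (f 0 / 2) (1 / 2))"
  have N: "1 \<le> N" "U + 5 \<le> real N" unfolding N_def by linarith+
  have \<eta>: "0 < \<eta>" "\<eta> \<le> \<epsilon> / (4 * real N)" "\<eta> \<le> f 0 / 2" "\<eta> \<le> 1 / 2"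
    using \<epsilon> N f_pos[of 0] by (auto simp: \<eta>_def)
  let ?E = "\<lambda>t j. {\<omega> \<in> space M. \<epsilon> * Avar f t \<le> \<bar>level (hub_label t \<omega>) (clock (t + real j)) \<omega>
    - level (hub_label t \<omega>) (clock t) \<omega> - (Psi (clock (t + real j)) - Psi (clock t))\<bar>}"
  have UE: "unusual_future \<epsilon> U t = (\<Union>j\<in>{0..horizon U t}. ?E t j)" for t by (auto simp: unusual_future_def)
  have E: "?E t j \<in> events" if t: "0 \<le> t" for t j
  proof -
    let ?n = "clock t" and ?n2 = "clock (t + real j)"
    have n: "1 \<le> ?n" "?n \<le> ?n2" using t clock_ge_1 clock_mono by auto
    have "?E t j = {\<omega> \<in> space M. \<epsilon> * Avar f t \<le> \<bar>Phi f (real (indegree (G ?n2 \<omega>) (label (S t \<omega>))))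
      - Phi f (real (indegree (restrict_network ?n (G ?n2 \<omega>)) (label (S t \<omega>)))) - (Psi ?n2 - Psi ?n)\<bar>}"
      using G_restrict[OF n] by (auto simp: hub_label_def)
    also have "\<dots> \<in> events" by (rule sets_hub[OF t n(2)])
    finally show ?thesis .
  qed
  show "\<forall>\<^sub>F t in at_top. unusual_future \<epsilon> U t \<in> events"
    using eventually_ge_at_top[of 0] by eventually_elim (use E in \<open>auto simp: UE\<close>)
  show "((\<lambda>t. prob (unusual_future \<epsilon> U t)) \<longlongrightarrow> 0) at_top"
  proof (rule tendsto_0_poly_decay[of "\<eta> * \<epsilon> / 2" _ "2 * (U + 3)"])
    have "\<forall>\<^sub>F t in at_top. Avar f t \<le> 1 * t" by (intro Avar_le_eps) simp
    then show "\<forall>\<^sub>F t in at_top. prob (unusual_future \<epsilon> U t) \<le> 2 * (U + 3) * ((t + 1)\<^sup>2 * exp (- (\<eta> * \<epsilon> / 2) * Avar f t))"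
      using eventually_ge_at_top[of 1]
    proof eventually_elim
      case (elim t)
      have t: "1 \<le> t" "0 \<le> t" "0 < t" using elim by auto
      let ?n = "clock t"
      have n1: "1 \<le> ?n" using clock_ge_1 t by simp
      let ?q = "exp (- \<eta> * \<epsilon> / 2 * Avar f t)"
      have h: "real (horizon U t) \<le> U * t + 2"
        using U t by (simp add: horizon_def) linarith
      have "prob (unusual_future \<epsilon> U t) \<le> (\<Sum>j\<in>{0..horizon U t}. prob (?E t j))"
        unfolding UE using E[OF t(2)] by (intro finite_measure_subadditive_finite) auto
      also have "\<dots> \<le> (\<Sum>j\<in>{0..horizon U t}. 2 * ?q)"
      proof (rule sum_mono)
        fix j assume j: "j \<in> {0..horizon U t}"
        let ?n2 = "clock (t + real j)"
        have n2: "?n \<le> ?n2" using t by (intro clock_mono) auto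
        have jh: "real j \<le> U * t + 2" using j h by auto
        have "Psi ?n2 - Psi ?n + \<epsilon> * Avar f t \<le> real N * t"
        proof -
          have "Psi ?n2 \<le> t + real j" using t by (intro Psi_clock_le) auto
          moreover have "t - 1 < Psi ?n" using t by (intro clock_gt)
          moreover have "\<epsilon> * Avar f t \<le> 1 * t"
            using \<epsilon> elim t Avar_nonneg[of t] by (intro mult_mono) auto
          moreover have "(U + 5) * t \<le> real N * t" using N t by (intro mult_right_mono) auto
          moreover have "(U + 5) * t = U * t + 5 * t" by (simp add: algebra_simps)
          ultimately show ?thesis using jh t by linarith
        qed
        moreover have "\<And>\<omega>. \<omega> \<in> space M \<Longrightarrow> hub_select t (G ?n \<omega>) \<in> {1..?n}"
          using hub_select_eq[OF t(2)] hub_facts(1)[OF t(2)] by simp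
        ultimately have "prob {\<omega> \<in> space M. \<epsilon> * Avar f t \<le> \<bar>level (hub_select t (G ?n \<omega>)) ?n2 \<omega>
            - level (hub_select t (G ?n \<omega>)) ?n \<omega> - (Psi ?n2 - Psi ?n)\<bar>} \<le> 2 * ?q"
          using \<eta> N \<epsilon> t by (intro prob_selected_far[OF n1 n2]) auto
        also have "{\<omega> \<in> space M. \<epsilon> * Avar f t \<le> \<bar>level (hub_select t (G ?n \<omega>)) ?n2 \<omega>
            - level (hub_select t (G ?n \<omega>)) ?n \<omega> - (Psi ?n2 - Psi ?n)\<bar>} = ?E t j"
          using hub_select_eq[OF t(2)] by auto
        finally show "prob (?E t j) \<le> 2 * ?q" .
      qed
      also have "\<dots> = 2 * ?q * (real (horizon U t) + 1)" by simp
      also have "\<dots> \<le> 2 * ?q * ((U + 3) * (t + 1)\<^sup>2)"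
      proof (rule mult_left_mono)
        have "real (horizon U t) + 1 \<le> (U + 3) * (t + 1)" using h U t by (simp add: algebra_simps)
        also have "\<dots> \<le> (U + 3) * (t + 1)\<^sup>2"
          using U t by (intro mult_left_mono) (auto simp: power2_eq_square)
        finally show "real (horizon U t) + 1 \<le> (U + 3) * (t + 1)\<^sup>2" .
      qed auto
      finally show ?case by (simp add: algebra_simps)
    qed
  qed (use \<eta> \<epsilon> in auto)
qed

lemma sets_exceptional:
  assumes "0 \<le> t"
  shows "too_large \<delta> t \<in> events" "none_large \<delta> t \<in> events" "unusual_past \<epsilon> \<delta> t \<in> events"
proof -
  let ?n = "clock t"
  have n1: "1 \<le> ?n" using clock_ge_1 assms by simp
  show "too_large \<delta> t \<in> events"
    unfolding too_large_def using sets_G[OF n1, of "\<lambda>g. \<exists>m\<in>{1..?n}. t + (1 / 2 + \<delta>) * Avar f t \<le> Phi f (real (indegree g m))"] .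
  show "none_large \<delta> t \<in> events"
    unfolding none_large_def using sets_G[OF n1, of "\<lambda>g. \<forall>m\<in>{1..?n}. Phi f (real (indegree g m)) < t + (1 / 2 - \<delta>) * Avar f t"] .
  have tj: "1 \<le> clock (t - real j)" "clock (t - real j) \<le> ?n" if "j \<in> {0..nat \<lfloor>t\<rfloor>}" for j
  proof -
    have "0 \<le> t - real j" using that assms by (auto simp: le_nat_iff le_floor_iff)
    then show "1 \<le> clock (t - real j)" "clock (t - real j) \<le> ?n" 
        using clock_ge_1[of "t - real j"] clock_mono[of "t - real j" t] by auto
  qed
  have "unusual_past \<epsilon> \<delta> t = {\<omega> \<in> space M. \<exists>j\<in>{0..nat \<lfloor>t\<rfloor>}. \<exists>m\<in>{1..clock (t - real j)}.
      far \<epsilon> t m (clock (t - real j)) (indegree (restrict_network (clock (t - real j)) (G ?n \<omega>)) m)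
      \<and> t + (1 / 2 - \<delta>) * Avar f t \<le> level m ?n \<omega>}"
    unfolding unusual_past_def
    by (intro Collect_cong conj_cong bex_cong refl) (simp add: G_restrict[OF tj])
  also have "\<dots> \<in> events" by (rule sets_G[OF n1])
  finally show "unusual_past \<epsilon> \<delta> t \<in> events" .
qed

end

section \<open>The evolution of the hub outside of the exceptional events\<close>

context hub_network
begin

text \<open>The deterministic part. As the hub is large, its past is usual at all mesh points. At time \<open>t\<close> this
  gives \<open>L = t - s + A\<close> up to small errors for its level \<open>L\<close> and its birth time \<open>s\<close>, where
  \<open>A = Avar f t\<close>; comparison with \<open>L = t + A / 2\<close> yields \<open>s = A / 2\<close>.\<close>

lemma hub_evolution:
  assumes \<epsilon>: "0 < \<epsilon>" "\<epsilon> \<le> 1 / 16" and U: "0 \<le> U"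
    and R: "regime B (\<epsilon>\<^sup>2 / 32) t" and B: "4 + Avar f 2 \<le> B"
    and u0: "1 \<le> u\<^sub>0 * t"
    and unif: "\<And>u. u \<in> {0..1} \<Longrightarrow> \<bar>Avar f (u * t) / Avar f t - u powr \<rho>\<bar> \<le> \<epsilon>"
    and \<omega>: "\<omega> \<in> space M" "\<omega> \<notin> too_large (\<epsilon>\<^sup>2 / 8) t" "\<omega> \<notin> none_large (\<epsilon>\<^sup>2 / 8) t"
      "\<omega> \<notin> unusual_past \<epsilon> (\<epsilon>\<^sup>2 / 8) t" "\<omega> \<notin> unusual_future \<epsilon> U t"
  shows "\<bar>S t \<omega> - Avar f t / 2\<bar> \<le> 4 * \<epsilon> * Avar f t"
    and "\<bar>Z f (\<lambda>n. G n \<omega>) (S t \<omega>) t - t - Avar f t / 2\<bar> \<le> \<epsilon> * Avar f t"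
    and "\<And>u. u \<in> {u\<^sub>0..U} \<Longrightarrow>
      \<bar>Z f (\<lambda>n. G n \<omega>) (S t \<omega>) (S t \<omega> + t * u) - t * u - Avar f t * min (u powr \<rho>) 1\<bar> \<le> 8 * \<epsilon> * Avar f t"
proof -
  note rD = regimeD[OF R]
  define a where "a = Avar f t"
  define \<delta> where "\<delta> = \<epsilon>\<^sup>2 / 8"
  define n where "n = clock t"
  define H where "H = hub_label t \<omega>"
  define s where "s = S t \<omega>"
  define L where "L = level H n \<omega>"
  define Zs where "Zs v = Z f (\<lambda>n. G n \<omega>) s v" for v
  have a0: "0 < a" using rD by (simp add: a_def)
  have t: "1 \<le> t" "0 \<le> t" using rD(1) by auto
  have e2: "\<epsilon>\<^sup>2 \<le> \<epsilon>" "0 \<le> \<epsilon>\<^sup>2" using \<epsilon> by (auto simp: power2_eq_square mult_left_le)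
  have \<delta>: "0 \<le> \<delta>" "\<delta> \<le> \<epsilon>" using \<epsilon> e2 by (auto simp: \<delta>_def)
  have \<epsilon>a: "0 < \<epsilon> * a" "16 * (\<epsilon> * a) \<le> a" using \<epsilon> a0 by auto
  have \<delta>a: "0 \<le> \<delta> * a" "\<delta> * a \<le> \<epsilon> * a" using \<delta> a0 by (auto intro: mult_right_mono)
  have ga: "\<epsilon>\<^sup>2 / 32 * a \<le> \<epsilon> * a" using e2 \<epsilon> a0 by (intro mult_right_mono) auto
  have A2: "0 \<le> Avar f 2" "0 \<le> Avar f 1" "Avar f 1 \<le> Avar f 2" by (auto intro: Avar_nonneg Avar_mono)
  have B\<epsilon>: "4 + Avar f 2 \<le> \<epsilon> * a" using B rD(2) ga unfolding a_def by linarith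
  have at: "a \<le> \<epsilon> * t"
  proof -
    have "\<epsilon>\<^sup>2 / 32 * t \<le> \<epsilon> * t" using e2 \<epsilon> t by (intro mult_right_mono) auto
    then show ?thesis using rD(3) by (simp add: a_def)
  qed
  have n1: "1 \<le> n" and Psi_n: "Psi n \<le> t" "t - 1 < Psi n"
    using clock_ge_1[OF t(2)] Psi_clock_le[OF t(2)] clock_gt[OF t(2)] by (auto simp: n_def)
  have H: "H \<in> {1..n}" "s = Psi H" and H_max: "\<And>m. m \<in> {1..n} \<Longrightarrow> level m n \<omega> \<le> L"
    using hub_facts[OF t(2) \<omega>(1)] by (auto simp: H_def s_def n_def L_def)
  have H1: "1 \<le> H" using H by simp
  have s: "0 \<le> s" "s \<le> Psi n" using H Psi_nonneg[of H] Psi_le_iff[of H n] by auto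
  have Zs: "Zs v = level H (clock v) \<omega>" if "s \<le> v" for v
  proof -
    have "0 \<le> v" using that s by simp
    moreover have "H \<le> clock v" using le_clock_iff[OF \<open>0 \<le> v\<close> H1] that H by simp
    ultimately show ?thesis using Z_Psi[OF H1, of v f "\<lambda>n. G n \<omega>"] H(2) by (simp add: Zs_def max_def)
  qed
  have st: "s \<le> t" using s Psi_n by simp
  have Zt: "Zs t = L" using Zs[OF st] by (simp add: L_def n_def)
  have L_up: "L < t + (1 / 2 + \<delta>) * a"
    using \<omega>(1,2) H(1) by (fastforce simp: too_large_def L_def n_def a_def \<delta>_def not_le)
  have L_lo: "t + (1 / 2 - \<delta>) * a \<le> L"
  proof -
    obtain m where "m \<in> {1..n}" "t + (1 / 2 - \<delta>) * a \<le> level m n \<omega>"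
      using \<omega>(1,3) by (auto simp: none_large_def n_def a_def \<delta>_def not_less)
    then show ?thesis using H_max[of m] by simp
  qed
  have L: "\<bar>L - t - a / 2\<bar> \<le> \<epsilon> * a"
    using L_up L_lo \<delta>a by (simp add: algebra_simps abs_le_iff)
  \<comment> \<open>Its past is as usual, at all times of a mesh of width \<open>1\<close>.\<close>
  have past: "\<bar>level H (clock (t - real j)) \<omega> - ((Psi (clock (t - real j)) - s) + Avar f (Psi (clock (t - real j)) - s))\<bar> < \<epsilon> * a"
    if j: "s \<le> t - real j" for j
  proof -
    have "real j \<le> t" using j s by simp
    then have j': "j \<in> {0..nat \<lfloor>t\<rfloor>}" "0 \<le> t - real j" by (auto simp: le_nat_iff le_floor_iff)
    have "H \<in> {1..clock (t - real j)}" using le_clock_iff[OF j'(2) H1] j H by simp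
    then have "\<not> far \<epsilon> t H (clock (t - real j)) (D H (clock (t - real j)) \<omega>)"
      using \<omega>(1,4) j'(1) L_lo unfolding unusual_past_def L_def n_def a_def \<delta>_def by blast
    then show ?thesis by (simp add: far_def H(2) a_def)
  qed
  define r where "r = Psi n - s"
  define V where "V = Avar f r"
  have r: "0 \<le> r" "r \<le> t" using s Psi_n by (auto simp: r_def)
  have V: "0 \<le> V" "V \<le> a" using r by (auto simp: V_def a_def intro: Avar_nonneg Avar_mono)
  have LV: "\<bar>L - (r + V)\<bar> < \<epsilon> * a" using past[of 0] st by (simp add: L_def n_def r_def V_def)
  have half: "(1 / 2 + \<delta>) * a = a / 2 + \<delta> * a" "(1 / 2 - \<delta>) * a = a / 2 - \<delta> * a" by (simp_all add: algebra_simps)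
  have s_up: "s \<le> a / 2 + 2 * (\<epsilon> * a)"
  proof -
    have "L < r + V + \<epsilon> * a" using LV by linarith
    then show ?thesis using L_lo V Psi_n \<delta>a unfolding half r_def by linarith
  qed
  have s_lo: "a / 2 - 4 * (\<epsilon> * a) \<le> s"
  proof -
    have tr: "0 \<le> t - r" "t - r \<le> 1 + a" using r Psi_n s_up \<epsilon>a by (auto simp: r_def)
    have "a \<le> Avar f (r + (t - r))" by (simp add: a_def)
    also have "\<dots> \<le> V + Avar f (t - r)" unfolding V_def using r tr by (intro Avar_subadd)
    also have "Avar f (t - r) \<le> \<epsilon>\<^sup>2 / 32 * a"
      unfolding a_def
    proof (rule rD(6)[OF tr(1)])
      have "1 * a \<le> B * a" using B A2 a0 by (intro mult_right_mono) auto
      then show "t - r \<le> B * Avar f t + B" using tr B A2 unfolding a_def by linarith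
    qed
    finally have aV: "a \<le> V + \<epsilon> * a" using ga by linarith
    have "r + V - \<epsilon> * a < L" using LV by linarith
    then show ?thesis using aV L_up Psi_n \<delta>a B\<epsilon> A2 unfolding half r_def by linarith
  qed
  show "\<bar>S t \<omega> - Avar f t / 2\<bar> \<le> 4 * \<epsilon> * Avar f t"
    using s_up s_lo \<epsilon>a by (simp add: s_def[symmetric] a_def[symmetric] abs_le_iff)
  show "\<bar>Z f (\<lambda>n. G n \<omega>) (S t \<omega>) t - t - Avar f t / 2\<bar> \<le> \<epsilon> * Avar f t"
    using L Zt by (simp add: Zs_def s_def a_def)
  fix u assume u: "u \<in> {u\<^sub>0..U}"
  define x where "x = t * u"
  have "u\<^sub>0 * t \<le> u * t" using u t by (intro mult_right_mono) auto
  then have x1: "1 \<le> x" using u0 by (simp add: x_def mult.commute)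
  have "0 < t * u" using x1 unfolding x_def by linarith
  then have u_pos: "0 < u" using t by (simp add: zero_less_mult_iff)
  define v where "v = s + x"
  have sv: "s \<le> v" using x1 by (simp add: v_def)
  have v0: "0 \<le> v" using sv s by simp
  have "\<bar>Zs v - x - a * min (u powr \<rho>) 1\<bar> \<le> 8 * (\<epsilon> * a)"
  proof (cases "v \<le> t")
    case vt: True
    \<comment> \<open>Before time \<open>t\<close>: interpolate between two points of the mesh.\<close>
    define j where "j = nat \<lfloor>t - v\<rfloor>"
    have j: "real j \<le> t - v" "t - v < real j + 1" using vt by (auto simp: j_def)
    have Zv: "Zs v = level H (clock v) \<omega>" using Zs[OF sv] .
    let ?n1 = "clock (t - real j)" and ?n0 = "clock (t - real (j + 1))"
    have up: "Zs v \<le> x + 1 + Avar f x + Avar f 1 + \<epsilon> * a"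
    proof -
      have sj: "s \<le> t - real j" "0 \<le> t - real j" using j sv s by auto
      have "Zs v \<le> level H ?n1 \<omega>"
        unfolding Zv using v0 j by (intro level_mono clock_ge_1 clock_mono \<omega>(1)) auto
      moreover have "Psi ?n1 - s \<le> x + 1" using Psi_clock_le[OF sj(2)] j by (simp add: v_def)
      moreover have "Avar f (Psi ?n1 - s) \<le> Avar f x + Avar f 1"
      proof -
        have "H \<le> ?n1" using le_clock_iff[OF sj(2) H1] sj H by simp
        then have "0 \<le> Psi ?n1 - s" using Psi_le_iff[OF H1 clock_ge_1[OF sj(2)]] H by simp
        then have "Avar f (Psi ?n1 - s) \<le> Avar f (x + 1)"
          using \<open>Psi ?n1 - s \<le> x + 1\<close> by (intro Avar_mono)
        also have "\<dots> \<le> Avar f x + Avar f 1" using x1 by (intro Avar_subadd) auto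
        finally show ?thesis .
      qed
      ultimately show ?thesis using past[OF sj(1)] by linarith
    qed
    have lo: "x - 2 + Avar f x - Avar f 2 - \<epsilon> * a \<le> Zs v"
    proof -
      have sj: "s \<le> t - real (j + 1)" "0 \<le> t - real (j + 1)" using j x1 s by (auto simp: v_def)
      have "level H ?n0 \<omega> \<le> Zs v"
        unfolding Zv using sj j by (intro level_mono clock_ge_1 clock_mono \<omega>(1)) auto
      moreover have x2: "x - 2 \<le> Psi ?n0 - s" using clock_gt[OF sj(2)] j by (simp add: v_def)
      moreover have "Avar f x \<le> Avar f (Psi ?n0 - s) + Avar f 2"
      proof -
        have "H \<le> ?n0" using le_clock_iff[OF sj(2) H1] sj H by simp
        then have "0 \<le> Psi ?n0 - s" using Psi_le_iff[OF H1 clock_ge_1[OF sj(2)]] H by simp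
        moreover have "Avar f x \<le> Avar f ((Psi ?n0 - s) + 2)"
          using x1 x2 by (intro Avar_mono) auto
        ultimately show ?thesis using Avar_subadd[of "Psi ?n0 - s" 2] by simp
      qed
      ultimately show ?thesis using past[OF sj(1)] by linarith
    qed
    have ut: "x \<le> t" using vt s by (simp add: v_def)
    then have u1: "u \<le> 1" using t by (simp add: x_def)
    have "\<bar>Avar f x / a - u powr \<rho>\<bar> \<le> \<epsilon>"
      using unif[of u] u_pos u1 by (simp add: x_def a_def mult.commute)
    then have "\<bar>Avar f x / a - u powr \<rho>\<bar> * a \<le> \<epsilon> * a" using a0 by (intro mult_right_mono) auto
    moreover have "\<bar>Avar f x / a - u powr \<rho>\<bar> * a = \<bar>Avar f x - a * u powr \<rho>\<bar>"
    proof -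
      have "\<bar>Avar f x / a - u powr \<rho>\<bar> * a = \<bar>(Avar f x / a - u powr \<rho>) * a\<bar>" using a0 by (simp add: abs_mult)
      also have "(Avar f x / a - u powr \<rho>) * a = Avar f x - a * u powr \<rho>" using a0 by (simp add: field_simps)
      finally show ?thesis .
    qed
    ultimately have Ax: "\<bar>Avar f x - a * u powr \<rho>\<bar> \<le> \<epsilon> * a" by simp
    have "u powr \<rho> \<le> 1" using u1 u_pos \<rho>_pos by (simp add: powr_le1)
    then have "min (u powr \<rho>) 1 = u powr \<rho>" by simp
    then show ?thesis using up lo Ax A2 B\<epsilon> \<epsilon>a by (simp add: abs_le_iff)
  next
    case False
    \<comment> \<open>After time \<open>t\<close>, the level of the hub grows at the same speed as artificial time.\<close>
    define j where "j = nat \<lfloor>v - t\<rfloor>"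
    have j: "real j \<le> v - t" "v - t < real j + 1" using False by (auto simp: j_def)
    have Zv: "Zs v = level H (clock v) \<omega>" using Zs[OF sv] .
    let ?n2 = "clock (t + real j)" and ?n3 = "clock (t + real (j + 1))"
    have "t * u \<le> t * U" using u t by (intro mult_left_mono) auto
    then have "v - t \<le> U * t" using st by (simp add: v_def x_def mult.commute)
    then have jU: "real (j + 1) \<le> U * t + 1" using j by simp
    have jh: "j \<in> {0..horizon U t}" "j + 1 \<in> {0..horizon U t}"
      using jU by (auto simp: horizon_def) linarith+
    have fut: "\<bar>level H (clock (t + real i)) \<omega> - L - (Psi (clock (t + real i)) - Psi n)\<bar> < \<epsilon> * a"
      if "i \<in> {0..horizon U t}" for i
      using \<omega>(1,5) that unfolding unusual_future_def H_def L_def n_def a_def by (auto simp: not_le)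
    have "level H ?n2 \<omega> \<le> Zs v" "Zs v \<le> level H ?n3 \<omega>"
      unfolding Zv using t j v0 by (intro level_mono clock_ge_1 clock_mono \<omega>(1); simp)+
    moreover have "t + real j - 1 < Psi ?n2" using t by (intro clock_gt) auto
    moreover have "Psi ?n3 \<le> t + real (j + 1)" using t by (intro Psi_clock_le) auto
    ultimately have Zd: "\<bar>Zs v - L - (v - t)\<bar> \<le> \<epsilon> * a + 2"
      using fut[OF jh(1)] fut[OF jh(2)] j Psi_n by (simp add: abs_le_iff abs_less_iff)
    have eq: "Zs v - x - a = (Zs v - L - (v - t)) + (L - t - a / 2) + (s - a / 2)"
      by (simp add: v_def)
    have sa: "\<bar>s - a / 2\<bar> \<le> 4 * (\<epsilon> * a)" using s_up s_lo \<epsilon>a by (simp add: abs_le_iff)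
    have "\<bar>Zs v - x - a\<bar> \<le> 7 * (\<epsilon> * a)"
      unfolding eq using Zd L sa B\<epsilon> A2 by (simp add: abs_le_iff)
    moreover have "1 - \<epsilon> \<le> min (u powr \<rho>) 1"
    proof (cases "1 \<le> u")
      case True
      then have "1 \<le> u powr \<rho>" using \<rho>_pos by (intro ge_one_powr_ge_zero) auto
      then show ?thesis using \<epsilon> by simp
    next
      case u1: False
      have "t - a < t * u" using False s_up \<epsilon>a unfolding v_def x_def by linarith
      then have "t * (1 - \<epsilon>) < t * u" using at by (simp add: algebra_simps)
      then have "1 - \<epsilon> < u" using t by simp
      moreover have "u powr 1 \<le> u powr \<rho>" using u1 u_pos \<rho>_le_1 by (intro powr_mono') auto
      ultimately show ?thesis using u_pos \<epsilon> by simp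
    qed
    then have "a * (1 - \<epsilon>) \<le> a * min (u powr \<rho>) 1" "a * min (u powr \<rho>) 1 \<le> a * 1"
      using a0 by (intro mult_left_mono; simp)+
    ultimately show ?thesis by (simp add: abs_le_iff algebra_simps)
  qed
  then show "\<bar>Z f (\<lambda>n. G n \<omega>) (S t \<omega>) (S t \<omega> + t * u) - t * u - Avar f t * min (u powr \<rho>) 1\<bar> \<le> 8 * \<epsilon> * Avar f t"
    by (simp add: Zs_def s_def a_def x_def v_def)
qed

lemma hub_evolution_in_prob:
  assumes \<epsilon>: "0 < \<epsilon>" "\<epsilon> \<le> 1 / 16" and U: "0 \<le> U" and u0: "0 < u\<^sub>0"
  obtains Bad where "\<forall>\<^sub>F t in at_top. Bad t \<in> events" "((\<lambda>t. prob (Bad t)) \<longlongrightarrow> 0) at_top"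
    "\<forall>\<^sub>F t in at_top. \<forall>\<omega>\<in>space M - Bad t.
      \<bar>S t \<omega> - Avar f t / 2\<bar> \<le> 4 * \<epsilon> * Avar f t \<and>
      \<bar>Z f (\<lambda>n. G n \<omega>) (S t \<omega>) t - t - Avar f t / 2\<bar> \<le> \<epsilon> * Avar f t \<and>
      (\<forall>u\<in>{u\<^sub>0..U}. \<bar>Z f (\<lambda>n. G n \<omega>) (S t \<omega>) (S t \<omega> + t * u) - t * u - Avar f t * min (u powr \<rho>) 1\<bar>
        \<le> 8 * \<epsilon> * Avar f t)"
proof -
  let ?\<delta> = "\<epsilon>\<^sup>2 / 8"
  define Bad where "Bad t = too_large ?\<delta> t \<union> none_large ?\<delta> t \<union> (unusual_past \<epsilon> ?\<delta> t \<union> unusual_future \<epsilon> U t)" for t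
  have e2: "\<epsilon>\<^sup>2 \<le> 1" using \<epsilon> by (simp add: power_le_one)
  have \<epsilon>1: "\<epsilon> \<le> 1" using \<epsilon> by simp
  have \<delta>: "0 < ?\<delta>" "?\<delta> \<le> 1 / 2" using \<epsilon> e2 by auto
  have ev: "\<forall>\<^sub>F t in at_top. too_large ?\<delta> t \<in> events \<and> none_large ?\<delta> t \<in> events \<and>
      unusual_past \<epsilon> ?\<delta> t \<in> events \<and> unusual_future \<epsilon> U t \<in> events"
    using eventually_ge_at_top[of 0] unusual_future_null(2)[OF \<epsilon>(1) \<epsilon>1 U]
    by eventually_elim (use sets_exceptional in auto)
  have 1: "\<forall>\<^sub>F t in at_top. Bad t \<in> events" using ev by eventually_elim (auto simp: Bad_def)
  have 2: "((\<lambda>t. prob (Bad t)) \<longlongrightarrow> 0) at_top"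
  proof (rule tendsto_sandwich[OF _ _ tendsto_const])
    show "((\<lambda>t. prob (too_large ?\<delta> t) + prob (none_large ?\<delta> t) + (prob (unusual_past \<epsilon> ?\<delta> t) + prob (unusual_future \<epsilon> U t))) \<longlongrightarrow> 0) at_top"
      using tendsto_add[OF tendsto_add[OF too_large_null[OF \<delta>] none_large_null[OF \<delta>]]
          tendsto_add[OF unusual_past_null[OF \<epsilon>(1)] unusual_future_null(1)[OF \<epsilon>(1) _ U]]] \<epsilon> by simp
    show "\<forall>\<^sub>F t in at_top. prob (Bad t) \<le> prob (too_large ?\<delta> t) + prob (none_large ?\<delta> t) + (prob (unusual_past \<epsilon> ?\<delta> t) + prob (unusual_future \<epsilon> U t))"
      using ev
    proof eventually_elim
      case (elim t)
      then show ?case unfolding Bad_def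
        by (intro order_trans[OF measure_Un_le] add_mono) auto
    qed
  qed auto
  define B where "B = 4 + Avar f 2"
  have "\<forall>\<^sub>F t in at_top. regime B (\<epsilon>\<^sup>2 / 32) t"
    using \<epsilon> Avar_nonneg[of 2] by (intro eventually_regime) (auto simp: B_def)
  moreover have "\<forall>\<^sub>F t in at_top. 1 / u\<^sub>0 \<le> t" by (rule eventually_ge_at_top)
  moreover have "\<forall>\<^sub>F t in at_top. \<forall>u\<in>{0..1}. \<bar>Avar f (u * t) / Avar f t - u powr \<rho>\<bar> \<le> \<epsilon>"
    using \<epsilon> by (intro Avar_uniform)
  ultimately have 3: "\<forall>\<^sub>F t in at_top. \<forall>\<omega>\<in>space M - Bad t.
      \<bar>S t \<omega> - Avar f t / 2\<bar> \<le> 4 * \<epsilon> * Avar f t \<and>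
      \<bar>Z f (\<lambda>n. G n \<omega>) (S t \<omega>) t - t - Avar f t / 2\<bar> \<le> \<epsilon> * Avar f t \<and>
      (\<forall>u\<in>{u\<^sub>0..U}. \<bar>Z f (\<lambda>n. G n \<omega>) (S t \<omega>) (S t \<omega> + t * u) - t * u - Avar f t * min (u powr \<rho>) 1\<bar>
        \<le> 8 * \<epsilon> * Avar f t)"
  proof eventually_elim
    case (elim t)
    have u0t: "1 \<le> u\<^sub>0 * t" using elim(2) u0 by (simp add: field_simps)
    have un: "\<And>u. u \<in> {0..1} \<Longrightarrow> \<bar>Avar f (u * t) / Avar f t - u powr \<rho>\<bar> \<le> \<epsilon>" using elim(3) by blast
    show ?case
    proof (intro ballI conjI)
      fix \<omega> assume "\<omega> \<in> space M - Bad t"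
      then have w: "\<omega> \<in> space M" "\<omega> \<notin> too_large ?\<delta> t" "\<omega> \<notin> none_large ?\<delta> t"
        "\<omega> \<notin> unusual_past \<epsilon> ?\<delta> t" "\<omega> \<notin> unusual_future \<epsilon> U t" by (auto simp: Bad_def)
      show "\<bar>S t \<omega> - Avar f t / 2\<bar> \<le> 4 * \<epsilon> * Avar f t"
        "\<bar>Z f (\<lambda>n. G n \<omega>) (S t \<omega>) t - t - Avar f t / 2\<bar> \<le> \<epsilon> * Avar f t"
        using hub_evolution(1,2)[OF \<epsilon> U elim(1) _ u0t un w] by (auto simp: B_def)
      fix u assume "u \<in> {u\<^sub>0..U}"
      then show "\<bar>Z f (\<lambda>n. G n \<omega>) (S t \<omega>) (S t \<omega> + t * u) - t * u - Avar f t * min (u powr \<rho>) 1\<bar> \<le> 8 * \<epsilon> * Avar f t"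
        using hub_evolution(3)[OF \<epsilon> U elim(1) _ u0t un w] by (auto simp: B_def)
    qed
  qed
  show ?thesis using that[OF 1 2 3] .
qed

end

section \<open>Path regularity of the evolution on the artificial scales\<close>

lemma clock_eqI: "1 \<le> n \<Longrightarrow> Psi n \<le> w \<Longrightarrow> w < Psi (Suc n) \<Longrightarrow> clock w = n"
proof -
  assume n: "1 \<le> n" "Psi n \<le> w" "w < Psi (Suc n)"
  have w: "0 \<le> w" using n Psi_nonneg[of n] by simp
  have "n \<le> clock w" using le_clock_iff[OF w n(1)] n by simp
  moreover have "\<not> Suc n \<le> clock w" using le_clock_iff[OF w, of "Suc n"] n by simp
  ultimately show ?thesis by simp
qed

lemma clock_less: "0 \<le> v \<Longrightarrow> v < Psi (Suc (clock v))"
  using le_clock_iff[of v "Suc (clock v)"] by simp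

lemma clock_at_right: "0 \<le> v \<Longrightarrow> \<forall>\<^sub>F w in at_right v. clock w = clock v"
proof -
  assume v: "0 \<le> v"
  have "\<forall>\<^sub>F w in at_right v. w \<in> {v<..<Psi (Suc (clock v))}"
    using clock_less[OF v] by (rule eventually_at_right_real)
  then show ?thesis
    by eventually_elim (use Psi_clock_le[OF v] clock_ge_1[OF v] in \<open>auto intro!: clock_eqI\<close>)
qed

lemma clock_at_left: "0 < v \<Longrightarrow> \<exists>n. \<forall>\<^sub>F w in at_left v. clock w = n"
proof -
  assume v: "0 < v"
  let ?n = "clock v"
  have n1: "1 \<le> ?n" and le: "Psi ?n \<le> v" using v clock_ge_1[of v] Psi_clock_le[of v] by auto
  show ?thesis
  proof (cases "Psi ?n < v")
    case True
    have "\<forall>\<^sub>F w in at_left v. w \<in> {Psi ?n<..<v}" using True by (rule eventually_at_left_real)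
    then have "\<forall>\<^sub>F w in at_left v. clock w = ?n"
      by eventually_elim (use n1 clock_less[of v] v in \<open>auto intro!: clock_eqI\<close>)
    then show ?thesis by blast
  next
    case False
    then have eq: "Psi ?n = v" using le by simp
    then have "?n \<noteq> 1" using v by auto
    then obtain k where k: "?n = Suc k" "1 \<le> k" using n1 by (cases ?n) auto
    have "Psi k < v" using Psi_less[of k ?n] k eq by simp
    then have "\<forall>\<^sub>F w in at_left v. w \<in> {Psi k<..<v}" by (rule eventually_at_left_real)
    then have "\<forall>\<^sub>F w in at_left v. clock w = k"
      by eventually_elim (use k eq in \<open>auto intro!: clock_eqI\<close>)
    then show ?thesis by blast
  qed
qed

text \<open>The paths are step functions of \<open>clock\<close> minus a linear function.\<close>

lemma Z_path_cadlag:
  assumes m: "1 \<le> m" and t: "0 < t"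
  shows "(\<lambda>u. (Z f \<gamma> (Psi m) (Psi m + t * u) - t * u) / c) \<in> cadlag_pos"
  unfolding cadlag_pos_def
proof (intro CollectI allI impI conjI)
  fix u :: real assume u: "0 < u"
  let ?v = "Psi m + t * u"
  define g where "g k = Phi f (real (indegree (\<gamma> (max m k)) m))" for k
  have v: "0 < ?v" using u t Psi_nonneg[of m] by (simp add: add_nonneg_pos)
  have Zg: "Z f \<gamma> (Psi m) w = g (clock w)" if "0 \<le> w" for w using Z_Psi[OF m that] by (simp add: g_def)
  have pos: "\<forall>\<^sub>F x in at u. 0 < x" using u by (intro order_tendstoD(1)[OF tendsto_ident_at])
  have shift_right: "filterlim (\<lambda>x. Psi m + t * x) (at_right ?v) (at_right u)"
    unfolding filterlim_at using t
    by (intro conjI tendsto_intros eventually_at_right_less[THEN eventually_mono]) auto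
  have shift_left: "filterlim (\<lambda>x. Psi m + t * x) (at_left ?v) (at_left u)"
    unfolding filterlim_at using t
    by (intro conjI tendsto_intros eventually_at_left_real[of "u - 1" u, THEN eventually_mono]) auto
  have nonneg: "0 \<le> Psi m + t * x" if "0 < x" for x using that t Psi_nonneg[of m] by simp
  have "\<forall>\<^sub>F x in at_right u. clock (Psi m + t * x) = clock ?v"
    using eventually_compose_filterlim[OF clock_at_right shift_right] v by simp
  moreover have "\<forall>\<^sub>F x in at_right u. 0 < x"
    using pos by (simp add: eventually_at_split)
  ultimately have "\<forall>\<^sub>F x in at_right u. Z f \<gamma> (Psi m) (Psi m + t * x) = Z f \<gamma> (Psi m) ?v"
    by eventually_elim (use Zg nonneg u in simp)
  then have "((\<lambda>x. Z f \<gamma> (Psi m) (Psi m + t * x)) \<longlongrightarrow> Z f \<gamma> (Psi m) ?v) (at_right u)"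
    by (rule tendsto_eventually)
  then show "((\<lambda>u. (Z f \<gamma> (Psi m) (Psi m + t * u) - t * u) / c) \<longlongrightarrow> (Z f \<gamma> (Psi m) ?v - t * u) / c) (at_right u)"
    unfolding divide_inverse by (intro tendsto_intros)
  obtain k where "\<forall>\<^sub>F w in at_left ?v. clock w = k" using clock_at_left[OF v] by blast
  from eventually_compose_filterlim[OF this shift_left]
  have "\<forall>\<^sub>F x in at_left u. clock (Psi m + t * x) = k" .
  moreover have "\<forall>\<^sub>F x in at_left u. 0 < x"
    using pos by (simp add: eventually_at_split)
  ultimately have "\<forall>\<^sub>F x in at_left u. Z f \<gamma> (Psi m) (Psi m + t * x) = g k"
    by eventually_elim (use Zg nonneg in simp)
  then have "((\<lambda>x. Z f \<gamma> (Psi m) (Psi m + t * x)) \<longlongrightarrow> g k) (at_left u)"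
    by (rule tendsto_eventually)
  then have "((\<lambda>u. (Z f \<gamma> (Psi m) (Psi m + t * u) - t * u) / c) \<longlongrightarrow> (g k - t * u) / c) (at_left u)"
    unfolding divide_inverse by (intro tendsto_intros)
  then show "\<exists>l. ((\<lambda>u. (Z f \<gamma> (Psi m) (Psi m + t * u) - t * u) / c) \<longlongrightarrow> l) (at_left u)" by blast
qed

section \<open>Asymptotics of the hub\<close>

context hub_network
begin

lemma Z_hub:
  assumes "0 \<le> t" "\<omega> \<in> space M"
  shows "Z f (\<lambda>n. G n \<omega>) (S t \<omega>) t = Phi f (real (indegree (G (clock t) \<omega>) (label (S t \<omega>))))"
proof -
  have "1 \<le> hub_label t \<omega>" "hub_label t \<omega> \<le> clock t"
    using hub_facts(1)[OF assms] by auto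
  then have "Z f (\<lambda>n. G n \<omega>) (Psi (hub_label t \<omega>)) t = Phi f (real (indegree (G (clock t) \<omega>) (hub_label t \<omega>)))"
    using Z_Psi[of "hub_label t \<omega>" t f "\<lambda>n. G n \<omega>"] assms by (simp add: max_def)
  then show ?thesis
    unfolding hub_facts(2)[OF assms, symmetric] unfolding hub_label_def .
qed

lemma prob_tendsto_0:
  assumes "\<forall>\<^sub>F t in at_top. Bad t \<in> events" "((\<lambda>t. prob (Bad t)) \<longlongrightarrow> 0) at_top"
    and "\<forall>\<^sub>F t in at_top. X t \<subseteq> Bad t"
  shows "((\<lambda>t::real. prob (X t)) \<longlongrightarrow> 0) at_top"
proof (rule tendsto_sandwich[OF _ _ tendsto_const assms(2)])
  show "\<forall>\<^sub>F t in at_top. prob (X t) \<le> prob (Bad t)"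
    using assms(1,3) by eventually_elim (rule finite_measure_mono)
qed auto

lemma normalisation:
  assumes "0 < t"
  shows "t powr ((1 - 2 * \<alpha>) / (1 - \<alpha>)) / l_bar f \<alpha> t = t / f_bar f t"
proof -
  have "(1 - 2 * \<alpha>) / (1 - \<alpha>) + \<alpha> / (1 - \<alpha>) = 1"
    using \<alpha>_less by (simp add: add_divide_distrib[symmetric])
  then have "t powr ((1 - 2 * \<alpha>) / (1 - \<alpha>)) * t powr (\<alpha> / (1 - \<alpha>)) = t"
    using assms by (simp add: powr_add[symmetric])
  then show ?thesis using f_bar_pos[of t] by (simp add: l_bar_def)
qed

lemma f_bar_normalisation:
  assumes "0 < \<epsilon>"
  shows "\<forall>\<^sub>F t in at_top. \<exists>b. \<bar>b - \<kappa>\<bar> \<le> \<epsilon> \<and> b * (t / f_bar f t) = Avar f t"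
proof -
  have "\<forall>\<^sub>F t in at_top. dist (Avar f t * f_bar f t / t) \<kappa> < \<epsilon>"
    using Avar_f_bar assms by (rule tendstoD)
  then show ?thesis using eventually_gt_at_top[of 0]
  proof eventually_elim
    case (elim t)
    then show ?case
      using f_bar_pos[of t] by (intro exI[of _ "Avar f t * f_bar f t / t"]) (auto simp: dist_real_def)
  qed
qed

lemma hub_index_equiv:
  "asymp_equiv_in_prob M S (\<lambda>t \<omega>. Z f (\<lambda>n. G n \<omega>) (S t \<omega>) t - t) at_top"
  unfolding asymp_equiv_in_prob_def tendsto_in_prob_def
proof (intro allI impI conjI)
  fix e :: real assume e: "0 < e"
  let ?Y = "\<lambda>t \<omega>. Z f (\<lambda>n. G n \<omega>) (S t \<omega>) t - t"
  show "\<forall>\<^sub>F t in at_top. {\<omega> \<in> space M. \<bar>S t \<omega> / ?Y t \<omega> - 1\<bar> > e} \<in> events"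
    using eventually_ge_at_top[of 0]
  proof eventually_elim
    case (elim t)
    have "{\<omega> \<in> space M. \<bar>S t \<omega> / ?Y t \<omega> - 1\<bar> > e} =
      {\<omega> \<in> space M. \<bar>S t \<omega> / (Phi f (real (indegree (G (clock t) \<omega>) (label (S t \<omega>)))) - t) - 1\<bar> > e}"
      using Z_hub[OF elim] by auto
    also have "\<dots> \<in> events"
      using sets_hub[OF elim order_refl, of "\<lambda>s g. \<bar>s / (Phi f (real (indegree g (label s))) - t) - 1\<bar> > e"] .
    finally show ?case .
  qed
  define \<epsilon> where "\<epsilon> = min (e / 20) (1 / 16)"
  have \<epsilon>: "0 < \<epsilon>" "\<epsilon> \<le> 1 / 16" "20 * \<epsilon> \<le> e" using e by (auto simp: \<epsilon>_def)
  obtain Bad where Bad: "\<forall>\<^sub>F t in at_top. Bad t \<in> events" "((\<lambda>t. prob (Bad t)) \<longlongrightarrow> 0) at_top"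
    and good: "\<forall>\<^sub>F t in at_top. \<forall>\<omega>\<in>space M - Bad t.
      \<bar>S t \<omega> - Avar f t / 2\<bar> \<le> 4 * \<epsilon> * Avar f t \<and> \<bar>?Y t \<omega> - Avar f t / 2\<bar> \<le> \<epsilon> * Avar f t \<and>
      (\<forall>u\<in>{1..1}. \<bar>Z f (\<lambda>n. G n \<omega>) (S t \<omega>) (S t \<omega> + t * u) - t * u - Avar f t * min (u powr \<rho>) 1\<bar>
        \<le> 8 * \<epsilon> * Avar f t)"
    by (rule hub_evolution_in_prob[OF \<epsilon>(1,2), of 1 1]) auto
  show "((\<lambda>t. prob {\<omega> \<in> space M. \<bar>S t \<omega> / ?Y t \<omega> - 1\<bar> > e}) \<longlongrightarrow> 0) at_top"
  proof (rule prob_tendsto_0[OF Bad])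
    show "\<forall>\<^sub>F t in at_top. {\<omega> \<in> space M. \<bar>S t \<omega> / ?Y t \<omega> - 1\<bar> > e} \<subseteq> Bad t"
      using good eventually_gt_at_top[of 0]
    proof eventually_elim
      case (elim t)
      have "\<bar>S t \<omega> / ?Y t \<omega> - 1\<bar> \<le> e" if w: "\<omega> \<in> space M - Bad t" for \<omega>
      proof -
        let ?a = "Avar f t"
        have a: "0 < ?a" using elim Avar_pos by simp
        have S: "\<bar>S t \<omega> - ?a / 2\<bar> \<le> 4 * (\<epsilon> * ?a)" and Y: "\<bar>?Y t \<omega> - ?a / 2\<bar> \<le> \<epsilon> * ?a"
          using elim(1) w by (auto simp: mult.assoc)
        have "\<epsilon> * ?a \<le> 1 / 16 * ?a" using \<epsilon> a by (intro mult_right_mono) auto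
        then have Ya: "?a / 4 \<le> ?Y t \<omega>" using Y by linarith
        then have Y0: "0 < ?Y t \<omega>" using a by linarith
        have "\<bar>S t \<omega> - ?Y t \<omega>\<bar> \<le> 20 * \<epsilon> * (?a / 4)" using S Y by (simp add: abs_le_iff)
        also have "\<dots> \<le> 20 * \<epsilon> * ?Y t \<omega>" using Ya \<epsilon> by (intro mult_left_mono) auto
        also have "\<dots> \<le> e * ?Y t \<omega>" using Y0 \<epsilon> by (intro mult_right_mono) auto
        finally have "\<bar>S t \<omega> - ?Y t \<omega>\<bar> / ?Y t \<omega> \<le> e" using Y0 by (simp add: pos_divide_le_eq)
        moreover have "\<bar>S t \<omega> - ?Y t \<omega>\<bar> / ?Y t \<omega> = \<bar>S t \<omega> / ?Y t \<omega> - 1\<bar>"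
        proof -
          have "S t \<omega> / ?Y t \<omega> - 1 = (S t \<omega> - ?Y t \<omega>) / ?Y t \<omega>" using Y0 by (simp add: diff_divide_distrib)
          then show ?thesis using Y0 by (simp add: abs_divide)
        qed
        ultimately show ?thesis by simp
      qed
      then show ?case by force
    qed
  qed
qed

lemma hub_degree_equiv:
  "asymp_equiv_in_prob M (\<lambda>t \<omega>. Z f (\<lambda>n. G n \<omega>) (S t \<omega>) t - t)
    (\<lambda>t \<omega>. 1 / 2 * ((1 - \<alpha>) / (1 - 2 * \<alpha>)) * (t powr ((1 - 2 * \<alpha>) / (1 - \<alpha>)) / l_bar f \<alpha> t)) at_top"
  unfolding asymp_equiv_in_prob_def tendsto_in_prob_def
proof (intro allI impI conjI)
  fix e :: real assume e: "0 < e"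
  let ?Y = "\<lambda>t \<omega>. Z f (\<lambda>n. G n \<omega>) (S t \<omega>) t - t"
  let ?c = "\<lambda>t. 1 / 2 * ((1 - \<alpha>) / (1 - 2 * \<alpha>)) * (t powr ((1 - 2 * \<alpha>) / (1 - \<alpha>)) / l_bar f \<alpha> t)"
  show "\<forall>\<^sub>F t in at_top. {\<omega> \<in> space M. \<bar>?Y t \<omega> / ?c t - 1\<bar> > e} \<in> events"
    using eventually_ge_at_top[of 0]
  proof eventually_elim
    case (elim t)
    have "{\<omega> \<in> space M. \<bar>?Y t \<omega> / ?c t - 1\<bar> > e} =
      {\<omega> \<in> space M. \<bar>(Phi f (real (indegree (G (clock t) \<omega>) (label (S t \<omega>)))) - t) / ?c t - 1\<bar> > e}"
      using Z_hub[OF elim] by auto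
    also have "\<dots> \<in> events"
      using sets_hub[OF elim order_refl, of "\<lambda>s g. \<bar>(Phi f (real (indegree g (label s))) - t) / ?c t - 1\<bar> > e"] .
    finally show ?case .
  qed
  define \<epsilon> where "\<epsilon> = min (e / 4) (1 / 16)"
  have \<epsilon>: "0 < \<epsilon>" "\<epsilon> \<le> 1 / 16" "4 * \<epsilon> \<le> e" using e by (auto simp: \<epsilon>_def)
  obtain Bad where Bad: "\<forall>\<^sub>F t in at_top. Bad t \<in> events" "((\<lambda>t. prob (Bad t)) \<longlongrightarrow> 0) at_top"
    and good: "\<forall>\<^sub>F t in at_top. \<forall>\<omega>\<in>space M - Bad t.
      \<bar>S t \<omega> - Avar f t / 2\<bar> \<le> 4 * \<epsilon> * Avar f t \<and> \<bar>?Y t \<omega> - Avar f t / 2\<bar> \<le> \<epsilon> * Avar f t \<and>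
      (\<forall>u\<in>{1..1}. \<bar>Z f (\<lambda>n. G n \<omega>) (S t \<omega>) (S t \<omega> + t * u) - t * u - Avar f t * min (u powr \<rho>) 1\<bar>
        \<le> 8 * \<epsilon> * Avar f t)"
    by (rule hub_evolution_in_prob[OF \<epsilon>(1,2), of 1 1]) auto
  show "((\<lambda>t. prob {\<omega> \<in> space M. \<bar>?Y t \<omega> / ?c t - 1\<bar> > e}) \<longlongrightarrow> 0) at_top"
  proof (rule prob_tendsto_0[OF Bad])
    show "\<forall>\<^sub>F t in at_top. {\<omega> \<in> space M. \<bar>?Y t \<omega> / ?c t - 1\<bar> > e} \<subseteq> Bad t"
      using good eventually_gt_at_top[of 0] f_bar_normalisation[OF \<epsilon>(1)]
    proof eventually_elim
      case (elim t)
      let ?a = "Avar f t"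
      have a: "0 < ?a" using elim Avar_pos by simp
      obtain b where b: "\<bar>b - \<kappa>\<bar> \<le> \<epsilon>" "b * (t / f_bar f t) = ?a" using elim(3) by blast
      have b0: "0 < b" using b(1) \<epsilon> \<kappa>_ge_1 by linarith
      have c: "?c t = \<kappa> * ?a / (2 * b)"
        unfolding normalisation[OF elim(2)] \<kappa>_def[symmetric] b(2)[symmetric] using b0 by simp
      have "\<bar>?Y t \<omega> / ?c t - 1\<bar> \<le> e" if w: "\<omega> \<in> space M - Bad t" for \<omega>
      proof -
        define y where "y = 2 * ?Y t \<omega> / ?a"
        define q where "q = b / \<kappa>"
        have "\<bar>?Y t \<omega> - ?a / 2\<bar> \<le> \<epsilon> * ?a" using elim(1) w by auto
        also have "?Y t \<omega> - ?a / 2 = (y - 1) * (?a / 2)" using a by (simp add: y_def field_simps)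
        also have "\<epsilon> * ?a = 2 * \<epsilon> * (?a / 2)" by simp
        finally have "\<bar>y - 1\<bar> * (?a / 2) \<le> 2 * \<epsilon> * (?a / 2)" using a by (simp add: abs_mult)
        then have y: "\<bar>y - 1\<bar> \<le> 2 * \<epsilon>" by (rule mult_right_le_imp_le) (use a in simp)
        have "q - 1 = (b - \<kappa>) / \<kappa>" using \<kappa>_pos by (simp add: q_def diff_divide_distrib)
        then have "\<bar>q - 1\<bar> = \<bar>b - \<kappa>\<bar> / \<kappa>" using \<kappa>_pos by (simp add: abs_divide)
        also have "\<dots> \<le> \<epsilon> / 1" using b \<kappa>_ge_1 by (intro frac_le) auto
        finally have q: "\<bar>q - 1\<bar> \<le> \<epsilon>" by simp
        have eq: "?Y t \<omega> / ?c t - 1 = (y - 1) * q + (q - 1)"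
          unfolding c y_def q_def using a b0 \<kappa>_pos by (simp add: field_simps)
        have "\<bar>q\<bar> \<le> 1 + \<epsilon>" using q by linarith
        then have "\<bar>(y - 1) * q\<bar> \<le> (2 * \<epsilon>) * (1 + \<epsilon>)"
          unfolding abs_mult using y \<epsilon> by (intro mult_mono) auto
        also have "\<dots> \<le> (2 * \<epsilon>) * (3 / 2)" using \<epsilon> by (intro mult_left_mono) auto
        finally show ?thesis unfolding eq using q \<epsilon> by linarith
      qed
      then show ?case by force
    qed
  qed
qed

lemma hub_path_limit:
  "tendsto_in_prob_cadlag M
    (\<lambda>t \<omega> u. (Z f (\<lambda>n. G n \<omega>) (S t \<omega>) (S t \<omega> + t * u) - t * u) /
      (t powr ((1 - 2 * \<alpha>) / (1 - \<alpha>)) * inverse (l_bar f \<alpha> t)))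
    (\<lambda>u. (1 - \<alpha>) / (1 - 2 * \<alpha>) * min (u powr ((1 - 2 * \<alpha>) / (1 - \<alpha>))) 1) at_top"
  unfolding tendsto_in_prob_cadlag_def \<rho>_def[symmetric] \<kappa>_def[symmetric]
proof (intro conjI allI impI)
  let ?c = "\<lambda>t. t powr \<rho> * inverse (l_bar f \<alpha> t)"
  let ?X = "\<lambda>t \<omega> u. (Z f (\<lambda>n. G n \<omega>) (S t \<omega>) (S t \<omega> + t * u) - t * u) / ?c t"
  let ?x = "\<lambda>u. \<kappa> * min (u powr \<rho>) 1"
  show "?x \<in> cadlag_pos"
    unfolding cadlag_pos_def
  proof (intro CollectI allI impI conjI)
    fix u :: real assume u: "0 < u"
    have *: "(?x \<longlongrightarrow> ?x u) (at u within A)" for A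
      using u by (intro tendsto_intros) auto
    show "(?x \<longlongrightarrow> ?x u) (at_right u)" by (rule *)
    show "\<exists>l. (?x \<longlongrightarrow> l) (at_left u)" using * by blast
  qed
  show "\<forall>\<^sub>F t in at_top. \<forall>\<omega>\<in>space M. ?X t \<omega> \<in> cadlag_pos"
    using eventually_gt_at_top[of 0]
  proof eventually_elim
    case (elim t)
    show ?case
    proof
      fix \<omega> assume "\<omega> \<in> space M"
      then show "?X t \<omega> \<in> cadlag_pos"
        using hub_facts(1,2)[of t \<omega>] elim Z_path_cadlag[of "hub_label t \<omega>" t f "\<lambda>n. G n \<omega>" "?c t"] by simp
    qed
  qed
  fix K :: "real set" and e :: real
  assume Ke: "compact K \<and> K \<subseteq> {0<..} \<and> 0 < e"
  obtain u\<^sub>0 U where u0: "0 < u\<^sub>0" "0 \<le> U" and K: "K \<subseteq> {u\<^sub>0..U}"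
  proof (cases "K = {}")
    case True
    then show ?thesis using that[of 1 1] by simp
  next
    case False
    obtain l where l: "l \<in> K" "\<And>x. x \<in> K \<Longrightarrow> l \<le> x" using compact_attains_inf[of K] False Ke by blast
    obtain h where h: "h \<in> K" "\<And>x. x \<in> K \<Longrightarrow> x \<le> h" using compact_attains_sup[of K] False Ke by blast
    have "0 < l" "0 < h" using l h Ke by auto
    moreover have "K \<subseteq> {l..h}" using l(2) h(2) by auto
    ultimately show ?thesis using that[of l h] by simp
  qed
  let ?A = "\<lambda>t. {\<omega> \<in> space M. \<exists>u\<in>K. \<bar>?X t \<omega> u - ?x u\<bar> > e}"
  show "\<forall>\<^sub>F t in at_top. ?A t \<in> events"
    using eventually_gt_at_top[of 0]
  proof eventually_elim
    case (elim t)
    then have t: "0 \<le> t" by simp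
    let ?N = "clock (t + t * U)"
    have N: "clock t \<le> ?N" using elim u0 by (intro clock_mono) auto
    let ?Q = "\<lambda>s g. \<exists>u\<in>K. \<bar>(Z f (\<lambda>n. restrict_network n g) s (s + t * u) - t * u) / ?c t - ?x u\<bar> > e"
    have Zeq: "Z f (\<lambda>n. G n \<omega>) (S t \<omega>) (S t \<omega> + t * u) =
        Z f (\<lambda>n. restrict_network n (G ?N \<omega>)) (S t \<omega>) (S t \<omega> + t * u)" if w: "\<omega> \<in> space M" and u: "u \<in> K" for \<omega> u
    proof -
      let ?m = "hub_label t \<omega>"
      have m: "1 \<le> ?m" "?m \<le> clock t" "S t \<omega> = Psi ?m" using hub_facts[OF t w] by auto
      have tu: "0 \<le> t * u" "t * u \<le> t * U" using elim u K u0 by (auto intro!: mult_left_mono)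
      have "Psi ?m \<le> t" using le_clock_iff[OF t m(1)] m by simp
      then have "clock (Psi ?m + t * u) \<le> ?N" using tu Psi_nonneg[of ?m] by (intro clock_mono) auto
      moreover have pos: "0 \<le> Psi ?m + t * u" using tu Psi_nonneg[of ?m] by simp
      ultimately have "max ?m (clock (Psi ?m + t * u)) \<le> ?N" "1 \<le> max ?m (clock (Psi ?m + t * u))"
        using m N by auto
      then show ?thesis unfolding m(3) Z_Psi[OF m(1) pos] by (simp add: G_restrict[OF _ _ w, of _ ?N])
    qed
    have "?A t = {\<omega> \<in> space M. ?Q (S t \<omega>) (G ?N \<omega>)}"
      by (intro Collect_cong conj_cong bex_cong refl) (simp add: Zeq)
    also have "\<dots> \<in> events" by (rule sets_hub[OF t N])
    finally show ?case .
  qed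
  define \<epsilon> where "\<epsilon> = min (e / (9 * (\<kappa> + 1))) (1 / 16)"
  have "\<epsilon> \<le> 1 / 16" unfolding \<epsilon>_def by (rule min.cobounded2)
  moreover have "0 < \<epsilon>" using Ke \<kappa>_pos by (simp add: \<epsilon>_def)
  ultimately have \<epsilon>: "0 < \<epsilon>" "\<epsilon> \<le> 1 / 16" by simp_all
  have "\<epsilon> \<le> e / (9 * (\<kappa> + 1))" by (simp add: \<epsilon>_def)
  then have \<epsilon>e: "9 * \<epsilon> * (\<kappa> + 1) \<le> e" using \<kappa>_pos by (simp add: field_simps)
  obtain Bad where Bad: "\<forall>\<^sub>F t in at_top. Bad t \<in> events" "((\<lambda>t. prob (Bad t)) \<longlongrightarrow> 0) at_top"
    and good: "\<forall>\<^sub>F t in at_top. \<forall>\<omega>\<in>space M - Bad t.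
      \<bar>S t \<omega> - Avar f t / 2\<bar> \<le> 4 * \<epsilon> * Avar f t \<and>
      \<bar>Z f (\<lambda>n. G n \<omega>) (S t \<omega>) t - t - Avar f t / 2\<bar> \<le> \<epsilon> * Avar f t \<and>
      (\<forall>u\<in>{u\<^sub>0..U}. \<bar>Z f (\<lambda>n. G n \<omega>) (S t \<omega>) (S t \<omega> + t * u) - t * u - Avar f t * min (u powr \<rho>) 1\<bar>
        \<le> 8 * \<epsilon> * Avar f t)"
    by (rule hub_evolution_in_prob[OF \<epsilon> u0(2,1)])
  show "((\<lambda>t. prob (?A t)) \<longlongrightarrow> 0) at_top"
  proof (rule prob_tendsto_0[OF Bad])
    show "\<forall>\<^sub>F t in at_top. ?A t \<subseteq> Bad t"
      using good eventually_gt_at_top[of 0] f_bar_normalisation[OF \<epsilon>(1)]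
    proof eventually_elim
      case (elim t)
      let ?a = "Avar f t"
      have a: "0 < ?a" using elim Avar_pos by simp
      obtain b where b: "\<bar>b - \<kappa>\<bar> \<le> \<epsilon>" "b * (t / f_bar f t) = ?a" using elim(3) by blast
      have b0: "0 < b" using b(1) \<epsilon> \<kappa>_ge_1 by linarith
      have "?c t = t powr \<rho> / l_bar f \<alpha> t" by (simp only: divide_inverse)
      also have "\<dots> = t / f_bar f t" using normalisation[OF elim(2)] by (simp only: \<rho>_def)
      also have "\<dots> = ?a / b" unfolding b(2)[symmetric] using b0 by simp
      finally have c: "?c t = ?a / b" .
      have "\<bar>?X t \<omega> u - ?x u\<bar> \<le> e" if w: "\<omega> \<in> space M - Bad t" and u: "u \<in> K" for \<omega> u
      proof -
        define z where "z = (Z f (\<lambda>n. G n \<omega>) (S t \<omega>) (S t \<omega> + t * u) - t * u) / ?a"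
        define y where "y = min (u powr \<rho>) 1"
        have "\<bar>z * ?a - ?a * y\<bar> \<le> 8 * \<epsilon> * ?a"
          using elim(1) w u K a by (auto simp: z_def y_def)
        moreover have "\<bar>z * ?a - ?a * y\<bar> = \<bar>z - y\<bar> * ?a"
        proof -
          have "z * ?a - ?a * y = (z - y) * ?a" by (simp add: algebra_simps)
          then show ?thesis using a by (simp add: abs_mult)
        qed
        ultimately have zy: "\<bar>z - y\<bar> \<le> 8 * \<epsilon>" using a by (simp add: mult_le_cancel_right)
        have y: "0 \<le> y" "y \<le> 1" by (auto simp: y_def)
        have eq: "?X t \<omega> u - ?x u = (z - y) * b + y * (b - \<kappa>)"
          unfolding c z_def y_def[symmetric] using a b0 by (simp add: field_simps)
        have "b \<le> \<kappa> + 1" using b(1) \<epsilon> by linarith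
        then have "\<bar>(z - y) * b\<bar> \<le> 8 * \<epsilon> * (\<kappa> + 1)"
          unfolding abs_mult using zy b0 \<epsilon> by (intro mult_mono) auto
        moreover have "\<bar>y * (b - \<kappa>)\<bar> \<le> 1 * \<epsilon>"
          unfolding abs_mult using y b(1) by (intro mult_mono) auto
        moreover have "\<epsilon> * 1 \<le> \<epsilon> * (\<kappa> + 1)" using \<epsilon> \<kappa>_pos by (intro mult_left_mono) auto
        ultimately show ?thesis unfolding eq using \<epsilon>e by (simp add: algebra_simps)
      qed
      then show ?case by force
    qed
  qed
qed

end

theorem theorem1p15:
  fixes M :: "'w measure"
    and f :: "nat \<Rightarrow> real"
    and \<alpha> :: real
    and G :: "nat \<Rightarrow> 'w \<Rightarrow> network"
    and S :: "real \<Rightarrow> 'w \<Rightarrow> real"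
  assumes "attachment_rule f"
    and "regularly_varying (step_ext f) \<alpha>"
    and "\<alpha> < 1 / 2"
    and "\<alpha> = 0 \<longrightarrow> filterlim f at_top sequentially"
    and "network_process M f G"
    and "hub_index M f G S"
  shows "asymp_equiv_in_prob M S (\<lambda>t \<omega>. Z f (\<lambda>n. G n \<omega>) (S t \<omega>) t - t) at_top
    \<and> asymp_equiv_in_prob M (\<lambda>t \<omega>. Z f (\<lambda>n. G n \<omega>) (S t \<omega>) t - t)
        (\<lambda>t \<omega>. 1 / 2 * ((1 - \<alpha>) / (1 - 2 * \<alpha>)) *
                (t powr ((1 - 2 * \<alpha>) / (1 - \<alpha>)) / l_bar f \<alpha> t)) at_top
    \<and> (\<forall>t>0. 1 / 2 * ((1 - \<alpha>) / (1 - 2 * \<alpha>)) *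
               (t powr ((1 - 2 * \<alpha>) / (1 - \<alpha>)) / l_bar f \<alpha> t)
             = 1 / 2 * ((1 - \<alpha>) / (1 - 2 * \<alpha>)) * (t / f_bar f t))
    \<and> tendsto_in_prob_cadlag M
        (\<lambda>t \<omega> u. (Z f (\<lambda>n. G n \<omega>) (S t \<omega>) (S t \<omega> + t * u) - t * u) /
                  (t powr ((1 - 2 * \<alpha>) / (1 - \<alpha>)) * inverse (l_bar f \<alpha> t)))
        (\<lambda>u. (1 - \<alpha>) / (1 - 2 * \<alpha>) * min (u powr ((1 - 2 * \<alpha>) / (1 - \<alpha>))) 1)
        at_top"
proof -
  interpret hub_network f \<alpha> M G S
    by unfold_locales (use assms in auto)
  show ?thesis
    using hub_index_equiv hub_degree_equiv normalisation hub_path_limit by simp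
qed

end
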